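(* Let $h\colon \mathbb{N}\to\mathbb{R}-\{0\}$ be a multiplicative function, and for each integer $\ell$ let $f_\ell(n)=e^{2\pi i \ell \log_{10}|h(n)|}$. Then $\{h(n)\}_{n\ge 1}$ is a strong Benford sequence if and only if $\mathbb{D}(f_\ell,n^{i\alpha};\infty)=\infty$ for all $\alpha\in\mathbb{R}$ and all integers $\ell\neq 0$.
   Context: $\mathbb{N}$ is the set of positive integers. A multiplicative function $h$ satisfies $h(mn)=h(m)h(n)$ whenever $\gcd(m,n)=1$. Strong Benford: Every positive real $a$ is written $a=10^{M}\sum_{j\ge 0} d_j 10^{-j}$ with $M\in\mathbb{Z}$, $1\le d_0\le 9$, $0\le d_j\le 9$ for $j\ge 1$ (usual convention: the digits are not eventually all $9$); the $d_j$ are the digits of $a$. A sequence $\{a_k\}_{k\ge1}$ of positive reals is strong Benford if for every positive integer $K$ and every digit string $S=d_0d_1\cdots d_{K-1}$ with $d_0\ne 0$, $$\lim_{N\to\infty}\frac{\#\{k\le N: \text{the first } K \text{ digits of } a_k \text{ are } d_0,\dots,d_{K-1}\}}{N}=\log_{10}(r+10^{-K+1})-\log_{10} r,\qquad r=\sum_{j=0}^{K-1}d_j10^{-j}.$$ A sequence of nonzero real numbers is called strong Benford if the sequence of absolute values is strong Benford. Distance: for multiplicative functions $f,g$ with values in $\{z\in\mathbb{C}:|z|\le 1\}$, $\mathbb{D}(f,g;x)=\Big(\sum_{p\le x}\frac{1-\mathrm{Re}(f(p)\overline{g(p)})}{p}\Big)^{1/2}$, the sum being over primes $p$; $\mathbb{D}(f,g;\infty)$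 is the (possibly infinite) limit as $x\to\infty$, i.e. the sum over all primes. Here $n^{i\alpha}$ denotes the function $n\mapsto n^{i\alpha}$. *)

theory Defs
  imports "HOL-Analysis.Analysis" "HOL-Computational_Algebra.Primes"
begin

text \<open>
  Functions on the positive integers are total functions on \<^typ>\<open>nat\<close>; their value at \<open>0\<close>
  is irrelevant and never constrained.
\<close>

definition multiplicative_fun :: "(nat \<Rightarrow> 'a::times) \<Rightarrow> bool" where
  "multiplicative_fun h \<longleftrightarrow> (\<forall>m\<ge>1. \<forall>n\<ge>1. coprime m n \<longrightarrow> h (m * n) = h m * h n)"

text \<open>
  The last conjunct excludes expansions that are eventually all \<open>9\<close>, which makes \<open>M\<close> and \<open>d\<close>
  unique for each \<open>a > 0\<close>.
\<close>

definition decimal_expansion :: "real \<Rightarrow> int \<Rightarrow> (nat \<Rightarrow> nat) \<Rightarrow> bool" where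
  "decimal_expansion a M d \<longleftrightarrow>
     1 \<le> d 0 \<and> (\<forall>j. d j \<le> 9) \<and>
     summable (\<lambda>j. real (d j) * 10 powi (- int j)) \<and>
     a = 10 powi M * (\<Sum>j. real (d j) * 10 powi (- int j)) \<and>
     \<not> (\<forall>\<^sub>F j in sequentially. d j = 9)"

text \<open>A digit string of length \<open>K\<close> is given by the values \<open>S 0, \<dots>, S (K - 1)\<close>.\<close>

definition first_digits :: "nat \<Rightarrow> (nat \<Rightarrow> nat) \<Rightarrow> real \<Rightarrow> bool" where
  "first_digits K S a \<longleftrightarrow> (\<exists>M d. decimal_expansion a M d \<and> (\<forall>j<K. d j = S j))"

definition digit_string :: "nat \<Rightarrow> (nat \<Rightarrow> nat) \<Rightarrow> bool" where
  "digit_string K S \<longleftrightarrow> S 0 \<noteq> 0 \<and> (\<forall>j<K. S j \<le> 9)"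

definition string_value :: "nat \<Rightarrow> (nat \<Rightarrow> nat) \<Rightarrow> real" where
  "string_value K S = (\<Sum>j<K. real (S j) * 10 powi (- int j))"

definition strong_benford_pos :: "(nat \<Rightarrow> real) \<Rightarrow> bool" where
  "strong_benford_pos a \<longleftrightarrow>
     (\<forall>K\<ge>1. \<forall>S. digit_string K S \<longrightarrow>
        (\<lambda>N. real (card {k \<in> {1..N}. first_digits K S (a k)}) / real N)
          \<longlonglongrightarrow> log 10 (string_value K S + 10 powi (1 - int K)) - log 10 (string_value K S))"

definition strong_benford :: "(nat \<Rightarrow> real) \<Rightarrow> bool" where
  "strong_benford a \<longleftrightarrow> strong_benford_pos (\<lambda>k. \<bar>a k\<bar>)"

definition pretentious_dist :: "(nat \<Rightarrow> complex) \<Rightarrow> (nat \<Rightarrow> complex) \<Rightarrow> real \<Rightarrow> real" where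
  "pretentious_dist f g x =
     sqrt (\<Sum>p | prime p \<and> real p \<le> x. (1 - Re (f p * cnj (g p))) / real p)"

text \<open>
  For \<open>f\<close> and \<open>g\<close> with values in the closed unit disc the distance is nondecreasing in \<open>x\<close>,
  so the limit exists in the extended reals.
\<close>

definition pretentious_dist_inf :: "(nat \<Rightarrow> complex) \<Rightarrow> (nat \<Rightarrow> complex) \<Rightarrow> ereal" where
  "pretentious_dist_inf f g = Lim at_top (\<lambda>x::real. ereal (pretentious_dist f g x))"

definition benford_char :: "(nat \<Rightarrow> real) \<Rightarrow> int \<Rightarrow> nat \<Rightarrow> complex" where
  "benford_char h l n = exp (2 * of_real pi * \<i> * of_int l * of_real (log 10 \<bar>h n\<bar>))"

end

(*
  By Weyl's criterion, strong Benford means that every f = f_l with l <> 0 has mean value 0, so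
  the theorem is a form of Halasz's theorem for unimodular multiplicative functions.

  If D(f, n^{i t}; oo) = oo for all t, the Euler product gives |F(s)| = o(1 / (sigma - 1)) uniformly for
  bounded t (compactness). Let L(s) be the Dirichlet series of Lambda f. Plancherel for the Poisson
  kernel 1 / (c^2 + t^2) bounds the partial sums of Lambda f * f in mean square by the integral of |F L|^2:
  on |t| <= T take out the supremum of |F|, and for |t| > T use 1 / (1 + t^2) <= 2 / (T^2 + t^2), the
  remaining integrals being controlled by majorants. As f log and Lambda f * f have partial sums
  differing by O(x), the sum of |S(n)| / n^2 over n <= x is o(log x). This passes to S(x) = o(x) through
  |S(x)| log x <= sum_d Lambda(d) |S(x / d)| + O(x), because S varies slowly enough to be replaced by its
  average over [u, (1 + delta) u].

  If D(f, n^{i t}; oo) < oo, the Euler product gives |F(sigma + i t)| >= c / (sigma - 1), which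
  contradicts mean value 0, unless f(2^k) = -2^{i k t} for all k >= 1. In that exceptional case f^2 is
  pretentious to n^{2 i t} without being exceptional itself.
*)
theory Submission
  imports Defs "HOL-Probability.Probability" "HOL-Complex_Analysis.Complex_Analysis"
    "HOL-Number_Theory.Number_Theory" "HOL-Real_Asymp.Real_Asymp"
begin

section \<open>The Poisson kernel\<close>

text \<open>As f need not be completely multiplicative, L is not -F'/F; only the product F L enters,
  and F is never inverted. Infinite Euler products are avoided too: a finite product is exact once
  multiplied by the sum over integers free of the chosen primes, and this remainder is compared with
  that of the zeta function.

  Both parts of the mean square integral have size (sigma - 1)^(-3), with a small factor epsilon^2
  or 1 / T. At sigma = 1 + 1 / log x this is o(log^3 x) for the sum of |A(n)|^2 / n^3, A being the
  partial sums of Lambda f * f. Balancing against the sum of 1 / n gives o(log^2 x) for the sum of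
  |S(n)| log n / n^2, and setting aside the n below a small power of x gives o(log x).

  The prime 2 is exceptional because an Euler factor differs from 1 by at most r / (1 - r) with r =
  p^(-sigma), and this reaches 1 only at r = 1/2. The way out is that the square of f_l is f_(2l),
  another nonzero frequency, so strong Benford gives it mean value 0 as well.\<close>

lemma integrable_inverse_square_plus:
  assumes "c > (0::real)"
  shows "integrable lborel (\<lambda>t. 1 / (c^2 + t^2))"
proof -
  have "integrable lborel (\<lambda>x::real. inverse (1 + x\<^sup>2))"
    using integrable_inverse_1_plus_square by (simp add: set_integrable_def)
  then have "integrable lborel (\<lambda>x::real. inverse (1 + (0 + inverse c * x)\<^sup>2))"
    using assms by (subst lborel_integrable_real_affine_iff) auto
  then have "integrable lborel (\<lambda>x::real. inverse (c^2) * inverse (1 + (0 + inverse c * x)\<^sup>2))"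
    by simp
  also have "(\<lambda>x::real. inverse (c^2) * inverse (1 + (0 + inverse c * x)\<^sup>2)) = (\<lambda>t. 1 / (c^2 + t^2))"
    using assms by (auto simp: field_simps power2_eq_square fun_eq_iff)
  finally show ?thesis .
qed

text \<open>Residue computation on the rectangle with base \<open>[-R, R]\<close> and height
  \<open>R\<close>, which encloses only the pole at \<open>\<i> * c\<close>. The other three sides
  have total length \<open>4 * R\<close>, and there the integrand is at most
  \<open>1 / (R^2 - c^2)\<close>, since \<open>y \<ge> 0\<close> keeps the exponential bounded by 1
  in the upper half plane.\<close>

lemma poisson_contour_bound:
  assumes c: "c > 0" and R: "R > c" and y: "y \<ge> (0::real)" 
  shows "cmod (integral {-R..R} (\<lambda>t. cis (t*y) / of_real (c^2+t^2)) - of_real (pi / c * exp (- c * y)))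
      \<le> 4 * R / (R^2 - c^2)"
proof -
  \<comment> \<open>Only the pole in the lower half plane stays in \<open>f\<close>; the other one
    is the Cauchy kernel in \<open>g\<close>.\<close>
  define f where "f = (\<lambda>z::complex. exp (\<i> * of_real y * z) / (z + \<i> * of_real c))"
  define g where "g = (\<lambda>z. f z / (z - \<i> * of_real c))"
  define a b where "a = Complex (-R) 0" and "b = Complex R R"
  have R0: "R > 0" using c R by simp
  have box: "\<i> * complex_of_real c \<in> box a b"
    using c R by (auto simp: a_def b_def in_box_complex_iff)
  have pimg: "path_image (rectpath a b) \<subseteq> cbox a b - {\<i> * complex_of_real c}"
    using path_image_rectpath_subset_cbox[of a b] path_image_rectpath_inter_box[of a b] box R0
    by (auto simp: a_def b_def)
  have cb: "cbox a b \<subseteq> {z. Im z > - c}" using c by (auto simp: a_def b_def in_cbox_complex_iff)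
  have hol: "f holomorphic_on {z. Im z > - c}"
    unfolding f_def by (intro holomorphic_intros) (auto simp: complex_eq_iff)
  have cf: "((\<lambda>w. f w / (w - \<i> * of_real c)) has_contour_integral
     (2 * pi * \<i> * winding_number (rectpath a b) (\<i> * of_real c) * f (\<i> * of_real c))) (rectpath a b)"
  proof (rule Cauchy_integral_formula_convex_simple)
    show "convex (cbox a b)" by simp
    show "f holomorphic_on cbox a b" using hol cb holomorphic_on_subset by blast
    show "\<i> * of_real c \<in> interior (cbox a b)" using box by (simp add: interior_cbox)
  qed (use pimg in auto)
  have "winding_number (rectpath a b) (\<i> * of_real c) = 1"
    using box by (rule winding_number_rectpath)
  moreover have "2 * pi * \<i> * f (\<i> * of_real c) = of_real (pi / c * exp (- c * y))"
    using c by (simp add: f_def field_simps exp_of_real[symmetric])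
  ultimately have tot: "(g has_contour_integral of_real (pi / c * exp (- c * y))) (rectpath a b)"
    using cf by (simp add: g_def)
  define a2 a4 where "a2 = Complex R 0" and "a4 = Complex (-R) R"
  have cont: "continuous_on (cbox a b - {\<i> * complex_of_real c}) g"
    unfolding g_def using hol cb
    by (intro continuous_intros continuous_on_subset[OF holomorphic_on_imp_continuous_on[OF hol]]) auto
  have rp: "rectpath a b = linepath a a2 +++ linepath a2 b +++ linepath b a4 +++ linepath a4 a"
    by (simp add: rectpath_def a_def b_def a2_def a4_def Let_def)
  have seg: "closed_segment a a2 \<subseteq> cbox a b - {\<i> * complex_of_real c}" 
       "closed_segment a2 b \<subseteq> cbox a b - {\<i> * complex_of_real c}"
       "closed_segment b a4 \<subseteq> cbox a b - {\<i> * complex_of_real c}"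
       "closed_segment a4 a \<subseteq> cbox a b - {\<i> * complex_of_real c}"
    using pimg unfolding rp by (auto simp: path_image_join)
  have ci: "g contour_integrable_on linepath a a2" "g contour_integrable_on linepath a2 b"
           "g contour_integrable_on linepath b a4" "g contour_integrable_on linepath a4 a"
    by (rule contour_integrable_continuous_linepath, rule continuous_on_subset[OF cont], fact seg)+
  have "(g has_contour_integral contour_integral (linepath a a2) g +
      (contour_integral (linepath a2 b) g + (contour_integral (linepath b a4) g + contour_integral (linepath a4 a) g)))
      (rectpath a b)"
    unfolding rp using ci
    by (intro has_contour_integral_join has_contour_integral_integral valid_path_join) auto
  from has_contour_integral_unique[OF tot this]
  have sum: "of_real (pi / c * exp (- c * y)) = contour_integral (linepath a a2) g +
      (contour_integral (linepath a2 b) g + (contour_integral (linepath b a4) g + contour_integral (linepath a4 a) g))" .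
  have nb: "norm (g z) \<le> 1 / (R^2 - c^2)" if "Im z \<ge> 0" "norm z \<ge> R" for z
  proof -
    have "g z = exp (\<i> * of_real y * z) / (z^2 + of_real (c^2))"
      by (simp add: g_def f_def field_simps power2_eq_square)
    moreover have "norm (exp (\<i> * of_real y * z)) \<le> 1"
      using that y by (simp add: norm_exp)
    moreover have "norm (z^2 + of_real (c^2)) \<ge> R^2 - c^2"
    proof -
      have "R^2 - c^2 \<le> norm (z^2) - norm (complex_of_real (c^2))"
        using that R0 by (simp add: norm_power)
      also have "\<dots> \<le> norm (z^2 + of_real (c^2))" by norm
      finally show ?thesis .
    qed
    moreover have "R^2 - c^2 > 0" using R c by (simp add: power_strict_mono)
    ultimately show ?thesis by (simp add: norm_divide frac_le)
  qed
  have Rc: "R^2 - c^2 > 0" using R c by (simp add: power_strict_mono)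
  have nR: "norm z \<ge> R" if "\<bar>Re z\<bar> = R \<or> Im z = R" for z
    using that abs_Re_le_cmod[of z] abs_Im_le_cmod[of z] by auto
  have s2: "closed_segment a2 b \<subseteq> {z. Im z \<ge> 0 \<and> Re z = R}"
    using R0 by (intro closed_segment_subset) (auto simp: a2_def b_def convex_def algebra_simps simp flip: distrib_right)
  have s3: "closed_segment b a4 \<subseteq> {z. Im z = R}"
    using R0 by (intro closed_segment_subset) (auto simp: a4_def b_def convex_def algebra_simps simp flip: distrib_right)
  have s4: "closed_segment a4 a \<subseteq> {z. Im z \<ge> 0 \<and> Re z = - R}"
    using R0 by (intro closed_segment_subset) (auto simp: a4_def a_def convex_def algebra_simps simp flip: distrib_right)
  have b2: "norm (contour_integral (linepath a2 b) g) \<le> 1 / (R^2 - c^2) * norm (b - a2)"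
    using Rc s2 R0 by (intro contour_integral_bound_linepath ci nb nR) auto
  have b3: "norm (contour_integral (linepath b a4) g) \<le> 1 / (R^2 - c^2) * norm (a4 - b)"
    using Rc s3 R0 by (intro contour_integral_bound_linepath ci nb nR) auto
  have b4: "norm (contour_integral (linepath a4 a) g) \<le> 1 / (R^2 - c^2) * norm (a - a4)"
    using Rc s4 R0 by (intro contour_integral_bound_linepath ci nb nR) auto
  have "norm (b - a2) = R" "norm (a4 - b) = 2 * R" "norm (a - a4) = R"
    using R0 by (auto simp: a_def b_def a2_def a4_def cmod_def real_sqrt_mult)
  with b2 b3 b4 have "norm (contour_integral (linepath a2 b) g) + (norm (contour_integral (linepath b a4) g) + norm (contour_integral (linepath a4 a) g))
      \<le> 1 / (R^2 - c^2) * R + (1 / (R^2 - c^2) * (2 * R) + 1 / (R^2 - c^2) * R)"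
    by (intro add_mono) auto
  also have "\<dots> = 4 * R / (R^2 - c^2)" by (simp add: algebra_simps flip: add_divide_distrib)
  finally have B: "norm (contour_integral (linepath a2 b) g + (contour_integral (linepath b a4) g + contour_integral (linepath a4 a) g))
      \<le> 4 * R / (R^2 - c^2)"
    by (meson norm_triangle_ineq order_trans add_left_mono)
  have "contour_integral (linepath a a2) g = integral {Re a..Re a2} (\<lambda>x. g (of_real x))"
    using R0 by (intro contour_integral_linepath_Reals_eq) (auto simp: a_def a2_def complex_is_Real_iff)
  also have "\<dots> = integral {-R..R} (\<lambda>x. g (of_real x))"
    by (simp add: a_def a2_def)
  also have "\<dots> = integral {-R..R} (\<lambda>t. cis (t*y) / of_real (c^2+t^2))"
  proof (rule integral_cong)
    fix x assume "x \<in> {-R..R}"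
    have "g (complex_of_real x) = exp (\<i> * of_real y * of_real x) / ((of_real x + \<i> * of_real c) * (of_real x - \<i> * of_real c))"
      by (simp add: g_def f_def)
    also have "(of_real x + \<i> * of_real c) * (of_real x - \<i> * of_real c) = complex_of_real (c^2+x^2)"
      by (simp add: algebra_simps power2_eq_square)
    finally show "g (complex_of_real x) = cis (x*y) / of_real (c^2+x^2)"
      by (simp add: cis_conv_exp mult_ac)
  qed
  finally have I: "contour_integral (linepath a a2) g = integral {-R..R} (\<lambda>t. cis (t*y) / of_real (c^2+t^2))" .
  have "norm (I - K) \<le> B" if "K = I + X" "norm X \<le> B" for I K X :: complex and B
    using that by (simp add: norm_minus_commute)
  from this[OF sum[unfolded I] B] show ?thesis .
qed

lemma integrable_cis_poisson:
  assumes "c > (0::real)"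
  shows "integrable lborel (\<lambda>t. cis (t*y) / of_real (c^2+t^2))"
proof (rule Bochner_Integration.integrable_bound[OF integrable_inverse_square_plus[OF assms]])
  show "(\<lambda>t. cis (t*y) / of_real (c^2+t^2)) \<in> borel_measurable lborel"
    unfolding cis_conv_exp by measurable
qed (auto simp: norm_divide simp del: of_real_add of_real_power)

text \<open>The integrals over \<open>[-n, n]\<close> have two limits: the full integral, by
  dominated convergence, and the residue, since the contour error is
  \<open>O(1 / n)\<close>.\<close>

lemma poisson_nonneg:
  assumes c: "c > (0::real)" and y: "y \<ge> 0"
  shows "(LBINT t. cis (t*y) / of_real (c^2+t^2)) = of_real (pi / c * exp (- c * y))"
proof -
  let ?h = "\<lambda>t. cis (t*y) / of_real (c^2+t^2)"
  have lim1: "(\<lambda>n::nat. LBINT t:{-real n..real n}. ?h t) \<longlonglongrightarrow> (LBINT t. ?h t)"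
  proof -
    have "(\<lambda>n::nat. LBINT t. indicator {-real n..real n} t *\<^sub>R ?h t) \<longlonglongrightarrow> (LBINT t. ?h t)"
    proof (rule integral_dominated_convergence[where w = "\<lambda>t. norm (?h t)"])
      show "AE t in lborel. (\<lambda>n. indicator {-real n..real n} t *\<^sub>R ?h t) \<longlonglongrightarrow> ?h t"
      proof (rule AE_I2, rule tendsto_eventually)
        fix t :: real
        obtain N :: nat where N: "\<bar>t\<bar> \<le> real N" using real_arch_simple by blast
        show "\<forall>\<^sub>F n in sequentially. indicator {-real n..real n} t *\<^sub>R ?h t = ?h t"
          using eventually_ge_at_top[of N] by eventually_elim (use N in \<open>auto simp: indicator_def\<close>)
      qed
    qed (use integrable_cis_poisson[OF c, of y] in \<open>auto simp: indicator_def\<close>)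
    then show ?thesis by (simp add: set_lebesgue_integral_def)
  qed
  have eq: "(LBINT t:{-real n..real n}. ?h t) = integral {-real n..real n} ?h" for n
    by (intro set_borel_integral_eq_integral integrable_mult_indicator[OF _ integrable_cis_poisson[OF c], folded set_integrable_def]) auto
  have lim2: "(\<lambda>n::nat. integral {-real n..real n} ?h) \<longlonglongrightarrow> of_real (pi / c * exp (- c * y))"
  proof (rule LIM_zero_cancel, rule Lim_null_comparison)
    obtain N :: nat where N: "c < real N" using reals_Archimedean2 by blast
    show "\<forall>\<^sub>F n in sequentially. norm (integral {-real n..real n} ?h - of_real (pi / c * exp (- c * y))) \<le> 4 * real n / ((real n)^2 - c^2)"
      using eventually_ge_at_top[of N] by eventually_elim (use N in \<open>intro poisson_contour_bound c y, auto\<close>)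
    show "(\<lambda>n. 4 * real n / ((real n)^2 - c^2)) \<longlonglongrightarrow> 0"
      by real_asymp
  qed
  show ?thesis using LIMSEQ_unique[OF lim1[unfolded eq] lim2] .
qed

lemma poisson_kernel:
  assumes c: "c > (0::real)"
  shows "(LBINT t. cis (t*y) / of_real (c^2+t^2)) = of_real (pi / c * exp (- c * \<bar>y\<bar>))"
proof (cases "y \<ge> 0")
  case True then show ?thesis using poisson_nonneg[OF c True] by simp
next
  case False
  have "(LBINT t. cis (t*y) / of_real (c^2+t^2)) = (LBINT t. cis ((-t)*y) / of_real (c^2+(-t)^2))"
    using lborel_integral_real_affine[of "-1" "\<lambda>t. cis (t*y) / of_real (c^2+t^2)" 0] by simp
  then show ?thesis using poisson_nonneg[OF c, of "-y"] False by simp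
qed

section \<open>Plancherel formula for Dirichlet polynomials\<close>

lemma Re_mult_of_real: "Re (z * of_real r) = Re z * r"
  by simp

text \<open>Expanding the square leaves, for each pair, the Fourier transform of the Poisson kernel
  at the difference of the frequencies. This kernel is chosen because its transform is a decaying
  exponential, which for \<open>fr = ln\<close> is a power of the ratio of \<open>m\<close> and
  \<open>n\<close>.\<close>

lemma plancherel_finite:
  fixes a :: "nat \<Rightarrow> complex" and fr :: "nat \<Rightarrow> real"
  assumes c: "c > 0" and A: "finite A"
  shows "(LBINT t. (norm (\<Sum>n\<in>A. a n * cis (- t * fr n)))\<^sup>2 / (c\<^sup>2 + t\<^sup>2)) =
     pi / c * (\<Sum>m\<in>A. \<Sum>n\<in>A. Re (a m * cnj (a n)) * exp (- c * \<bar>fr m - fr n\<bar>))"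
proof -
  have pt: "complex_of_real ((norm (\<Sum>n\<in>A. a n * cis (- t * fr n)))\<^sup>2 / (c\<^sup>2 + t\<^sup>2)) =
     (\<Sum>m\<in>A. \<Sum>n\<in>A. (a m * cnj (a n)) * (cis (t * (fr n - fr m)) / of_real (c\<^sup>2 + t\<^sup>2)))" for t
  proof -
    have "complex_of_real ((norm (\<Sum>n\<in>A. a n * cis (- t * fr n)))\<^sup>2) =
       (\<Sum>m\<in>A. \<Sum>n\<in>A. (a m * cnj (a n)) * (cis (- t * fr m) * cnj (cis (- t * fr n))))"
      by (subst complex_norm_square) (simp add: sum_product mult_ac)
    also have "\<dots> = (\<Sum>m\<in>A. \<Sum>n\<in>A. (a m * cnj (a n)) * cis (t * (fr n - fr m)))"
      by (simp add: cis_cnj cis_mult algebra_simps)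
    finally show ?thesis by (simp add: sum_divide_distrib del: of_real_add of_real_power)
  qed
  have "complex_of_real (LBINT t. (norm (\<Sum>n\<in>A. a n * cis (- t * fr n)))\<^sup>2 / (c\<^sup>2 + t\<^sup>2)) =
    (LBINT t. (\<Sum>m\<in>A. \<Sum>n\<in>A. (a m * cnj (a n)) * (cis (t * (fr n - fr m)) / of_real (c\<^sup>2 + t\<^sup>2))))"
    by (subst integral_complex_of_real[symmetric]) (simp only: pt)
  also have "\<dots> = (\<Sum>m\<in>A. \<Sum>n\<in>A. (a m * cnj (a n)) * (LBINT t. cis (t * (fr n - fr m)) / of_real (c\<^sup>2 + t\<^sup>2)))"
    by (subst Bochner_Integration.integral_sum, 
        intro Bochner_Integration.integrable_sum integrable_mult_right integrable_cis_poisson c)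
       (subst Bochner_Integration.integral_sum, intro integrable_mult_right integrable_cis_poisson c, 
        simp only: integral_mult_right_zero)
  also have "\<dots> = (\<Sum>m\<in>A. \<Sum>n\<in>A. (a m * cnj (a n)) * of_real (pi / c * exp (- c * \<bar>fr n - fr m\<bar>)))"
    by (simp only: poisson_kernel[OF c])
  finally have "(LBINT t. (norm (\<Sum>n\<in>A. a n * cis (- t * fr n)))\<^sup>2 / (c\<^sup>2 + t\<^sup>2)) =
    Re (\<Sum>m\<in>A. \<Sum>n\<in>A. (a m * cnj (a n)) * of_real (pi / c * exp (- c * \<bar>fr n - fr m\<bar>)))"
    by (metis Re_complex_of_real)
  then show ?thesis
    by (simp only: Re_sum Re_mult_of_real) (simp add: sum_distrib_left mult_ac abs_minus_commute)
qed

lemma norm_add_square: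
  fixes x y :: complex
  shows "(norm (x + y))\<^sup>2 = (norm x)\<^sup>2 + 2 * Re (x * cnj y) + (norm y)\<^sup>2"
  by (simp only: cmod_power2) (simp add: power2_eq_square algebra_simps)

text \<open>Summation by parts for a quadratic form: \<open>w (max m n)\<close> is the sum of the
  differences \<open>w k - w (Suc k)\<close> over \<open>k\<close> from \<open>max m n\<close> to
  \<open>N\<close>, plus \<open>w (Suc N)\<close>, and for fixed \<open>k\<close> the pairs in
  \<open>{1..k}\<close> assemble to the square of one partial sum.\<close>

lemma sum_max_kernel:
  fixes b :: "nat \<Rightarrow> complex" and w :: "nat \<Rightarrow> real"
  shows "(\<Sum>m=1..N. \<Sum>n=1..N. Re (b m * cnj (b n)) * w (max m n)) =
    (\<Sum>k=1..N. (w k - w (Suc k)) * (norm (\<Sum>n=1..k. b n))\<^sup>2) + w (Suc N) * (norm (\<Sum>n=1..N. b n))\<^sup>2"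
proof (induction N)
  case (Suc N)
  define r where "r = (\<lambda>m n. Re (b m * cnj (b n)))"
  define q where "q = (\<lambda>N. (norm (\<Sum>n=1..N. b n))\<^sup>2)"
  define c where "c = Re ((\<Sum>n=1..N. b n) * cnj (b (Suc N)))"
  have 1: "q (Suc N) = q N + 2 * c + (norm (b (Suc N)))\<^sup>2"
  proof -
    have "(\<Sum>n=1..Suc N. b n) = (\<Sum>n=1..N. b n) + b (Suc N)" by simp
    then show ?thesis unfolding q_def c_def by (simp only: norm_add_square)
  qed
  have 2: "r (Suc N) (Suc N) = (norm (b (Suc N)))\<^sup>2"
    unfolding r_def by (simp only: cmod_power2) (simp add: power2_eq_square)
  have 3: "(\<Sum>m=1..N. r m (Suc N) * w (max m (Suc N))) = c * w (Suc N)"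
  proof -
    have "(\<Sum>m=1..N. r m (Suc N) * w (max m (Suc N))) = (\<Sum>m=1..N. r m (Suc N) * w (Suc N))"
      by (intro sum.cong) (auto simp: max_def)
    then show ?thesis by (simp only: sum_distrib_right Re_sum c_def r_def)
  qed
  have 4: "(\<Sum>m=1..N. r (Suc N) m * w (max (Suc N) m)) = c * w (Suc N)"
  proof -
    have "(\<Sum>m=1..N. r (Suc N) m * w (max (Suc N) m)) = (\<Sum>m=1..N. r m (Suc N) * w (Suc N))"
      by (intro sum.cong) (auto simp: max_def r_def)
    then show ?thesis by (simp only: sum_distrib_right Re_sum c_def r_def)
  qed
  have "(\<Sum>m=1..N. \<Sum>n=1..N. r m n * w (max m n)) = (\<Sum>k=1..N. (w k - w (Suc k)) * q k) + w (Suc N) * q N"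
    using Suc by (simp add: r_def q_def)
  with 1 2 3 4 have "(\<Sum>m=1..Suc N. \<Sum>n=1..Suc N. r m n * w (max m n)) = (\<Sum>k=1..Suc N. (w k - w (Suc k)) * q k) + w (Suc (Suc N)) * q (Suc N)"
    by (simp add: sum.distrib algebra_simps)
  then show ?case unfolding r_def q_def .
qed simp

text \<open>When the decay rate equals the exponent \<open>s\<close>, the whole weight depends on
  the larger index alone. This is the reason for pairing exponent and kernel width in the lower
  bound.\<close>

lemma powr_max_kernel:
  fixes s :: real
  assumes "m \<ge> 1" "n \<ge> 1" "s > 0"
  shows "real m powr (-s) * real n powr (-s) * exp (- s * \<bar>ln (real m) - ln (real n)\<bar>) = real (max m n) powr (- 2 * s)"
  using assms by (cases "m \<le> n") (auto simp: max_def powr_def exp_add[symmetric] algebra_simps abs_if)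

text \<open>The diagonalised form has nonnegative summands, so it may be cut at \<open>X\<close>.
  The freedom \<open>X \<le> N\<close> lets \<open>N\<close> tend to infinity while \<open>X\<close>
  stays fixed.\<close>

lemma plancherel_lower:
  fixes b :: "nat \<Rightarrow> complex"
  assumes s: "s > 0" and X: "X \<le> N"
  shows "pi / s * (\<Sum>k=1..X. (real k powr (- 2 * s) - real (Suc k) powr (- 2 * s)) * (norm (\<Sum>n=1..k. b n))\<^sup>2) \<le>
    (LBINT t. (norm (\<Sum>n=1..N. (b n * of_real (real n powr (-s))) * cis (- t * ln (real n))))\<^sup>2 / (s\<^sup>2 + t\<^sup>2))"
proof -
  have nn: "(real k powr (- 2 * s) - real (Suc k) powr (- 2 * s)) \<ge> 0" if "k \<ge> 1" for k
    using that s powr_mono2'[of "- 2 * s" "real k" "real (Suc k)"] by auto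
  have "(\<Sum>k=1..X. (real k powr (- 2 * s) - real (Suc k) powr (- 2 * s)) * (norm (\<Sum>n=1..k. b n))\<^sup>2)
     \<le> (\<Sum>k=1..N. (real k powr (- 2 * s) - real (Suc k) powr (- 2 * s)) * (norm (\<Sum>n=1..k. b n))\<^sup>2)"
    using X nn by (intro sum_mono2) auto
  also have "\<dots> \<le> (\<Sum>m=1..N. \<Sum>n=1..N. Re (b m * cnj (b n)) * real (max m n) powr (- 2 * s))"
    unfolding sum_max_kernel[of b "\<lambda>k. real k powr (- 2 * s)"] by simp
  also have "\<dots> = (\<Sum>m=1..N. \<Sum>n=1..N. Re ((b m * of_real (real m powr (-s))) * cnj (b n * of_real (real n powr (-s)))) * exp (- s * \<bar>ln (real m) - ln (real n)\<bar>))"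
  proof (intro sum.cong refl)
    fix m n assume "m \<in> {1..N}" "n \<in> {1..N}"
    then have "real (max m n) powr (- 2 * s) = real m powr (-s) * real n powr (-s) * exp (- s * \<bar>ln (real m) - ln (real n)\<bar>)"
      using s by (subst powr_max_kernel) auto
    moreover have "Re ((b m * of_real (real m powr (-s))) * cnj (b n * of_real (real n powr (-s)))) =
        Re (b m * cnj (b n)) * (real m powr (-s) * real n powr (-s))" by (simp add: algebra_simps)
    ultimately show "Re (b m * cnj (b n)) * real (max m n) powr (- 2 * s) = Re ((b m * of_real (real m powr (-s))) * cnj (b n * of_real (real n powr (-s)))) * exp (- s * \<bar>ln (real m) - ln (real n)\<bar>)"
      by (simp only: mult.assoc)
  qed
  finally show ?thesis
    using s by (subst plancherel_finite) (auto simp del: complex_cnj_mult complex_cnj_complex_of_real intro!: divide_right_mono)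
qed

text \<open>For \<open>m \<le> n\<close> and \<open>c \<ge> 1\<close> the exponential is at most
  \<open>m / n\<close>, and \<open>s \<ge> 1\<close> disposes of the remaining
  \<open>m powr (1 - s)\<close>; the smaller index is then summed by means of \<open>E\<close>. The
  surviving factor \<open>1 / c\<close> is what later makes the range of large \<open>t\<close>
  negligible.\<close>

lemma plancherel_upper:
  fixes b :: "nat \<Rightarrow> complex" and B E :: "nat \<Rightarrow> real"
  assumes s: "s \<ge> 1" and c: "c \<ge> 1" and bB: "\<And>n. n \<ge> 1 \<Longrightarrow> norm (b n) \<le> B n"
    and E: "\<And>n. n \<ge> 1 \<Longrightarrow> (\<Sum>m=1..n. B m) \<le> real n * E n"
  shows "(LBINT t. (norm (\<Sum>n=1..N. (b n * of_real (real n powr (-s))) * cis (- t * ln (real n))))\<^sup>2 / (c\<^sup>2 + t\<^sup>2))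
    \<le> 2 * pi / c * (\<Sum>n=1..N. B n * E n * real n powr (-s))"
proof -
  have B0: "B n \<ge> 0" if "n \<ge> 1" for n using bB[OF that] norm_ge_zero order_trans by blast
  define k where "k = (\<lambda>m n::nat. B m * B n * (real n powr (-s-1)))"
  define r where "r = (\<lambda>m n::nat. (B m * real m powr (-s)) * (B n * real n powr (-s)) * exp (- c * \<bar>ln (real m) - ln (real n)\<bar>))"
  have k0: "k m n \<ge> 0" if "m \<ge> 1" "n \<ge> 1" for m n using B0 that by (simp add: k_def)
  have rk: "r m n \<le> k m n" if "m \<ge> 1" "n \<ge> m" for m n
  proof -
    have "exp (- c * \<bar>ln (real m) - ln (real n)\<bar>) \<le> exp (-1 * \<bar>ln (real m) - ln (real n)\<bar>)"
      using c mult_right_mono[OF c, of "\<bar>ln (real m) - ln (real n)\<bar>"] by simp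
    also have "\<dots> = real m / real n"
      using that by (simp add: exp_diff)
    finally have "real m powr (-s) * real n powr (-s) * exp (- c * \<bar>ln (real m) - ln (real n)\<bar>) \<le> real m powr (-s) * real n powr (-s) * (real m / real n)"
      by (intro mult_left_mono) auto
    also have "\<dots> = real m powr (1-s) * real n powr (-s-1)"
      using that by (simp add: powr_diff powr_minus divide_simps)
    also have "\<dots> \<le> 1 * real n powr (-s-1)"
      using that s powr_mono[of "1-s" 0 "real m"] by (intro mult_right_mono) auto
    finally have "B m * B n * (real m powr (-s) * real n powr (-s) * exp (- c * \<bar>ln (real m) - ln (real n)\<bar>)) \<le> B m * B n * (1 * real n powr (-s-1))"
      using B0 that by (intro mult_left_mono) auto
    then show ?thesis by (simp add: r_def k_def mult_ac)
  qed
  have r_sym: "r m n = r n m" for m n by (simp add: r_def abs_minus_commute mult_ac)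
  \<comment> \<open>Both halves contain the diagonal, which only enlarges the bound.\<close>
  have rkk: "r m n \<le> (if m \<le> n then k m n else 0) + (if n \<le> m then k n m else 0)" if "m \<in> {1..N}" "n \<in> {1..N}" for m n
    using rk[of m n] rk[of n m] r_sym[of m n] k0[of m n] k0[of n m] that by auto
  have H: "(LBINT t. (norm (\<Sum>n=1..N. (b n * of_real (real n powr (-s))) * cis (- t * ln (real n))))\<^sup>2 / (c\<^sup>2 + t\<^sup>2))
     = pi / c * (\<Sum>m=1..N. \<Sum>n=1..N. Re ((b m * of_real (real m powr (-s))) * cnj (b n * of_real (real n powr (-s)))) * exp (- c * \<bar>ln (real m) - ln (real n)\<bar>))"
    using c by (subst plancherel_finite) auto
  have "(\<Sum>m=1..N. \<Sum>n=1..N. Re ((b m * of_real (real m powr (-s))) * cnj (b n * of_real (real n powr (-s)))) * exp (- c * \<bar>ln (real m) - ln (real n)\<bar>))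
     \<le> (\<Sum>m=1..N. \<Sum>n=1..N. r m n)"
  proof (intro sum_mono)
    fix m n assume mn: "m \<in> {1..N}" "n \<in> {1..N}"
    have "Re ((b m * of_real (real m powr (-s))) * cnj (b n * of_real (real n powr (-s)))) \<le> 
      norm ((b m * of_real (real m powr (-s))) * cnj (b n * of_real (real n powr (-s))))"
      by (rule complex_Re_le_cmod)
    also have "\<dots> = (norm (b m) * real m powr (-s)) * (norm (b n) * real n powr (-s))"
      by (simp add: norm_mult)
    also have "\<dots> \<le> (B m * real m powr (-s)) * (B n * real n powr (-s))"
      using mn bB B0 by (intro mult_mono) auto
    finally show "Re ((b m * of_real (real m powr (-s))) * cnj (b n * of_real (real n powr (-s)))) * exp (- c * \<bar>ln (real m) - ln (real n)\<bar>) \<le> r m n"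
      unfolding r_def by (rule mult_right_mono) simp
  qed
  also have "\<dots> \<le> (\<Sum>m=1..N. \<Sum>n=1..N. (if m \<le> n then k m n else 0) + (if n \<le> m then k n m else 0))"
    by (intro sum_mono rkk)
  also have "\<dots> = 2 * (\<Sum>n=1..N. \<Sum>m=1..N. if m \<le> n then k m n else 0)"
    by (simp add: sum.distrib) (subst sum.swap, simp)
  also have "(\<Sum>n=1..N. \<Sum>m=1..N. if m \<le> n then k m n else 0) = (\<Sum>n=1..N. \<Sum>m=1..n. k m n)"
    by (intro sum.cong refl sum.mono_neutral_cong_right) auto
  also have "\<dots> = (\<Sum>n=1..N. (B n * real n powr (-s-1)) * (\<Sum>m=1..n. B m))"
    by (simp add: k_def sum_distrib_left sum_distrib_right mult_ac)
  finally have "(\<Sum>m=1..N. \<Sum>n=1..N. Re ((b m * of_real (real m powr (-s))) * cnj (b n * of_real (real n powr (-s)))) * exp (- c * \<bar>ln (real m) - ln (real n)\<bar>))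
     \<le> 2 * (\<Sum>n=1..N. (B n * real n powr (-s-1)) * (\<Sum>m=1..n. B m))" .
  also have "(\<Sum>n=1..N. (B n * real n powr (-s-1)) * (\<Sum>m=1..n. B m)) \<le> (\<Sum>n=1..N. (B n * real n powr (-s-1)) * (real n * E n))"
    using B0 E by (intro sum_mono mult_left_mono) auto
  also have "\<dots> = (\<Sum>n=1..N. B n * E n * real n powr (-s))"
    by (intro sum.cong refl) (simp add: powr_diff)
  finally have "pi / c * (\<Sum>m=1..N. \<Sum>n=1..N. Re ((b m * of_real (real m powr (-s))) * cnj (b n * of_real (real n powr (-s)))) * exp (- c * \<bar>ln (real m) - ln (real n)\<bar>))
     \<le> pi / c * (2 * (\<Sum>n=1..N. B n * E n * real n powr (-s)))"
    using c by (intro mult_left_mono) auto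
  also have "\<dots> = 2 * pi / c * (\<Sum>n=1..N. B n * E n * real n powr (-s))" by simp
  finally show ?thesis unfolding H .
qed

lemma LIMSEQ_sum_Icc:
  fixes a :: "nat \<Rightarrow> 'b :: real_normed_vector"
  assumes "summable a" "a 0 = 0"
  shows "(\<lambda>N. \<Sum>n=1..N. a n) \<longlonglongrightarrow> suminf a"
proof -
  have "(\<Sum>n=1..N. a n) = (\<Sum>n<Suc N. a n)" for N
    using assms(2) by (intro sum.mono_neutral_left) (auto, metis not_less_eq_eq le_zero_eq One_nat_def)
  then show ?thesis using summable_LIMSEQ[OF assms(1)] by (simp only:) (rule LIMSEQ_Suc)
qed

text \<open>Passage from Dirichlet polynomials to absolutely convergent series. The dominating
  function is the kernel times the square of the sum of all \<open>norm (a n)\<close>.\<close>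

lemma plancherel_limit:
  fixes a :: "nat \<Rightarrow> complex" and fr :: "nat \<Rightarrow> real"
  assumes c: "c > 0" and sm: "summable (\<lambda>n. norm (a n))" and a0: "a 0 = 0"
  shows "(\<lambda>N. LBINT t. (norm (\<Sum>n=1..N. a n * cis (- t * fr n)))\<^sup>2 / (c\<^sup>2 + t\<^sup>2))
     \<longlonglongrightarrow> (LBINT t. (norm (\<Sum>n. a n * cis (- t * fr n)))\<^sup>2 / (c\<^sup>2 + t\<^sup>2))"
    and "integrable lborel (\<lambda>t. (norm (\<Sum>n. a n * cis (- t * fr n)))\<^sup>2 / (c\<^sup>2 + t\<^sup>2))"
    and "(\<lambda>t. \<Sum>n. a n * cis (- t * fr n)) \<in> borel_measurable borel"
proof -
  define M where "M = (\<Sum>n. norm (a n))"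
  have sm': "summable (\<lambda>n. a n * cis (- t * fr n))" for t
    by (rule summable_norm_cancel) (use sm in \<open>simp add: norm_mult\<close>)
  have lim: "(\<lambda>N. \<Sum>n=1..N. a n * cis (- t * fr n)) \<longlonglongrightarrow> (\<Sum>n. a n * cis (- t * fr n))" for t
    by (rule LIMSEQ_sum_Icc[OF sm']) (simp add: a0)
  have M: "norm (\<Sum>n=1..N. a n * cis (- t * fr n)) \<le> M" for N t
  proof -
    have "norm (\<Sum>n=1..N. a n * cis (- t * fr n)) \<le> (\<Sum>n=1..N. norm (a n))"
      by (rule order_trans[OF norm_sum]) (simp add: norm_mult)
    also have "\<dots> \<le> M" unfolding M_def using sm by (intro sum_le_suminf) auto
    finally show ?thesis .
  qed
  have meas: "(\<lambda>t. \<Sum>n=1..N. a n * cis (- t * fr n)) \<in> borel_measurable borel" for N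
    unfolding cis_conv_exp by measurable
  show mb: "(\<lambda>t. \<Sum>n. a n * cis (- t * fr n)) \<in> borel_measurable borel"
    by (rule borel_measurable_LIMSEQ_metric[OF meas]) (rule lim)
  have int: "integrable lborel (\<lambda>t. M\<^sup>2 * (1 / (c\<^sup>2 + t\<^sup>2)))"
    using integrable_inverse_square_plus[OF c] by (rule integrable_mult_right)
  have pos: "c\<^sup>2 + t\<^sup>2 > 0" for t using c by (simp add: add_pos_nonneg)
  show "(\<lambda>N. LBINT t. (norm (\<Sum>n=1..N. a n * cis (- t * fr n)))\<^sup>2 / (c\<^sup>2 + t\<^sup>2))
     \<longlonglongrightarrow> (LBINT t. (norm (\<Sum>n. a n * cis (- t * fr n)))\<^sup>2 / (c\<^sup>2 + t\<^sup>2))"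
  proof (rule integral_dominated_convergence[OF _ _ int])
    show "AE t in lborel. (\<lambda>N. (norm (\<Sum>n=1..N. a n * cis (- t * fr n)))\<^sup>2 / (c\<^sup>2 + t\<^sup>2))
        \<longlonglongrightarrow> (norm (\<Sum>n. a n * cis (- t * fr n)))\<^sup>2 / (c\<^sup>2 + t\<^sup>2)"
      using pos by (intro AE_I2 tendsto_intros lim) (auto simp: less_imp_neq[symmetric])
    show "AE t in lborel. norm ((norm (\<Sum>n=1..N. a n * cis (- t * fr n)))\<^sup>2 / (c\<^sup>2 + t\<^sup>2)) \<le> M\<^sup>2 * (1 / (c\<^sup>2 + t\<^sup>2))" for N
      using pos M power_mono[OF M norm_ge_zero, of _ _ 2] by (intro AE_I2) (auto simp: intro!: divide_right_mono)
  qed (use meas mb in measurable)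
  show "integrable lborel (\<lambda>t. (norm (\<Sum>n. a n * cis (- t * fr n)))\<^sup>2 / (c\<^sup>2 + t\<^sup>2))"
  proof (rule Bochner_Integration.integrable_bound[OF int])
    have M2: "norm (\<Sum>n. a n * cis (- t * fr n)) \<le> M" for t
      using M by (intro LIMSEQ_le_const2[OF tendsto_norm[OF lim]]) auto
    show "AE t in lborel. norm ((norm (\<Sum>n. a n * cis (- t * fr n)))\<^sup>2 / (c\<^sup>2 + t\<^sup>2)) \<le> norm (M\<^sup>2 * (1 / (c\<^sup>2 + t\<^sup>2)))"
      using pos power_mono[OF M2 norm_ge_zero, of _ 2] by (intro AE_I2) (auto simp: intro!: divide_right_mono)
  qed (use mb in measurable)
qed

section \<open>Euler products\<close>

text \<open>\<open>nps \<sigma> t n\<close> is $n^{-s}$ for $s = \sigma + it$, with value \<open>0\<close> at \<open>n = 0\<close>.\<close>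

definition nps :: "real \<Rightarrow> real \<Rightarrow> nat \<Rightarrow> complex" where
  "nps \<sigma> t n = of_real (real n powr (-\<sigma>)) * cis (- t * ln (real n))"

text \<open>Rests on \<open>0 powr x = 0\<close>. It allows every Dirichlet series to run over all
  of \<open>nat\<close>, although \<open>f 0\<close> is arbitrary.\<close>

lemma nps_0 [simp]: "nps \<sigma> t 0 = 0"
  by (simp add: nps_def)

lemma nps_1 [simp]: "nps \<sigma> t (Suc 0) = 1"
  by (simp add: nps_def)

lemma norm_nps [simp]: "norm (nps \<sigma> t n) = real n powr (-\<sigma>)"
  by (simp add: nps_def norm_mult)

lemma nps_mult: "nps \<sigma> t (m * n) = nps \<sigma> t m * nps \<sigma> t n"
  by (cases "m = 0 \<or> n = 0")
     (auto simp: nps_def powr_mult ln_mult cis_mult algebra_simps)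

lemma nps_power: "nps \<sigma> t (n ^ k) = nps \<sigma> t n ^ k"
  by (induction k) (auto simp: nps_mult)

lemma summable_powr_minus: "\<sigma> > 1 \<Longrightarrow> summable (\<lambda>n. real n powr (-\<sigma>))"
  by (simp add: summable_real_powr_iff)

text \<open>The mean value theorem for \<open>x powr (1-\<sigma>)\<close>, as a discrete integral
  test. Telescoping gives \<open>1 / (\<sigma> - 1)\<close> and
  \<open>\<sigma> / (\<sigma> - 1)\<close> as bounds for the zeta function.\<close>

lemma powr_step:
  assumes "\<sigma> > (1::real)" "n \<ge> (1::nat)"
  shows "real (Suc n) powr (-\<sigma>) \<le> (real n powr (1-\<sigma>) - real (Suc n) powr (1-\<sigma>)) / (\<sigma>-1)"
    and "(real n powr (1-\<sigma>) - real (Suc n) powr (1-\<sigma>)) / (\<sigma>-1) \<le> real n powr (-\<sigma>)"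
proof -
  have "\<exists>z>real n. z < real (Suc n) \<and> real (Suc n) powr (1-\<sigma>) - real n powr (1-\<sigma>) = (real (Suc n) - real n) * ((1-\<sigma>) * z powr (-\<sigma>))"
  proof (rule MVT2)
    fix x assume "real n \<le> x" "x \<le> real (Suc n)"
    then show "((\<lambda>x. x powr (1-\<sigma>)) has_real_derivative ((1-\<sigma>) * x powr (-\<sigma>))) (at x)"
      using assms by (auto intro!: derivative_eq_intros)
  qed simp
  then obtain z where z: "z > real n" "z < real (Suc n)" 
    and "real (Suc n) powr (1-\<sigma>) - real n powr (1-\<sigma>) = (1-\<sigma>) * z powr (-\<sigma>)" by auto
  then have eq: "(real n powr (1-\<sigma>) - real (Suc n) powr (1-\<sigma>)) / (\<sigma>-1) = z powr (-\<sigma>)"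
    using assms by (simp add: field_simps)
  show "real (Suc n) powr (-\<sigma>) \<le> (real n powr (1-\<sigma>) - real (Suc n) powr (1-\<sigma>)) / (\<sigma>-1)"
    unfolding eq using z assms by (intro powr_mono2') auto
  show "(real n powr (1-\<sigma>) - real (Suc n) powr (1-\<sigma>)) / (\<sigma>-1) \<le> real n powr (-\<sigma>)"
    unfolding eq using z assms by (intro powr_mono2') auto
qed

lemma sum_powr_le:
  assumes "\<sigma> > (1::real)"
  shows "(\<Sum>n=1..N. real n powr (-\<sigma>)) \<le> \<sigma> / (\<sigma> - 1)"
proof (cases N)
  case (Suc M)
  have "(\<Sum>n=1..Suc M. real n powr (-\<sigma>)) \<le> 1 + (1 - real (Suc M) powr (1-\<sigma>)) / (\<sigma>-1)"
  proof (induction M)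
    case (Suc M)
    then show ?case using powr_step(1)[OF assms, of "Suc M"] by (simp add: diff_divide_distrib)
  qed simp
  also have "\<dots> \<le> 1 + 1 / (\<sigma>-1)" using assms by (intro add_left_mono divide_right_mono) auto
  also have "\<dots> = \<sigma> / (\<sigma> - 1)" using assms by (simp add: field_simps)
  finally show ?thesis using Suc by simp
qed (use assms in auto)

lemma suminf_powr_le:
  assumes "\<sigma> > (1::real)"
  shows "(\<Sum>n. real n powr (-\<sigma>)) \<le> \<sigma> / (\<sigma> - 1)"
proof (rule suminf_le_const[OF summable_powr_minus[OF assms]])
  fix N
  have "(\<Sum>n<N. real n powr (-\<sigma>)) \<le> (\<Sum>n=1..N. real n powr (-\<sigma>))"
  proof -
    have "(\<Sum>n<N. real n powr (-\<sigma>)) = (\<Sum>n=1..<N. real n powr (-\<sigma>))"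
      by (rule sum.mono_neutral_right) (auto simp: not_le)
    also have "\<dots> \<le> (\<Sum>n=1..N. real n powr (-\<sigma>))" by (rule sum_mono2) auto
    finally show ?thesis .
  qed
  then show "(\<Sum>n<N. real n powr (-\<sigma>)) \<le> \<sigma> / (\<sigma> - 1)"
    using sum_powr_le[OF assms] order_trans by blast
qed

lemma suminf_powr_ge:
  assumes "\<sigma> > (1::real)"
  shows "(\<Sum>n. real n powr (-\<sigma>)) \<ge> 1 / (\<sigma> - 1)"
proof -
  have "(1 - real (Suc N) powr (1-\<sigma>)) / (\<sigma>-1) \<le> (\<Sum>n<Suc N. real n powr (-\<sigma>))" for N
  proof (induction N)
    case (Suc N)
    then show ?case using powr_step(2)[OF assms, of "Suc N"] by (simp add: diff_divide_distrib)
  qed (use assms in auto)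
  moreover have "(\<Sum>n<Suc N. real n powr (-\<sigma>)) \<le> (\<Sum>n. real n powr (-\<sigma>))" for N
    by (rule sum_le_suminf[OF summable_powr_minus[OF assms]]) auto
  ultimately have le: "(1 - real (Suc N) powr (1-\<sigma>)) / (\<sigma>-1) \<le> (\<Sum>n. real n powr (-\<sigma>))" for N
    using order_trans by blast
  have "((\<lambda>N. (1 - real (Suc N) powr (1-\<sigma>)) / (\<sigma>-1)) \<longlonglongrightarrow> (1 - 0) / (\<sigma>-1))"
    using assms by (intro tendsto_intros) (real_asymp, simp)
  from LIMSEQ_le_const2[OF this] le show ?thesis by auto
qed

section \<open>Finite Euler products with a sifted remainder\<close>

lemma abs_summable_times:
  fixes g :: "'a \<Rightarrow> 'c :: real_normed_div_algebra" and h :: "'b \<Rightarrow> 'c"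
  assumes "(\<lambda>x. norm (g x)) summable_on A" "(\<lambda>y. norm (h y)) summable_on B"
  shows "(\<lambda>(x, y). norm (g x * h y)) summable_on A \<times> B"
proof (rule summable_on_SigmaI)
  show "((\<lambda>y. case (x, y) of (x, y) \<Rightarrow> norm (g x * h y)) has_sum (norm (g x) * infsum (\<lambda>y. norm (h y)) B)) B" for x
    using has_sum_cmult_right[OF has_sum_infsum[OF assms(2)], of "norm (g x)"] by (simp add: norm_mult)
  show "(\<lambda>x. norm (g x) * infsum (\<lambda>y. norm (h y)) B) summable_on A"
    by (rule summable_on_cmult_left[OF assms(1)])
qed auto

text \<open>Multiplicativity holds on coprime arguments only, so the values at the powers of one
  prime are unrelated. This freedom is what allows the Euler factor at 2 to vanish in the
  limit.\<close>

locale unimodular =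
  fixes f :: "nat \<Rightarrow> complex"
  assumes f_mult: "m \<ge> 1 \<Longrightarrow> n \<ge> 1 \<Longrightarrow> coprime m n \<Longrightarrow> f (m * n) = f m * f n"
    and norm_f: "n \<ge> 1 \<Longrightarrow> norm (f n) = 1"
begin

lemma f_1: "f (Suc 0) = 1"
  using f_mult[of 1 1] norm_f[of 1] by auto

definition sifted :: "nat set \<Rightarrow> real \<Rightarrow> real \<Rightarrow> complex" where
  "sifted Q \<sigma> t = (\<Sum>\<^sub>\<infinity>n\<in>{n. n \<ge> 1 \<and> (\<forall>p\<in>Q. \<not> p dvd n)}. f n * nps \<sigma> t n)"

definition euler :: "nat \<Rightarrow> real \<Rightarrow> real \<Rightarrow> complex" where
  "euler p \<sigma> t = (\<Sum>\<^sub>\<infinity>k. f (p ^ k) * nps \<sigma> t p ^ k)"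

lemma norm_term_le: "norm (f n * nps \<sigma> t n) \<le> real n powr (-\<sigma>)"
  by (cases "n = 0") (auto simp: norm_mult norm_f)

lemma summable_norm_term: "\<sigma> > 1 \<Longrightarrow> summable (\<lambda>n. norm (f n * nps \<sigma> t n))"
  by (rule summable_comparison_test'[OF summable_powr_minus, of \<sigma> 0]) (use norm_term_le in auto)

lemma abs_summable_term: "\<sigma> > 1 \<Longrightarrow> (\<lambda>n. norm (f n * nps \<sigma> t n)) summable_on A"
  using norm_summable_imp_summable_on[of "\<lambda>n. norm (f n * nps \<sigma> t n)"] summable_norm_term[of \<sigma> t]
  by (auto intro: summable_on_subset_banach)

lemma abs_summable_euler:
  assumes "\<sigma> > 1" "prime p"
  shows "(\<lambda>k. norm (f (p ^ k) * nps \<sigma> t p ^ k)) summable_on A"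
proof -
  have "(\<lambda>n. norm (f n * nps \<sigma> t n)) summable_on (\<lambda>k. p ^ k) ` A"
    by (rule abs_summable_term) fact
  moreover have "inj_on (\<lambda>k. p ^ k) A"
    using prime_gt_1_nat[OF assms(2)] by (auto simp: inj_on_def)
  ultimately show ?thesis
    by (subst (asm) summable_on_reindex) (auto simp: o_def nps_power)
qed

text \<open>Every integer free of \<open>Q\<close> is \<open>p ^ k * m\<close> with \<open>p\<close>
  not dividing \<open>m\<close> in exactly one way, the multiplicity of \<open>p\<close> recovering
  \<open>k\<close>. Coprimality of the two factors splits \<open>f\<close>, and absolute convergence
  splits the sum.\<close>

lemma sifted_insert:
  assumes s: "\<sigma> > 1" and Q: "\<And>q. q \<in> Q \<Longrightarrow> prime q" and p: "prime p" "p \<notin> Q"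
  shows "sifted Q \<sigma> t = euler p \<sigma> t * sifted (insert p Q) \<sigma> t"
proof -
  define C where "C = (\<lambda>Q::nat set. {n::nat. n \<ge> 1 \<and> (\<forall>p\<in>Q. \<not> p dvd n)})"
  let ?g = "\<lambda>(k, m). p ^ k * m"
  have pp: "\<not> q dvd p ^ k" if "q \<in> Q" for q k
    using Q[OF that] p that by (metis prime_dvd_power primes_dvd_imp_eq)
  have p0: "p > 1" using p prime_gt_1_nat by blast
  have bij: "bij_betw ?g (UNIV \<times> C (insert p Q)) (C Q)"
  proof (rule bij_betw_imageI)
    show "inj_on ?g (UNIV \<times> C (insert p Q))"
    proof (rule inj_onI, clarsimp)
      fix k m k' m' assume h: "m \<in> C (insert p Q)" "m' \<in> C (insert p Q)" "p ^ k * m = p ^ k' * m'"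
      have mk: "multiplicity p (p ^ k * m) = k" if "m \<in> C (insert p Q)" for k m
        using that p p0 by (subst prime_elem_multiplicity_mult_distrib) (auto simp: C_def not_dvd_imp_multiplicity_0)
      have "k = k'" using mk[OF h(1), of k] mk[OF h(2), of k'] h(3) by simp
      with h p0 show "k = k' \<and> m = m'" by auto
    qed
    show "?g ` (UNIV \<times> C (insert p Q)) = C Q"
    proof safe
      fix k m assume "m \<in> C (insert p Q)"
      then show "p ^ k * m \<in> C Q"
        using pp p0 Q by (auto simp: C_def prime_dvd_mult_iff)
    next
      fix n assume n: "n \<in> C Q"
      then have "n \<noteq> 0" "\<not> is_unit p" using p0 by (auto simp: C_def)
      from multiplicity_decompose'[OF this] obtain m where m: "n = p ^ multiplicity p n * m" "\<not> p dvd m" .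
      then have "m \<noteq> 0" using \<open>n \<noteq> 0\<close> by (metis mult_0_right)
      moreover have "\<not> q dvd m" if "q \<in> Q" for q using n that m(1) by (metis (no_types, lifting) C_def mem_Collect_eq dvd_mult)
      ultimately have "m \<in> C (insert p Q)" using m n by (auto simp: C_def)
      with m(1) show "n \<in> ?g ` (UNIV \<times> C (insert p Q))" by (metis (no_types, lifting) SigmaI UNIV_I case_prod_conv image_eqI)
    qed
  qed
  have tm: "f (p ^ k * m) * nps \<sigma> t (p ^ k * m) = (f (p ^ k) * nps \<sigma> t p ^ k) * (f m * nps \<sigma> t m)" if "m \<in> C (insert p Q)" for k m
  proof -
    have "coprime (p ^ k) m" using p that by (auto simp: C_def intro!: prime_imp_power_coprime_nat prime_imp_coprime_nat)
    then show ?thesis using that p0 by (subst f_mult) (auto simp: C_def nps_mult nps_power)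
  qed
  have sC: "sifted R \<sigma> t = (\<Sum>\<^sub>\<infinity>n\<in>C R. f n * nps \<sigma> t n)" for R
    by (simp add: sifted_def C_def)
  have "sifted Q \<sigma> t = (\<Sum>\<^sub>\<infinity>x\<in>UNIV \<times> C (insert p Q). (case x of (k, m) \<Rightarrow> (f (p ^ k) * nps \<sigma> t p ^ k) * (f m * nps \<sigma> t m)))"
    unfolding sC
    by (subst infsum_reindex_bij_betw[OF bij, symmetric]) (auto intro!: infsum_cong simp: tm)
  also have "\<dots> = (\<Sum>\<^sub>\<infinity>k. \<Sum>\<^sub>\<infinity>m\<in>C (insert p Q). (f (p ^ k) * nps \<sigma> t p ^ k) * (f m * nps \<sigma> t m))"
  proof (subst infsum_Sigma_banach[symmetric])
    show "(\<lambda>x. (case x of (k, m) \<Rightarrow> (f (p ^ k) * nps \<sigma> t p ^ k) * (f m * nps \<sigma> t m))) summable_on UNIV \<times> C (insert p Q)"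
      by (rule abs_summable_summable)
         (use abs_summable_times[OF abs_summable_euler[OF s p(1)] abs_summable_term[OF s]] in \<open>simp add: case_prod_unfold\<close>)
  qed simp
  also have "\<dots> = euler p \<sigma> t * sifted (insert p Q) \<sigma> t"
    by (simp add: infsum_cmult_right' infsum_cmult_left' euler_def sC)
  finally show ?thesis .
qed

lemma sifted_finite:
  assumes s: "\<sigma> > 1" and fin: "finite Q" and Q: "\<And>q. q \<in> Q \<Longrightarrow> prime q"
  shows "sifted {} \<sigma> t = (\<Prod>p\<in>Q. euler p \<sigma> t) * sifted Q \<sigma> t"
  using fin Q
proof (induction Q rule: finite_induct)
  case (insert p Q)
  then show ?case using sifted_insert[OF s, of Q p t] by (simp add: mult_ac)
qed simp

lemma sifted_empty:
  assumes "\<sigma> > 1"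
  shows "sifted {} \<sigma> t = (\<Sum>n. f n * nps \<sigma> t n)"
proof -
  have "sifted {} \<sigma> t = infsum (\<lambda>n. f n * nps \<sigma> t n) UNIV"
    unfolding sifted_def by (rule infsum_cong_neutral) (auto simp: not_le)
  also have "\<dots> = (\<Sum>n. f n * nps \<sigma> t n)"
    by (rule infsumI[OF norm_summable_imp_has_sum[OF summable_norm_term[OF assms]
          summable_sums[OF summable_norm_cancel[OF summable_norm_term[OF assms]]]]])
  finally show ?thesis .
qed

end

section \<open>Estimates for a single Euler factor\<close>

text \<open>\<open>1 - r\<close> is the inverse of the Euler factor of the zeta function, so the
  product is near 1 when \<open>c 1\<close> is. The error consists of \<open>R * (1 - r)\<close> and
  \<open>c 1 * r^2\<close>, each of norm at most \<open>r^2\<close>.\<close>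

lemma euler_factor_approx:
  fixes c :: "nat \<Rightarrow> complex"
  assumes c: "\<And>k. norm (c k) = 1" and c0: "c 0 = 1" and r: "0 \<le> r" "r \<le> 1/2"
  shows "norm ((\<Sum>k. c k * of_real (r ^ k)) * of_real (1 - r) - (1 + (c 1 - 1) * of_real r)) \<le> 2 * r^2"
    and "norm ((\<Sum>k. c k * of_real (r ^ k)) - 1) \<le> r / (1 - r)"
proof -
  have sn: "summable (\<lambda>k. norm (c k * of_real (r ^ k)))"
    using r by (simp add: norm_mult c norm_power summable_geometric)
  then have sm: "summable (\<lambda>k. c k * of_real (r ^ k))" by (rule summable_norm_cancel)
  define R where "R = (\<Sum>k. c (k + 2) * of_real (r ^ (k + 2)))"
  define R1 where "R1 = (\<Sum>k. c (k + 1) * of_real (r ^ (k + 1)))"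
  have nR: "norm (\<Sum>k. c (k + j) * of_real (r ^ (k + j))) \<le> r^j / (1 - r)" for j
  proof -
    have "norm (\<Sum>k. c (k + j) * of_real (r ^ (k + j))) \<le> (\<Sum>k. norm (c (k + j) * of_real (r ^ (k + j))))"
      using sn by (intro summable_norm) (subst summable_iff_shift[of "\<lambda>k. norm (c k * of_real (r ^ k))"])
    also have "\<dots> = (\<Sum>k. r^j * r^k)" using r by (simp add: norm_mult c norm_power power_add mult_ac)
    also have "\<dots> = r^j / (1 - r)" using r by (subst suminf_mult) (auto simp: suminf_geometric summable_geometric)
    finally show ?thesis .
  qed
  have E1: "(\<Sum>k. c k * of_real (r ^ k)) = 1 + R1"
    using suminf_split_initial_segment[OF sm, of 1] c0 by (simp add: R1_def)
  have E2: "(\<Sum>k. c k * of_real (r ^ k)) = 1 + c 1 * of_real r + R"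
    using suminf_split_initial_segment[OF sm, of 2] c0 by (simp add: R_def numeral_2_eq_2)
  show "norm ((\<Sum>k. c k * of_real (r ^ k)) - 1) \<le> r / (1 - r)"
    unfolding E1 R1_def using nR[of 1] by simp
  have "(\<Sum>k. c k * of_real (r ^ k)) * of_real (1 - r) - (1 + (c 1 - 1) * of_real r) = R * of_real (1 - r) - c 1 * of_real (r^2)"
    unfolding E2 by (simp add: algebra_simps power2_eq_square)
  also have "norm \<dots> \<le> norm (R * of_real (1 - r)) + norm (c 1 * of_real (r^2))" by (rule norm_triangle_ineq4)
  also have "\<dots> \<le> r^2 / (1 - r) * (1 - r) + r^2"
  proof (rule add_mono)
    have "norm (R * of_real (1 - r)) = norm R * (1 - r)" using r by (simp add: norm_mult del: of_real_diff)
    then show "norm (R * of_real (1 - r)) \<le> r^2 / (1 - r) * (1 - r)"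
      using nR[of 2] r unfolding R_def by (simp only:) (rule mult_right_mono, auto)
  qed (simp add: norm_mult c norm_power)
  also have "\<dots> = 2 * r^2" using r by simp
  finally show "norm ((\<Sum>k. c k * of_real (r ^ k)) * of_real (1 - r) - (1 + (c 1 - 1) * of_real r)) \<le> 2 * r^2" .
qed

lemma norm_one_plus_square:
  assumes "norm z = 1"
  shows "(norm (1 + (z - 1) * of_real r))\<^sup>2 = 1 - 2 * r * (1 - r) * (1 - Re z)"
proof -
  have "(Re z)\<^sup>2 + (Im z)\<^sup>2 = 1" using assms by (metis cmod_power2 one_power2)
  then have "r\<^sup>2 * ((Re z)\<^sup>2 + (Im z)\<^sup>2) = r\<^sup>2" by simp
  then show ?thesis by (simp only: cmod_power2) (simp add: power2_eq_square algebra_simps)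
qed

text \<open>With \<open>N\<close> the norm of the linear approximation, the upper bound comes from
  \<open>N^2 \<le> 1 - r * v \<le> (1 - r * v / 2)^2\<close> and the lower one from
  \<open>(1 - 2 * r * v)^2 \<le> 1 - 2 * r * v \<le> N^2\<close>. The third bound is for the
  finitely many primes at which the second is too weak; among the primes, \<open>r \<le> 1/3\<close>
  leaves only 2 uncovered.\<close>

lemma euler_factor_bounds:
  fixes c :: "nat \<Rightarrow> complex"
  assumes c: "\<And>k. norm (c k) = 1" and c0: "c 0 = 1" and r: "0 \<le> r" "r \<le> 1/2"
  defines "E \<equiv> (\<Sum>k. c k * of_real (r ^ k))" and "v \<equiv> 1 - Re (c 1)"
  shows "norm E * (1 - r) \<le> exp (2 * r^2 - r * v / 2)"
    and "norm E * (1 - r) \<ge> 1 - (2 * r * v + 2 * r^2)"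
    and "r \<le> 1/3 \<Longrightarrow> norm E * (1 - r) \<ge> 1/3"
proof -
  define N where "N = norm (1 + (c 1 - 1) * of_real r)"
  have N2: "N\<^sup>2 = 1 - 2 * r * (1 - r) * v" unfolding N_def v_def by (rule norm_one_plus_square[OF c])
  have N0: "N \<ge> 0" by (simp add: N_def)
  have v: "0 \<le> v" "v \<le> 2" using c[of 1] complex_Re_le_cmod[of "c 1"] abs_Re_le_cmod[of "c 1"] by (auto simp: v_def)
  have nE: "norm (E * of_real (1 - r)) = norm E * (1 - r)" using r by (simp add: norm_mult del: of_real_diff)
  have ap: "norm (E * of_real (1 - r) - (1 + (c 1 - 1) * of_real r)) \<le> 2 * r^2"
    unfolding E_def using euler_factor_approx(1)[where c = c and r = r, OF c c0 r] .
  have a1: "norm E * (1 - r) \<le> N + 2 * r^2"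
    using ap norm_triangle_ineq2[of "E * of_real (1 - r)" "1 + (c 1 - 1) * of_real r"] unfolding nE N_def by linarith
  have a2: "norm E * (1 - r) \<ge> N - 2 * r^2"
    using ap norm_triangle_ineq3[of "E * of_real (1 - r)" "1 + (c 1 - 1) * of_real r"] unfolding nE N_def by linarith
  have rv: "0 \<le> r * v" "r * v \<le> 1" using r v mult_mono[of r "1/2" v 2] by auto
  have rr: "r * (r * v) \<le> 1/2 * (r * v)" "0 \<le> r * (r * v)" using mult_right_mono[OF r(2) rv(1)] mult_nonneg_nonneg[OF r(1) rv(1)] by auto
  have "N\<^sup>2 \<le> (1 - r * v / 2)\<^sup>2"
    unfolding N2 using rr zero_le_power2[of "r * v"] by (simp add: power2_eq_square algebra_simps)
  then have "N \<le> 1 - r * v / 2" using rv by (auto intro: power2_le_imp_le)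
  also have "1 - r * v / 2 + 2 * r^2 \<le> exp (2 * r^2 - r * v / 2)"
    using exp_ge_add_one_self[of "2 * r^2 - r * v / 2"] by linarith
  finally show "norm E * (1 - r) \<le> exp (2 * r^2 - r * v / 2)" using a1 by linarith
  show "norm E * (1 - r) \<ge> 1 - (2 * r * v + 2 * r^2)"
  proof (cases "2 * r * v \<le> 1")
    case True
    have "(1 - 2 * r * v)\<^sup>2 \<le> 1 - 2 * r * v"
      using True rv mult_left_le[of "1 - 2 * r * v" "1 - 2 * r * v"] by (simp add: power2_eq_square)
    also have "\<dots> \<le> N\<^sup>2" unfolding N2 using rr by (simp add: algebra_simps)
    finally have "1 - 2 * r * v \<le> N" using N0 by (rule power2_le_imp_le)
    with a2 show ?thesis by linarith
  next
    case False
    then have "1 - (2 * r * v + 2 * r^2) \<le> 0" by (smt (verit) zero_le_power2)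
    also have "0 \<le> norm E * (1 - r)" using r by simp
    finally show ?thesis .
  qed
  show "norm E * (1 - r) \<ge> 1/3" if r3: "r \<le> 1/3"
  proof -
    have "norm (E - 1) \<le> r / (1 - r)" unfolding E_def using euler_factor_approx(2)[where c = c and r = r, OF c c0 r] .
    also have "\<dots> \<le> 1/2" using r3 r by (simp add: field_simps)
    finally have "norm E \<ge> 1/2" using norm_triangle_ineq3[of E 1] by (simp add: abs_le_iff) 
    then have "norm E * (1 - r) \<ge> 1/2 * (2/3)" using r3 by (intro mult_mono) auto
    then show ?thesis by simp
  qed
qed

text \<open>The \<open>sifted\<close> sum of the constant function 1 at \<open>t = 0\<close>, kept
  as a real number. For a finite set \<open>Q\<close> of primes it is the zeta function with the
  Euler factors at \<open>Q\<close> removed.\<close>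

definition zsift :: "nat set \<Rightarrow> real \<Rightarrow> real" where
  "zsift Q \<sigma> = (\<Sum>\<^sub>\<infinity>n\<in>{n. n \<ge> 1 \<and> (\<forall>p\<in>Q. \<not> p dvd n)}. real n powr (-\<sigma>))"

text \<open>Makes the product formula available for the zeta function, against which every other
  series is compared.\<close>

interpretation one: unimodular "\<lambda>_. 1" by unfold_locales auto

lemma nps_real: "nps \<sigma> 0 n = of_real (real n powr (-\<sigma>))"
  by (simp add: nps_def)

lemma summable_on_powr: "\<sigma> > 1 \<Longrightarrow> (\<lambda>n. real n powr (-\<sigma>)) summable_on A"
  using norm_summable_imp_summable_on[of "\<lambda>n. real n powr (-\<sigma>)"] summable_powr_minus[of \<sigma>]
  by (auto intro: summable_on_subset_banach)

lemma prime_powr_le_half: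
  assumes "\<sigma> \<ge> 1" "prime p"
  shows "real p powr (-\<sigma>) \<le> 1 / real p" "real p powr (-\<sigma>) \<le> 1/2"
proof -
  have p: "real p \<ge> 2" using prime_ge_2_nat[OF assms(2)] by simp
  have "real p powr (-\<sigma>) \<le> real p powr (-1)" using assms p by (intro powr_mono) auto
  then show "real p powr (-\<sigma>) \<le> 1 / real p" using p by (simp add: powr_minus divide_inverse)
  also have "\<dots> \<le> 1/2" using p by (simp add: field_simps)
  finally show "real p powr (-\<sigma>) \<le> 1/2" .
qed

lemma zsift_finite:
  assumes s: "\<sigma> > 1" and fin: "finite Q" and Q: "\<And>q. q \<in> Q \<Longrightarrow> prime q"
  shows "zsift Q \<sigma> = (\<Prod>p\<in>Q. 1 - real p powr (-\<sigma>)) * (\<Sum>n. real n powr (-\<sigma>))"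
proof -
  have z: "one.sifted Q \<sigma> 0 = of_real (zsift Q \<sigma>)" for Q
    unfolding one.sifted_def zsift_def mult_1 nps_real
    by (rule infsumI, rule has_sum_of_real) (auto intro!: has_sum_infsum summable_on_powr s)
  have e: "one.euler p \<sigma> 0 = of_real (1 / (1 - real p powr (-\<sigma>)))" if "p \<in> Q" for p
  proof -
    have r: "norm (complex_of_real (real p powr (-\<sigma>))) < 1"
      using prime_powr_le_half(2)[of \<sigma> p] s Q[OF that] by simp
    have "one.euler p \<sigma> 0 = (\<Sum>\<^sub>\<infinity>k. of_real (real p powr (-\<sigma>)) ^ k)"
      by (simp add: one.euler_def nps_real)
    also have "\<dots> = (\<Sum>k. of_real (real p powr (-\<sigma>)) ^ k)"
      using r by (intro infsumI norm_summable_imp_has_sum summable_sums summable_geometric) (auto simp: norm_power summable_geometric)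
    also have "\<dots> = of_real (1 / (1 - real p powr (-\<sigma>)))"
      using r by (subst suminf_geometric) auto
    finally show ?thesis .
  qed
  have nz: "(\<Prod>p\<in>Q. 1 - real p powr (-\<sigma>)) \<noteq> 0"
  proof -
    have "1 - real p powr (-\<sigma>) \<noteq> 0" if "p \<in> Q" for p
      using prime_powr_le_half(2)[of \<sigma> p] s Q[OF that] by auto
    then show ?thesis by (simp add: prod_zero_iff[OF fin])
  qed
  have "one.sifted {} \<sigma> 0 = complex_of_real (\<Sum>n. real n powr (-\<sigma>))"
    unfolding one.sifted_empty[OF s] using suminf_of_real[OF summable_powr_minus[OF s], where ?'a = complex] by (simp add: nps_real)
  moreover have "one.sifted {} \<sigma> 0 = (\<Prod>p\<in>Q. one.euler p \<sigma> 0) * one.sifted Q \<sigma> 0"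
    by (rule one.sifted_finite[OF s fin Q])
  moreover have "(\<Prod>p\<in>Q. one.euler p \<sigma> 0) = of_real (\<Prod>p\<in>Q. 1 / (1 - real p powr (-\<sigma>)))"
    using e by (subst of_real_prod) (intro prod.cong refl, auto)
  ultimately have "complex_of_real (\<Sum>n. real n powr (-\<sigma>)) = of_real ((\<Prod>p\<in>Q. 1 / (1 - real p powr (-\<sigma>))) * zsift Q \<sigma>)"
    unfolding z by simp
  then have "(\<Sum>n. real n powr (-\<sigma>)) = (\<Prod>p\<in>Q. 1 / (1 - real p powr (-\<sigma>))) * zsift Q \<sigma>"
    by (simp only: of_real_eq_iff)
  then show ?thesis using nz by (simp add: prod_dividef)
qed

context unimodular
begin

definition coef :: "real \<Rightarrow> nat \<Rightarrow> nat \<Rightarrow> complex" where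
  "coef t p k = f (p ^ k) * cis (- t * ln (real p)) ^ k"

definition defect :: "real \<Rightarrow> nat \<Rightarrow> real" where
  "defect t p = 1 - Re (f p * cis (- t * ln (real p)))"

lemma norm_coef: "prime p \<Longrightarrow> norm (coef t p k) = 1"
  using prime_gt_0_nat[of p] by (simp add: coef_def norm_mult norm_power norm_f Suc_leI)

lemma coef_0 [simp]: "coef t p 0 = 1"
  by (simp add: coef_def f_1)

lemma coef_1: "1 - Re (coef t p 1) = defect t p"
  by (simp add: coef_def defect_def)

lemma defect_nonneg: "prime p \<Longrightarrow> defect t p \<ge> 0"
  using complex_Re_le_cmod[of "coef t p 1"] norm_coef[of p t 1] unfolding coef_1[symmetric] by simp

lemma euler_coef:
  assumes s: "\<sigma> > 1" and p: "prime p"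
  shows "euler p \<sigma> t = (\<Sum>k. coef t p k * of_real ((real p powr (-\<sigma>)) ^ k))"
proof -
  have eq: "f (p ^ k) * nps \<sigma> t p ^ k = coef t p k * of_real ((real p powr (-\<sigma>)) ^ k)" for k
    by (simp add: coef_def nps_def power_mult_distrib)
  have "summable (\<lambda>k. norm (coef t p k * of_real ((real p powr (-\<sigma>)) ^ k)))"
    using prime_powr_le_half(2)[of \<sigma> p] s p by (simp add: norm_mult norm_coef norm_power summable_geometric)
  then show ?thesis unfolding euler_def eq
    by (intro infsumI norm_summable_imp_has_sum summable_sums) (auto dest: summable_norm_cancel)
qed

lemma norm_sifted_le:
  assumes "\<sigma> > 1"
  shows "norm (sifted Q \<sigma> t) \<le> zsift Q \<sigma>"
  unfolding sifted_def zsift_def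
  by (rule norm_infsum_le[OF has_sum_infsum has_sum_infsum])
     (use norm_term_le abs_summable_summable[OF abs_summable_term[OF assms]] summable_on_powr[OF assms] in auto)

text \<open>The term \<open>n = 1\<close> contributes 1, and all others together at most
  \<open>zsift Q \<sigma> - 1\<close>. Once \<open>zsift\<close> is at most 4/3, the bound is at
  least half of \<open>zsift\<close>.\<close>

lemma norm_sifted_ge:
  assumes s: "\<sigma> > 1" and Q: "\<And>q. q \<in> Q \<Longrightarrow> prime q"
  shows "norm (sifted Q \<sigma> t) \<ge> 2 - zsift Q \<sigma>"
proof -
  let ?C = "{n. n \<ge> 1 \<and> (\<forall>p\<in>Q. \<not> p dvd n)}"
  have 1: "1 \<in> ?C" using Q by (auto simp: prime_nat_iff)
  have C: "insert 1 (?C - {1}) = ?C" using 1 by blast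
  have "sifted Q \<sigma> t = infsum (\<lambda>n. f n * nps \<sigma> t n) (insert 1 (?C - {1}))"
    unfolding C sifted_def ..
  also have "\<dots> = 1 + infsum (\<lambda>n. f n * nps \<sigma> t n) (?C - {1})"
    by (subst infsum_insert) (auto simp: f_1 intro: abs_summable_summable[OF abs_summable_term[OF s]])
  finally have a: "sifted Q \<sigma> t = 1 + infsum (\<lambda>n. f n * nps \<sigma> t n) (?C - {1})" .
  have "zsift Q \<sigma> = infsum (\<lambda>n. real n powr (-\<sigma>)) (insert 1 (?C - {1}))"
    unfolding C zsift_def ..
  also have "\<dots> = 1 + infsum (\<lambda>n. real n powr (-\<sigma>)) (?C - {1})"
    by (subst infsum_insert) (auto intro: summable_on_powr[OF s])
  finally have b: "zsift Q \<sigma> = 1 + infsum (\<lambda>n. real n powr (-\<sigma>)) (?C - {1})" .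
  have "norm (infsum (\<lambda>n. f n * nps \<sigma> t n) (?C - {1})) \<le> infsum (\<lambda>n. real n powr (-\<sigma>)) (?C - {1})"
    by (rule norm_infsum_le[OF has_sum_infsum has_sum_infsum])
       (use norm_term_le abs_summable_summable[OF abs_summable_term[OF s]] summable_on_powr[OF s] in auto)
  then show ?thesis unfolding a b using norm_diff_ineq[of 1 "infsum (\<lambda>n. f n * nps \<sigma> t n) (?C - {1})"] by simp
qed

section \<open>Upper bounds for the Dirichlet series near the line of absolute convergence\<close>

text \<open>The sifted remainder is at most that of the zeta function, which supplies a factor
  \<open>1 - p powr (-\<sigma>)\<close> for each \<open>p\<close> in \<open>Q\<close>; so any finite
  \<open>Q\<close> yields a bound. The 4 absorbs the quadratic errors, since the sum of
  \<open>n powr (-2)\<close> is at most 2.\<close>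

lemma series_upper:
  assumes s: "\<sigma> > 1" and fin: "finite Q" and Q: "\<And>q. q \<in> Q \<Longrightarrow> prime q"
  shows "norm (\<Sum>n. f n * nps \<sigma> t n) \<le> \<sigma> / (\<sigma> - 1) * exp (4 - (\<Sum>p\<in>Q. defect t p * real p powr (-\<sigma>)) / 2)"
proof -
  let ?r = "\<lambda>p. real p powr (-\<sigma>)"
  have r: "0 \<le> ?r p" "?r p \<le> 1/2" "?r p \<le> 1 / real p" if "p \<in> Q" for p
    using prime_powr_le_half[of \<sigma> p] Q[OF that] s by auto
  have "norm (\<Sum>n. f n * nps \<sigma> t n) = (\<Prod>p\<in>Q. norm (euler p \<sigma> t)) * norm (sifted Q \<sigma> t)"
    using sifted_finite[OF s fin Q, of t] by (simp add: norm_mult prod_norm sifted_empty[OF s])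
  also have "\<dots> \<le> (\<Prod>p\<in>Q. norm (euler p \<sigma> t)) * zsift Q \<sigma>"
    by (intro mult_left_mono norm_sifted_le s prod_nonneg) auto
  also have "\<dots> = (\<Prod>p\<in>Q. norm (euler p \<sigma> t) * (1 - ?r p)) * (\<Sum>n. real n powr (-\<sigma>))"
    by (simp add: zsift_finite[OF s fin Q] prod.distrib)
  also have "\<dots> \<le> (\<Prod>p\<in>Q. exp (2 * (?r p)\<^sup>2 - ?r p * defect t p / 2)) * (\<sigma> / (\<sigma> - 1))"
  proof (intro mult_mono prod_mono suminf_powr_le s conjI)
    fix p assume p: "p \<in> Q"
    show "norm (euler p \<sigma> t) * (1 - ?r p) \<le> exp (2 * (?r p)\<^sup>2 - ?r p * defect t p / 2)"
      unfolding euler_coef[OF s Q[OF p]] coef_1[symmetric]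
      by (rule euler_factor_bounds(1)) (use r[OF p] Q[OF p] in \<open>auto simp: norm_coef\<close>)
    show "0 \<le> norm (euler p \<sigma> t) * (1 - ?r p)" using r[OF p] by simp
  qed (use s in \<open>auto intro!: suminf_nonneg summable_powr_minus prod_nonneg\<close>)
  also have "(\<Prod>p\<in>Q. exp (2 * (?r p)\<^sup>2 - ?r p * defect t p / 2)) = exp (2 * (\<Sum>p\<in>Q. (?r p)\<^sup>2) - (\<Sum>p\<in>Q. defect t p * ?r p) / 2)"
    by (simp add: exp_sum[OF fin, symmetric] sum_subtractf sum_distrib_left sum_divide_distrib mult_ac)
  finally have X: "norm (\<Sum>n. f n * nps \<sigma> t n) \<le> exp (2 * (\<Sum>p\<in>Q. (?r p)\<^sup>2) - (\<Sum>p\<in>Q. defect t p * ?r p) / 2) * (\<sigma> / (\<sigma> - 1))" .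
  have Y: "exp (2 * (\<Sum>p\<in>Q. (?r p)\<^sup>2) - (\<Sum>p\<in>Q. defect t p * ?r p) / 2) \<le> exp (4 - (\<Sum>p\<in>Q. defect t p * ?r p) / 2)"
  proof -
    have "(\<Sum>p\<in>Q. (?r p)\<^sup>2) \<le> (\<Sum>p\<in>Q. real p powr (-2))"
    proof (rule sum_mono)
      fix p assume p: "p \<in> Q"
      have "(?r p)\<^sup>2 \<le> (1 / real p)\<^sup>2" using r[OF p] by (intro power_mono) auto
      also have "\<dots> = real p powr (-2)" using prime_gt_0_nat[OF Q[OF p]] by (simp add: powr_minus power_inverse divide_inverse)
      finally show "(?r p)\<^sup>2 \<le> real p powr (-2)" .
    qed
    also have "\<dots> \<le> (\<Sum>n. real n powr (-2))"
      by (intro sum_le_suminf summable_powr_minus fin) auto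
    also have "\<dots> \<le> 2 / (2 - 1)" by (rule suminf_powr_le) simp
    finally show ?thesis by simp
  qed
  show ?thesis
    using order_trans[OF X mult_right_mono[OF Y, of "\<sigma> / (\<sigma> - 1)"]] s by (simp add: mult.commute)
qed

text \<open>An integer free of all primes up to \<open>N\<close> is 1 or exceeds \<open>N\<close>,
  so only 1 and a tail of a convergent series remain. Here \<open>N\<close> depends on
  \<open>\<sigma>\<close>, which later estimates must survive.\<close>

lemma zsift_tail:
  assumes s: "\<sigma> > 1"
  shows "\<exists>N. \<forall>Q. {p. prime p \<and> p \<le> N} \<subseteq> Q \<longrightarrow> zsift Q \<sigma> \<le> 4/3"
proof -
  have "\<exists>N. \<forall>n\<ge>N. norm (\<Sum>i. real (i + n) powr (-\<sigma>)) < 1/3"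
    by (rule suminf_exist_split) (use summable_powr_minus[OF s] in auto)
  then obtain N where N: "norm (\<Sum>i. real (i + N) powr (-\<sigma>)) < 1/3" by blast
  have "zsift Q \<sigma> \<le> 4/3" if Q: "{p. prime p \<and> p \<le> N} \<subseteq> Q" for Q
  proof -
    let ?C = "{n. n \<ge> 1 \<and> (\<forall>p\<in>Q. \<not> p dvd n)}"
    have sub: "?C \<subseteq> insert 1 {N..}"
    proof
      fix n assume n: "n \<in> ?C"
      show "n \<in> insert 1 {N..}"
      proof (cases "n = 1")
        case False
        then obtain p where p: "prime p" "p dvd n" using prime_factor_nat by blast
        then have "p \<notin> Q" using n by auto
        then have "p > N" using Q p by auto
        moreover have "p \<le> n" using p n by (auto intro: dvd_imp_le)
        ultimately show ?thesis by auto
      qed simp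
    qed
    have "zsift Q \<sigma> \<le> infsum (\<lambda>n. real n powr (-\<sigma>)) (insert 1 {N..})"
      unfolding zsift_def using sub by (intro infsum_mono2 summable_on_powr s) auto
    also have "\<dots> \<le> 1 + infsum (\<lambda>n. real n powr (-\<sigma>)) {N..}"
    proof (cases "1 \<in> {N..}")
      case True then show ?thesis by (simp add: insert_absorb)
    next
      case False then show ?thesis by (subst infsum_insert) (auto intro!: summable_on_powr s)
    qed
    also have "infsum (\<lambda>n. real n powr (-\<sigma>)) {N..} = infsum (\<lambda>i. real (i + N) powr (-\<sigma>)) UNIV"
      by (rule infsum_reindex_bij_betw[symmetric, of _ UNIV]) (auto intro!: bij_betwI[of _ _ _ "\<lambda>n. n - N"])
    also have "\<dots> = (\<Sum>i. real (i + N) powr (-\<sigma>))"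
      by (intro infsumI norm_summable_imp_has_sum summable_sums)
         (use summable_powr_minus[OF s] summable_iff_shift[of "\<lambda>n. real n powr (-\<sigma>)" N] in auto)
    finally show ?thesis using N by simp
  qed
  then show ?thesis by blast
qed

end

context unimodular
begin

text \<open>A finite set of primes whose defects add up to more than \<open>M\<close> at one
  \<open>t\<close> does so on a neighbourhood, because a finite sum is continuous in
  \<open>t\<close>. Finitely many such sets cover \<open>[-T, T]\<close>, and since defects are
  nonnegative their union \<open>R\<close> serves all \<open>t\<close>. Only then is
  \<open>\<sigma>\<close> brought close to 1, depending on \<open>R\<close>.\<close>

lemma series_small_uniformly:
  assumes div: "\<And>t M. \<exists>Q. finite Q \<and> (\<forall>q\<in>Q. prime q) \<and> (\<Sum>p\<in>Q. defect t p / real p) > M"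
    and e: "\<epsilon> > 0"
  shows "\<exists>\<delta>>0. \<forall>\<sigma> t. 1 < \<sigma> \<longrightarrow> \<sigma> < 1 + \<delta> \<longrightarrow> \<bar>t\<bar> \<le> T \<longrightarrow>
     norm (\<Sum>n. f n * nps \<sigma> t n) \<le> \<epsilon> / (\<sigma> - 1)"
proof -
  \<comment> \<open>Solves \<open>2 * exp (4 - M / 4) = \<epsilon>\<close>. One halving of
    \<open>M\<close> is in \<open>series_upper\<close>, the other is lost in replacing
    \<open>1 / p\<close> by \<open>p powr (-\<sigma>)\<close>; the factor 2 bounds
    \<open>\<sigma>\<close>.\<close>
  define M where "M = 4 * (4 + ln (2 / \<epsilon>))"
  have "\<forall>t. \<exists>Q. finite Q \<and> (\<forall>q\<in>Q. prime q) \<and> (\<Sum>p\<in>Q. defect t p / real p) > M" using div by blast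
  then obtain Q where Q: "\<And>t. finite (Q t)" "\<And>t q. q \<in> Q t \<Longrightarrow> prime q" "\<And>t. (\<Sum>p\<in>Q t. defect t p / real p) > M"
    by metis
  define U where "U = (\<lambda>t. {t'. (\<Sum>p\<in>Q t. defect t' p / real p) > M})"
  have opn: "open (U t)" for t
    unfolding U_def defect_def divide_inverse by (intro open_Collect_less continuous_intros)
  have cov: "{-T..T} \<subseteq> (\<Union>t\<in>{-T..T}. U t)" using Q(3) by (auto simp: U_def)
  obtain J where J: "J \<subseteq> {-T..T}" "finite J" "{-T..T} \<subseteq> (\<Union>t\<in>J. U t)"
    using compactE_image[OF compact_Icc[of "-T" T], of "{-T..T}" U] opn cov by metis
  define R where "R = (\<Union>t\<in>J. Q t)"
  have finR: "finite R" using J Q by (auto simp: R_def)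
  have prR: "prime q" if "q \<in> R" for q using that Q by (auto simp: R_def)
  have big: "(\<Sum>p\<in>R. defect t p / real p) > M" if "\<bar>t\<bar> \<le> T" for t
  proof -
    have "t \<in> {-T..T}" using that by auto
    then obtain j where j: "j \<in> J" "t \<in> U j" using J(3) by blast
    have "M < (\<Sum>p\<in>Q j. defect t p / real p)" using j by (auto simp: U_def)
    also have "\<dots> \<le> (\<Sum>p\<in>R. defect t p / real p)"
      using j finR prR by (intro sum_mono2) (auto simp: R_def defect_nonneg)
    finally show ?thesis .
  qed
  \<comment> \<open>Some common bound for the primes in \<open>R\<close>, at least 2 so that
    \<open>ln P > 0\<close>. The choice of \<open>\<delta>\<close> then gives
    \<open>p powr (\<sigma> - 1) \<le> 2\<close> for each of them.\<close>
  define P where "P = real (\<Sum>p\<in>R. p) + 2"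
  have P: "P \<ge> 2" by (simp add: P_def sum_nonneg)
  have pP: "real p \<le> P" if "p \<in> R" for p
    using member_le_sum[OF that, of "\<lambda>p. real p"] finR by (auto simp: P_def)
  define \<delta> where "\<delta> = min 1 (ln 2 / ln P)"
  have d0: "\<delta> > 0" using P by (simp add: \<delta>_def)
  have "norm (\<Sum>n. f n * nps \<sigma> t n) \<le> \<epsilon> / (\<sigma> - 1)" if s: "1 < \<sigma>" "\<sigma> < 1 + \<delta>" and t: "\<bar>t\<bar> \<le> T" for \<sigma> t
  proof -
    have half: "real p powr (-\<sigma>) \<ge> (1 / real p) / 2" if p: "p \<in> R" for p
    proof -
      have p0: "real p \<ge> 2" using prime_ge_2_nat[OF prR[OF p]] by simp
      have "(\<sigma> - 1) * ln (real p) \<le> (ln 2 / ln P) * ln P"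
        using s p0 P pP[OF p] by (intro mult_mono) (auto simp: \<delta>_def)
      also have "\<dots> = ln 2" using P by simp
      finally have "exp (- ((\<sigma> - 1) * ln (real p))) \<ge> exp (- ln 2)" by simp
      then have "real p powr (1 - \<sigma>) \<ge> 1 / 2" using p0 by (simp add: powr_def exp_minus algebra_simps)
      then have "real p powr (1 - \<sigma>) / real p \<ge> (1 / 2) / real p" using p0 by (intro divide_right_mono) auto
      then show ?thesis using p0 by (simp add: powr_diff powr_minus divide_simps)
    qed
    have "M / 2 \<le> (\<Sum>p\<in>R. defect t p / real p) / 2" using big[OF t] by simp
    also have "\<dots> = (\<Sum>p\<in>R. defect t p * ((1 / real p) / 2))" by (simp add: sum_divide_distrib)
    also have "\<dots> \<le> (\<Sum>p\<in>R. defect t p * real p powr (-\<sigma>))"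
      using half prR defect_nonneg by (intro sum_mono mult_left_mono) auto
    finally have M: "M / 2 \<le> (\<Sum>p\<in>R. defect t p * real p powr (-\<sigma>))" .
    have "norm (\<Sum>n. f n * nps \<sigma> t n) \<le> \<sigma> / (\<sigma> - 1) * exp (4 - (\<Sum>p\<in>R. defect t p * real p powr (-\<sigma>)) / 2)"
      by (rule series_upper[OF s(1) finR prR])
    also have "\<dots> \<le> 2 / (\<sigma> - 1) * exp (4 - M / 4)"
      using s M by (intro mult_mono divide_right_mono) (auto simp: \<delta>_def)
    also have "exp (4 - M / 4) = \<epsilon> / 2"
    proof -
      have "4 - M / 4 = ln (\<epsilon> / 2)" using e by (simp add: M_def ln_div field_simps)
      then show ?thesis using e by simp
    qed
    also have "2 / (\<sigma> - 1) * (\<epsilon> / 2) = \<epsilon> / (\<sigma> - 1)" using s by (simp add: divide_simps)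
    finally show ?thesis .
  qed
  with d0 show ?thesis by blast
qed

section \<open>The lower bound and the prime 2\<close>

text \<open>If the sum vanished, adding the geometric series to its real part would give total 2 for
  the nonnegative terms \<open>(1 + Re (coef t 2 k)) * (1/2) ^ k\<close>. The term
  \<open>k = 0\<close> is already 2, so all others are 0, and a number of modulus 1 with real part
  -1 is -1.\<close>

lemma euler_two_nonzero:
  assumes "\<exists>k\<ge>1. coef t 2 k \<noteq> -1"
  shows "(\<Sum>k. coef t 2 k * of_real ((1/2) ^ k)) \<noteq> 0"
proof
  assume z: "(\<Sum>k. coef t 2 k * of_real ((1/2) ^ k)) = 0"
  have nc: "norm (coef t 2 k) = 1" for k by (rule norm_coef) simp
  have sm: "summable (\<lambda>k. coef t 2 k * of_real ((1/2) ^ k))"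
    by (rule summable_norm_cancel) (simp add: norm_mult nc norm_power summable_geometric)
  have g: "summable (\<lambda>k. (1/2::real) ^ k)" by (simp add: summable_geometric)
  have re: "(\<lambda>k. Re (coef t 2 k) * (1/2) ^ k) sums 0"
    using sums_Re[OF summable_sums[OF sm]] z by (simp only: Re_mult_of_real[symmetric]) simp
  have "(\<lambda>k. Re (coef t 2 k) * (1/2) ^ k + (1/2) ^ k) sums (0 + 2)"
    using geometric_sums[of "1/2::real"] by (intro sums_add re) simp
  then have S: "(\<lambda>k. (1 + Re (coef t 2 k)) * (1/2) ^ k) sums 2" by (simp add: algebra_simps)
  have nn: "(1 + Re (coef t 2 k)) * (1/2) ^ k \<ge> 0" for k
    using abs_Re_le_cmod[of "coef t 2 k"] nc[of k] by (intro mult_nonneg_nonneg) auto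
  have "coef t 2 k = -1" if k: "k \<ge> 1" for k
  proof -
    have "(\<Sum>j\<in>{0,k}. (1 + Re (coef t 2 j)) * (1/2) ^ j) \<le> (\<Sum>j. (1 + Re (coef t 2 j)) * (1/2) ^ j)"
      using nn by (intro sum_le_suminf sums_summable[OF S]) auto
    then have "(1 + Re (coef t 2 k)) * (1/2) ^ k \<le> 0" using k sums_unique[OF S] by simp
    moreover have "(1/2::real) ^ k > 0" by simp
    ultimately have r: "Re (coef t 2 k) = -1" using abs_Re_le_cmod[of "coef t 2 k"] nc[of k] by (auto simp: mult_le_0_iff)
    have "(Re (coef t 2 k))\<^sup>2 + (Im (coef t 2 k))\<^sup>2 = 1" using nc[of k] by (metis cmod_power2 one_power2)
    with r show ?thesis by (simp add: complex_eq_iff)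
  qed
  with assms show False by blast
qed

text \<open>A power series is continuous inside its disc of convergence, here of radius at least
  3/4, so nonvanishing at 1/2 persists at \<open>2 powr (-\<sigma>)\<close> for
  \<open>\<sigma>\<close> near 1.\<close>

lemma euler_two_lower:
  assumes "\<exists>k\<ge>1. coef t 2 k \<noteq> -1"
  shows "\<exists>c>0. \<exists>\<delta>>0. \<forall>\<sigma>. 1 < \<sigma> \<longrightarrow> \<sigma> < 1 + \<delta> \<longrightarrow> norm (euler 2 \<sigma> t) \<ge> c"
proof -
  define E where "E = (\<lambda>x::real. \<Sum>k. coef t 2 k * of_real (x ^ k))"
  have nc: "norm (coef t 2 k) = 1" for k by (rule norm_coef) simp
  have "summable (\<lambda>k. norm (coef t 2 k * (3/4::complex) ^ k))"
    by (simp add: norm_mult nc norm_power summable_geometric)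
  then have "summable (\<lambda>k. coef t 2 k * (3/4::complex) ^ k)" by (rule summable_norm_cancel)
  then have "isCont (\<lambda>z. \<Sum>k. coef t 2 k * z ^ k) (complex_of_real (1/2))"
    by (rule isCont_powser) simp
  then have "isCont (\<lambda>x::real. \<Sum>k. coef t 2 k * (complex_of_real x) ^ k) (1/2)"
    using isCont_o2[of "1/2::real" complex_of_real "\<lambda>z. \<Sum>k. coef t 2 k * z ^ k"] by simp
  then have cE: "isCont E (1/2)" by (simp add: E_def)
  have cp: "isCont (\<lambda>\<sigma>::real. 2 powr (-\<sigma>)) 1" by (intro continuous_intros) auto
  have "isCont (\<lambda>\<sigma>::real. norm (E (2 powr (-\<sigma>)))) 1"
    by (rule isCont_norm, rule isCont_o2[OF cp]) (use cE in \<open>simp add: powr_minus\<close>)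
  moreover have pos: "norm (E (1/2)) > 0" using euler_two_nonzero[OF assms] by (simp add: E_def)
  ultimately have "\<forall>\<^sub>F \<sigma> in at 1. norm (E (2 powr (-\<sigma>))) > norm (E (1/2)) / 2"
    unfolding isCont_def by (intro order_tendstoD(1)) (auto simp: powr_minus)
  then obtain \<delta> where d: "\<delta> > 0" "\<And>\<sigma>. \<sigma> \<noteq> 1 \<Longrightarrow> dist \<sigma> 1 < \<delta> \<Longrightarrow> norm (E (2 powr (-\<sigma>))) > norm (E (1/2)) / 2"
    unfolding eventually_at by auto
  have "norm (euler 2 \<sigma> t) \<ge> norm (E (1/2)) / 2" if "1 < \<sigma>" "\<sigma> < 1 + \<delta>" for \<sigma>
    using d(2)[of \<sigma>] that euler_coef[of \<sigma> 2 t] by (simp add: E_def dist_real_def)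
  then show ?thesis using d(1) pos by (intro exI[of _ "norm (E (1/2)) / 2"]) auto
qed

text \<open>The Weierstrass product inequality, for factors of which only lower bounds
  \<open>1 - h x\<close> are known.\<close>

lemma one_minus_sum_le_prod:
  fixes g h :: "'b \<Rightarrow> real"
  assumes "finite A" "\<And>x. x \<in> A \<Longrightarrow> 0 \<le> h x" "\<And>x. x \<in> A \<Longrightarrow> 0 \<le> g x" "\<And>x. x \<in> A \<Longrightarrow> 1 - h x \<le> g x" "(\<Sum>x\<in>A. h x) \<le> 1"
  shows "1 - (\<Sum>x\<in>A. h x) \<le> (\<Prod>x\<in>A. g x)"
  using assms
proof (induction A rule: finite_induct)
  case (insert a A)
  have nn: "(\<Sum>x\<in>A. h x) \<ge> 0" using insert by (intro sum_nonneg) auto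
  have ha: "0 \<le> h a" "0 \<le> g a" "1 - h a \<le> g a" and le1: "h a + (\<Sum>x\<in>A. h x) \<le> 1"
    using insert.prems insert.hyps by auto
  have IH: "1 - (\<Sum>x\<in>A. h x) \<le> (\<Prod>x\<in>A. g x)"
  proof (rule insert.IH)
    show "(\<Sum>x\<in>A. h x) \<le> 1" using le1 ha(1) by linarith
  qed (use insert.prems in auto)
  have "1 - (h a + (\<Sum>x\<in>A. h x)) \<le> (1 - h a) * (1 - (\<Sum>x\<in>A. h x))"
    using ha nn by (simp add: algebra_simps)
  also have "\<dots> \<le> g a * (\<Prod>x\<in>A. g x)"
    using ha nn le1 IH by (intro mult_mono) auto
  finally show ?case using insert by simp
qed simp

text \<open>The integers are sifted by the prime 2, by finitely many further primes in
  \<open>Q0\<close>, and by a finite set \<open>D\<close> large enough for the remainder to be close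
  to 1. Only \<open>D\<close> depends on \<open>\<sigma>\<close>, and its product is at least 1/2
  for every finite set of primes outside \<open>Q0\<close>; hence the constant is uniform in
  \<open>\<sigma>\<close>.\<close>

lemma series_lower:
  assumes conv: "\<And>Q. finite Q \<Longrightarrow> (\<forall>q\<in>Q. prime q) \<Longrightarrow> (\<Sum>p\<in>Q. defect t p / real p) \<le> B"
    and two: "\<exists>k\<ge>1. coef t 2 k \<noteq> -1"
  shows "\<exists>c>0. \<exists>\<delta>>0. \<forall>\<sigma>. 1 < \<sigma> \<longrightarrow> \<sigma> < 1 + \<delta> \<longrightarrow> norm (\<Sum>n. f n * nps \<sigma> t n) \<ge> c / (\<sigma> - 1)"
proof -
  \<comment> \<open>Bounds the loss at \<open>p\<close> simultaneously for all
    \<open>\<sigma> > 1\<close>, because \<open>p powr (-\<sigma>) \<le> 1 / p\<close>. Its sum over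
    the primes converges by \<open>conv\<close>.\<close>
  define g where "g = (\<lambda>p. 2 * (defect t p / real p) + 2 * (1 / real p)\<^sup>2)"
  let ?P = "{p::nat. prime p}"
  have gnn: "g p \<ge> 0" if "prime p" for p using defect_nonneg[OF that] by (simp add: g_def)
  have gsum: "g summable_on ?P"
  proof (rule nonneg_bdd_above_summable_on)
    show "bdd_above (sum g ` {F. F \<subseteq> ?P \<and> finite F})"
    proof (rule bdd_aboveI2)
      fix F assume F: "F \<in> {F. F \<subseteq> ?P \<and> finite F}"
      have "(\<Sum>p\<in>F. (1 / real p)\<^sup>2) = (\<Sum>p\<in>F. real p powr (-2))"
        using F by (intro sum.cong refl) (auto simp: powr_minus power_inverse divide_inverse dest: prime_gt_0_nat)
      also have "\<dots> \<le> (\<Sum>n. real n powr (-2))"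
        using F by (intro sum_le_suminf summable_powr_minus) auto
      finally have sq: "(\<Sum>p\<in>F. (1 / real p)\<^sup>2) \<le> (\<Sum>n. real n powr (-2))" .
      show "sum g F \<le> 2 * B + 2 * (\<Sum>n. real n powr (-2))"
      proof -
        have "(\<Sum>p\<in>F. defect t p / real p) \<le> B" using conv[of F] F by blast
        moreover have "sum g F = 2 * (\<Sum>p\<in>F. defect t p / real p) + 2 * (\<Sum>p\<in>F. (1 / real p)\<^sup>2)"
          by (simp only: g_def sum.distrib sum_distrib_left)
        ultimately show ?thesis using sq by linarith
      qed
    qed
  qed (use gnn in auto)
  obtain Q1 where Q1: "finite Q1" "Q1 \<subseteq> ?P" "\<And>F. finite F \<Longrightarrow> Q1 \<subseteq> F \<Longrightarrow> F \<subseteq> ?P \<Longrightarrow> dist (sum g F) (infsum g ?P) < 1/4"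
  proof -
    have "\<forall>\<^sub>F F in finite_subsets_at_top ?P. dist (sum g F) (infsum g ?P) < 1/4"
      using has_sum_infsum[OF gsum] unfolding has_sum_def by (rule tendstoD) simp
    then show ?thesis using that unfolding eventually_finite_subsets_at_top by metis
  qed
  define Q0 where "Q0 = insert 2 Q1"
  have Q0: "finite Q0" "Q0 \<subseteq> ?P" using Q1 by (auto simp: Q0_def)
  have tail: "sum g D \<le> 1/2" if D: "finite D" "D \<subseteq> ?P" "D \<inter> Q0 = {}" for D
  proof -
    have "dist (sum g (Q0 \<union> D)) (infsum g ?P) < 1/4" using D Q0 by (intro Q1) (auto simp: Q0_def)
    moreover have "dist (sum g Q0) (infsum g ?P) < 1/4" using Q0 by (intro Q1) (auto simp: Q0_def)
    moreover have "sum g (Q0 \<union> D) = sum g Q0 + sum g D" using D Q0 by (intro sum.union_disjoint) auto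
    ultimately show ?thesis unfolding dist_real_def by linarith
  qed
  obtain c1 \<delta> where c1: "c1 > 0" and d: "\<delta> > 0" and E2: "\<And>\<sigma>. 1 < \<sigma> \<Longrightarrow> \<sigma> < 1 + \<delta> \<Longrightarrow> norm (euler 2 \<sigma> t) \<ge> c1"
    using euler_two_lower[OF two] by blast
  \<comment> \<open>The factors belong, in order, to the prime 2 (where
    \<open>1 - 2 powr (-\<sigma>) \<ge> 1/2\<close>), to the other primes of \<open>Q0\<close>, to
    \<open>D\<close>, and to the sifted remainder.\<close>
  define c where "c = (c1 * (1/2)) * (1/3) ^ card (Q0 - {2}) * (1/2) * (1/2)"
  have "norm (\<Sum>n. f n * nps \<sigma> t n) \<ge> c / (\<sigma> - 1)" if s: "1 < \<sigma>" "\<sigma> < 1 + \<delta>" for \<sigma>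
  proof -
    let ?r = "\<lambda>p. real p powr (-\<sigma>)"
    let ?h = "\<lambda>p. norm (euler p \<sigma> t) * (1 - ?r p)"
    obtain N where N: "\<And>Q. {p. prime p \<and> p \<le> N} \<subseteq> Q \<Longrightarrow> zsift Q \<sigma> \<le> 4/3" using zsift_tail[OF s(1)] by blast
    define D where "D = {p. prime p \<and> p \<le> N} - Q0"
    define Q where "Q = Q0 \<union> D"
    have finD: "finite D" "D \<subseteq> ?P" "D \<inter> Q0 = {}" by (auto simp: D_def)
    have Q: "finite Q" "\<And>q. q \<in> Q \<Longrightarrow> prime q" using finD Q0 by (auto simp: Q_def)
    have zQ: "zsift Q \<sigma> \<le> 4/3" by (rule N) (auto simp: Q_def D_def)
    have r: "0 \<le> ?r p" "?r p \<le> 1/2" "?r p \<le> 1 / real p" if "p \<in> Q" for p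
      using prime_powr_le_half[of \<sigma> p] Q(2)[OF that] s by auto
    have hnn: "?h p \<ge> 0" if "p \<in> Q" for p using r[OF that] by simp
    have h3: "?h p \<ge> 1/3" if "p \<in> Q" "p \<noteq> 2" for p
    proof -
      have "p \<ge> 3" using prime_ge_2_nat[OF Q(2)[OF that(1)]] that(2) by linarith
      then have "1 / real p \<le> 1/3" by (simp add: field_simps)
      then have "?r p \<le> 1/3" using r(3)[OF that(1)] by linarith
      then show ?thesis unfolding euler_coef[OF s(1) Q(2)[OF that(1)]]
        by (intro euler_factor_bounds(3)) (use r[OF that(1)] Q(2)[OF that(1)] in \<open>auto simp: norm_coef\<close>)
    qed
    have hD: "1 - g p \<le> ?h p" if p: "p \<in> Q" for p
    proof -
      have "1 - (2 * ?r p * defect t p + 2 * (?r p)\<^sup>2) \<le> ?h p"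
        unfolding euler_coef[OF s(1) Q(2)[OF p]] coef_1[symmetric]
        by (rule euler_factor_bounds(2)) (use r[OF p] Q(2)[OF p] in \<open>auto simp: norm_coef\<close>)
      moreover have "2 * ?r p * defect t p \<le> 2 * (defect t p / real p)"
        using mult_right_mono[OF r(3)[OF p] defect_nonneg[OF Q(2)[OF p], of t]] by simp
      moreover have "(?r p)\<^sup>2 \<le> (1 / real p)\<^sup>2" using r[OF p] by (intro power_mono) auto
      ultimately show ?thesis unfolding g_def by linarith
    qed
    have p1: "(\<Prod>p\<in>D. ?h p) \<ge> 1/2"
    proof -
      have "1 - (\<Sum>p\<in>D. g p) \<le> (\<Prod>p\<in>D. ?h p)"
        using tail[OF finD] finD gnn hD hnn by (intro one_minus_sum_le_prod) (auto simp: Q_def)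
      with tail[OF finD] show ?thesis by linarith
    qed
    have p2: "(\<Prod>p\<in>Q0. ?h p) \<ge> (c1 * (1/2)) * (1/3) ^ card (Q0 - {2})"
    proof -
      have A: "c1 * (1/2) \<le> ?h 2" using E2[OF s] r[of 2] c1 by (intro mult_mono) (auto simp: Q_def Q0_def)
      have "(\<Prod>p\<in>Q0 - {2}. 1/3) \<le> (\<Prod>p\<in>Q0 - {2}. ?h p)"
        using h3 by (intro prod_mono) (auto simp: Q_def)
      then have B: "(1/3) ^ card (Q0 - {2}) \<le> (\<Prod>p\<in>Q0 - {2}. ?h p)" by (simp only: prod_constant)
      have C: "(\<Prod>p\<in>Q0. ?h p) = ?h 2 * (\<Prod>p\<in>Q0 - {2}. ?h p)"
        using Q0 by (intro prod.remove) (auto simp: Q0_def)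
      show ?thesis unfolding C using hnn[of 2] c1 by (intro mult_mono[OF A B]) (auto simp: Q_def Q0_def)
    qed
    have p3: "(\<Prod>p\<in>Q. ?h p) = (\<Prod>p\<in>Q0. ?h p) * (\<Prod>p\<in>D. ?h p)"
      unfolding Q_def using Q0 finD by (intro prod.union_disjoint) auto
    have p4: "(\<Prod>p\<in>Q. ?h p) \<ge> (c1 * (1/2)) * (1/3) ^ card (Q0 - {2}) * (1/2)"
      unfolding p3 using p1 p2 c1 by (intro mult_mono) (auto intro: order_trans[OF _ p2])
    let ?z = "\<Sum>n. real n powr (-\<sigma>)"
    have z1: "?z \<ge> 1 / (\<sigma> - 1)" by (rule suminf_powr_ge[OF s(1)])
    have "norm (\<Sum>n. f n * nps \<sigma> t n) = (\<Prod>p\<in>Q. norm (euler p \<sigma> t)) * norm (sifted Q \<sigma> t)"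
      using sifted_finite[OF s(1) Q, of t] by (simp add: norm_mult prod_norm sifted_empty[OF s(1)])
    also have "\<dots> \<ge> (\<Prod>p\<in>Q. norm (euler p \<sigma> t)) * (zsift Q \<sigma> * (1/2))"
      using norm_sifted_ge[OF s(1) Q(2), of Q t] zQ by (intro mult_left_mono prod_nonneg) auto
    also have "(\<Prod>p\<in>Q. norm (euler p \<sigma> t)) * (zsift Q \<sigma> * (1/2)) = (\<Prod>p\<in>Q. ?h p) * (1/2) * ?z"
      by (simp add: zsift_finite[OF s(1) Q] prod.distrib)
    finally have "norm (\<Sum>n. f n * nps \<sigma> t n) \<ge> (\<Prod>p\<in>Q. ?h p) * (1/2) * ?z" .
    moreover have "(\<Prod>p\<in>Q. ?h p) * (1/2) * ?z \<ge> c * (1 / (\<sigma> - 1))"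
      unfolding c_def using p4 z1 s c1 by (intro mult_mono) (auto intro: order_trans[OF _ p4] mult_nonneg_nonneg)
    ultimately have "c * (1 / (\<sigma> - 1)) \<le> norm (\<Sum>n. f n * nps \<sigma> t n)" by (rule order_trans[rotated])
    then show ?thesis by simp
  qed
  moreover have "c > 0" using c1 by (simp add: c_def)
  ultimately show ?thesis using d by blast
qed

end

section \<open>The von Mangoldt function\<close>

text \<open>Both sides run over the pairs with \<open>d * m \<le> N\<close>, grouped by the product
  on the left and by \<open>d\<close> on the right.\<close>

lemma sum_divisors_swap:
  fixes g :: "nat \<Rightarrow> nat \<Rightarrow> 'b :: comm_monoid_add"
  shows "(\<Sum>k=1..N. \<Sum>d | d dvd k. g d (k div d)) = (\<Sum>d=1..N. \<Sum>m=1..N div d. g d m)"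
proof -
  have "(\<Sum>k=1..N. \<Sum>d | d dvd k. g d (k div d)) = (\<Sum>(k, d)\<in>Sigma {1..N} (\<lambda>k. {d. d dvd k}). g d (k div d))"
    by (subst sum.Sigma) auto
  also have "\<dots> = (\<Sum>(d, m)\<in>Sigma {1..N} (\<lambda>d. {1..N div d}). g d m)"
  proof (rule sum.reindex_bij_witness[of _ "\<lambda>(d, m). (d * m, d)" "\<lambda>(k, d). (d, k div d)"], goal_cases)
    case (2 a)
    then obtain k d where [simp]: "a = (k, d)" and k: "1 \<le> k" "k \<le> N" "d dvd k" by auto
    have "d \<le> k" "d > 0" using k by (auto intro: dvd_imp_le Nat.gr0I)
    moreover from this k have "k div d \<le> N div d" "k div d \<ge> 1" by (auto intro: div_le_mono simp: div_greater_zero_iff Suc_le_eq)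
    ultimately show ?case using k by simp
  next
    case (4 b)
    then obtain d m where [simp]: "b = (d, m)" and k: "1 \<le> d" "d \<le> N" "1 \<le> m" "m \<le> N div d" by auto
    have "d * m \<le> d * (N div d)" using k by simp
    also have "\<dots> \<le> N" by simp
    finally show ?case using k by simp
  qed auto
  also have "\<dots> = (\<Sum>d=1..N. \<Sum>m=1..N div d. g d m)"
    by (subst sum.Sigma) auto
  finally show ?thesis .
qed

lemma ln_fact_eq_sum: "ln (fact n :: real) = (\<Sum>k=1..n. ln (real k))"
  by (induction n) (auto simp: ln_mult)

lemma sum_mangoldt_div: "(\<Sum>d=1..N. mangoldt d * real (N div d)) = ln (fact N :: real)"
proof -
  have "(\<Sum>d=1..N. mangoldt d * real (N div d)) = (\<Sum>d=1..N. \<Sum>m=1..N div d. (mangoldt d :: real))"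
    by (simp add: mult.commute)
  also have "\<dots> = (\<Sum>k=1..N. \<Sum>d | d dvd k. mangoldt d)"
    by (rule sum_divisors_swap[symmetric])
  also have "\<dots> = ln (fact N)"
    unfolding ln_fact_eq_sum using mangoldt_sum[where ?'a = real] by (intro sum.cong refl) auto
  finally show ?thesis .
qed

lemma ln_fact_le: "ln (fact n :: real) \<le> real n * ln (real n)"
proof -
  have "(\<Sum>k=1..n. ln (real k)) \<le> (\<Sum>k=1..n. ln (real n))" by (intro sum_mono) auto
  then show ?thesis by (simp add: ln_fact_eq_sum)
qed

text \<open>\<open>n ^ n / fact n\<close> is one term of the series for \<open>exp n\<close>, hence
  at most the whole.\<close>

lemma ln_fact_ge: "ln (fact n :: real) \<ge> real n * ln (real n) - real n"
proof (cases "n = 0")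
  case False
  have "real n ^ n / fact n \<le> exp (real n)"
  proof -
    have "(\<lambda>k. inverse (fact k) * real n ^ k) sums exp (real n)"
      using exp_converges[of "real n"] by simp
    then have "(\<Sum>k\<in>{n}. inverse (fact k) * real n ^ k) \<le> exp (real n)"
      by (subst sums_unique[of _ "exp (real n)"], simp) (intro sum_le_suminf, auto simp: sums_iff)
    then show ?thesis by (simp add: divide_inverse mult.commute)
  qed
  then have "ln (real n ^ n / fact n) \<le> real n"
    using False by (metis exp_gt_zero fact_gt_zero divide_pos_pos ln_exp ln_le_cancel_iff of_nat_0_less_iff zero_less_power neq0_conv)
  then show ?thesis using False by (simp add: ln_div ln_realpow)
qed simp

definition psi :: "nat \<Rightarrow> real" where "psi n = (\<Sum>k=1..n. mangoldt k)"

lemma psi_mono: "m \<le> n \<Longrightarrow> psi m \<le> psi n"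
  unfolding psi_def by (intro sum_mono2) (auto simp: mangoldt_nonneg)

text \<open>Chebyshev's argument: the weight \<open>2 * m div d - 2 * (m div d)\<close> is 1 for
  \<open>m < d \<le> 2 * m\<close> and never negative, and the weighted sum of
  \<open>mangoldt\<close> is the logarithm of the central binomial coefficient, at most
  \<open>2 * m * ln 2\<close>.\<close>

lemma psi_double: "psi (2 * m) \<le> psi m + 2 * real m"
proof -
  have "psi (2 * m) - psi m = (\<Sum>d\<in>{m+1..2*m}. mangoldt d * (real (2 * m div d) - 2 * real (m div d)))"
  proof -
    have "psi (2 * m) = psi m + (\<Sum>d\<in>{m+1..2*m}. mangoldt d)"
      unfolding psi_def mult_2 by (rule sum.ub_add_nat) simp
    moreover have "2 * m div d = 1" "m div d = 0" if "d \<in> {m+1..2*m}" for d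
      using that by (auto intro!: div_nat_eqI)
    ultimately show ?thesis by simp
  qed
  also have "\<dots> \<le> (\<Sum>d=1..2*m. mangoldt d * (real (2 * m div d) - 2 * real (m div d)))"
  proof (intro sum_mono2 mult_nonneg_nonneg mangoldt_nonneg)
    fix d
    have "2 * (m div d) \<le> 2 * m div d"
      by (metis div_mult_self_is_m div_times_less_eq_dividend mult.assoc mult_le_mono2 mult.commute bot_nat_0.not_eq_extremum div_by_0 le_refl mult_0_right div_le_mono less_eq_div_iff_mult_less_eq)
    then show "0 \<le> real (2 * m div d) - 2 * real (m div d)" by linarith
  qed auto
  also have "\<dots> = (\<Sum>d=1..2*m. mangoldt d * real (2 * m div d)) - 2 * (\<Sum>d=1..2*m. mangoldt d * real (m div d))"
    by (simp add: algebra_simps sum_subtractf sum_distrib_left)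
  also have "(\<Sum>d=1..2*m. mangoldt d * real (m div d)) = (\<Sum>d=1..m. mangoldt d * real (m div d))"
    by (intro sum.mono_neutral_right) auto
  also have "(\<Sum>d=1..2*m. mangoldt d * real (2 * m div d)) - 2 * \<dots> = ln (fact (2 * m)) - 2 * ln (fact m)"
    by (simp only: sum_mangoldt_div)
  also have "\<dots> = ln (real ((2 * m) choose m))"
    by (simp add: binomial_fact ln_div ln_mult)
  also have "\<dots> \<le> ln (2 ^ (2 * m))"
  proof -
    have "(2 * m) choose m \<le> 2 ^ (2 * m)" by (rule binomial_le_pow2)
    then have "real ((2 * m) choose m) \<le> 2 ^ (2 * m)" by (metis of_nat_le_iff of_nat_numeral of_nat_power)
    then show ?thesis by (subst ln_le_cancel_iff) auto
  qed
  also have "\<dots> = 2 * real m * ln 2" by (subst ln_realpow) auto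
  also have "\<dots> \<le> 2 * real m * 1" using ln_2_less_1 by (intro mult_left_mono) auto
  finally show ?thesis by simp
qed

text \<open>The constant 6 closes the induction: halving upwards costs \<open>6 * m + 2 * m\<close>
  with \<open>2 * m \<le> n + 1\<close>, and \<open>4 * n + 4 \<le> 6 * n\<close> once
  \<open>n \<ge> 2\<close>.\<close>

lemma psi_le: "psi n \<le> 6 * real n"
proof (induction n rule: less_induct)
  case (less n)
  show ?case
  proof (cases "n \<ge> 2")
    case True
    define m where "m = (n + 1) div 2"
    have m: "n \<le> 2 * m" "2 * m \<le> n + 1" "m < n" using True by (auto simp: m_def)
    have "psi n \<le> psi (2 * m)" using m by (intro psi_mono) auto
    also have "\<dots> \<le> psi m + 2 * real m" by (rule psi_double)
    also have "\<dots> \<le> 8 * real m" using less[OF m(3)] by simp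
    also have "\<dots> \<le> 4 * real n + 4" using m by linarith
    also have "\<dots> \<le> 6 * real n" using True by linarith
    finally show ?thesis .
  next
    case False
    then have "n = 0 \<or> n = 1" by auto
    then show ?thesis by (auto simp: psi_def)
  qed
qed

text \<open>Rounding \<open>N / d\<close> down gives exactly \<open>ln (fact N)\<close>; the
  rounding costs at most \<open>psi N\<close>.\<close>

lemma sum_mangoldt_over_le:
  assumes "N \<ge> 1"
  shows "(\<Sum>d=1..N. mangoldt d / real d) \<le> ln (real N) + 6"
proof -
  have "real N * (\<Sum>d=1..N. mangoldt d / real d) = (\<Sum>d=1..N. mangoldt d * (real N / real d))"
    by (simp add: sum_distrib_left mult_ac)
  also have "\<dots> \<le> (\<Sum>d=1..N. mangoldt d * (real (N div d) + 1))"
  proof (intro sum_mono mult_left_mono mangoldt_nonneg)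
    fix d assume "d \<in> {1..N}"
    then show "real N / real d \<le> real (N div d) + 1"
      by (metis floor_divide_of_nat_eq of_int_of_nat_eq real_of_int_floor_add_one_ge)
  qed
  also have "\<dots> = ln (fact N) + psi N"
    unfolding sum_mangoldt_div[symmetric] psi_def by (simp add: algebra_simps sum.distrib)
  also have "\<dots> \<le> real N * ln (real N) + 6 * real N"
    using ln_fact_le psi_le by (intro add_mono) auto
  also have "\<dots> = real N * (ln (real N) + 6)" by (simp add: algebra_simps)
  finally show ?thesis using assms by simp
qed

text \<open>Abel summation against nonincreasing weights. The induction carries more than
  nonnegativity: the weighted sum of \<open>C - a n\<close> dominates the plain sum times the
  current weight.\<close>

lemma sum_weighted_le:
  fixes a w :: "nat \<Rightarrow> real"
  assumes A: "\<And>n. (\<Sum>k=1..n. a k) \<le> C * real n" and w: "\<And>n. n \<ge> 1 \<Longrightarrow> 0 \<le> w n" "\<And>n. n \<ge> 1 \<Longrightarrow> w (Suc n) \<le> w n"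
  shows "(\<Sum>n=1..N. a n * w n) \<le> C * (\<Sum>n=1..N. w n)"
proof -
  have B: "(\<Sum>k=1..n. C - a k) \<ge> 0" for n
    using A[of n] by (simp add: sum_subtractf mult.commute)
  have "N \<ge> 1 \<Longrightarrow> (\<Sum>n=1..N. (C - a n) * w n) \<ge> (\<Sum>k=1..N. C - a k) * w N"
  proof (induction N rule: dec_induct)
    case (step n)
    have "(\<Sum>k=1..Suc n. C - a k) * w (Suc n) = (\<Sum>k=1..n. C - a k) * w (Suc n) + (C - a (Suc n)) * w (Suc n)"
      by (simp add: algebra_simps)
    also have "\<dots> \<le> (\<Sum>k=1..n. C - a k) * w n + (C - a (Suc n)) * w (Suc n)"
      using B w(2)[OF step(1)] by (intro add_right_mono mult_left_mono) auto
    also have "\<dots> \<le> (\<Sum>n=1..Suc n. (C - a n) * w n)" using step by simp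
    finally show ?case .
  qed simp
  moreover have "N \<ge> 1 \<Longrightarrow> (\<Sum>k=1..N. C - a k) * w N \<ge> 0" using B w by (intro mult_nonneg_nonneg) auto
  ultimately have "(\<Sum>n=1..N. (C - a n) * w n) \<ge> 0" by (cases "N \<ge> 1") (auto intro: order_trans)
  then show ?thesis by (simp add: algebra_simps sum_subtractf sum_distrib_left)
qed

lemma sum_mangoldt_powr_le:
  assumes "\<sigma> > 1"
  shows "(\<Sum>n=1..N. mangoldt n * real n powr (-\<sigma>)) \<le> 6 * (\<sigma> / (\<sigma> - 1))"
proof -
  have "(\<Sum>n=1..N. mangoldt n * real n powr (-\<sigma>)) \<le> 6 * (\<Sum>n=1..N. real n powr (-\<sigma>))"
    using psi_le assms by (intro sum_weighted_le) (auto simp: psi_def intro!: powr_mono2')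
  also have "\<dots> \<le> 6 * (\<sigma> / (\<sigma> - 1))" by (intro mult_left_mono sum_powr_le assms) simp
  finally show ?thesis .
qed

text \<open>Each logarithm is traded for \<open>n powr (\<delta> / 4)\<close> at the price
  \<open>4 / \<delta>\<close>, which leaves the exponent \<open>1 + \<delta> / 2\<close> and a sum
  of at most \<open>3 / \<delta>\<close>.\<close>

lemma sum_ln_square_powr_le:
  assumes s: "\<sigma> > 1" "\<sigma> \<le> 2"
  shows "(\<Sum>n=1..N. ln (real n) * ln (real n) * real n powr (-\<sigma>)) \<le> 48 / (\<sigma> - 1) ^ 3"
proof -
  define \<delta> where "\<delta> = \<sigma> - 1"
  have d: "\<delta> > 0" "\<delta> \<le> 1" using s by (auto simp: \<delta>_def)
  have "(\<Sum>n=1..N. ln (real n) * ln (real n) * real n powr (-\<sigma>)) \<le> (\<Sum>n=1..N. 16 / \<delta>\<^sup>2 * real n powr (-(1 + \<delta> / 2)))"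
  proof (rule sum_mono)
    fix n assume n: "n \<in> {1..N}"
    have l: "ln (real n) \<le> real n powr (\<delta>/4) / (\<delta>/4)" using n d by (intro ln_powr_bound) auto
    have "ln (real n) * ln (real n) \<le> (real n powr (\<delta>/4) / (\<delta>/4)) * (real n powr (\<delta>/4) / (\<delta>/4))"
      using l n d by (intro mult_mono) auto
    also have "\<dots> = 16 / \<delta>\<^sup>2 * real n powr (\<delta>/2)"
      using d n by (simp add: power2_eq_square powr_add[symmetric] field_simps)
    finally have "ln (real n) * ln (real n) * real n powr (-\<sigma>) \<le> 16 / \<delta>\<^sup>2 * real n powr (\<delta>/2) * real n powr (-\<sigma>)"
      by (intro mult_right_mono) auto
    also have "\<dots> = 16 / \<delta>\<^sup>2 * (real n powr (\<delta>/2 + (-\<sigma>)))" unfolding powr_add by (simp only: mult.assoc)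
    also have "\<delta>/2 + (-\<sigma>) = -(1 + \<delta>/2)" by (simp add: \<delta>_def field_simps)
    finally show "ln (real n) * ln (real n) * real n powr (-\<sigma>) \<le> 16 / \<delta>\<^sup>2 * real n powr (-(1 + \<delta> / 2))" .
  qed
  also have "\<dots> = 16 / \<delta>\<^sup>2 * (\<Sum>n=1..N. real n powr (-(1 + \<delta> / 2)))" by (simp add: sum_distrib_left)
  also have "\<dots> \<le> 16 / \<delta>\<^sup>2 * ((1 + \<delta>/2) / ((1 + \<delta>/2) - 1))"
    using d by (intro mult_left_mono sum_powr_le) auto
  also have "(1 + \<delta>/2) / ((1 + \<delta>/2) - 1) \<le> 3 / \<delta>" using d by (simp add: field_simps)
  finally have "(\<Sum>n=1..N. ln (real n) * ln (real n) * real n powr (-\<sigma>)) \<le> 16 / \<delta>\<^sup>2 * (3 / \<delta>)"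
    using d by (simp add: mult_left_mono divide_right_mono)
  also have "\<dots> = 48 / \<delta> ^ 3" by (simp add: power2_eq_square power3_eq_cube)
  finally show ?thesis by (simp add: \<delta>_def)
qed

section \<open>Divisor pairs with a common prime\<close>

text \<open>For \<open>d = p ^ k\<close> the summand is \<open>ln p / (p ^ k * p)\<close>. The
  geometric series over \<open>k\<close> gives at most \<open>2 * ln p / p^2\<close>, the bound
  \<open>ln p \<le> 2 * p powr (1/2)\<close> gives \<open>4 * p powr (-(3/2))\<close>, and the sum
  over \<open>p\<close> is at most \<open>4 * 3\<close>.\<close>

lemma sum_mangoldt_aprimedivisor_le:
  "(\<Sum>d=1..N. mangoldt d / (real d * real (aprimedivisor d))) \<le> 12"
proof -
  let ?g = "\<lambda>d. mangoldt d / (real d * real (aprimedivisor d))"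
  define A where "A = {p\<in>{2..N}. prime p} \<times> {1..N}"
  let ?h = "\<lambda>(p, k). p ^ k :: nat"
  have fA: "finite A" by (simp add: A_def)
  have gA: "?g (?h x) = (case x of (p, k) \<Rightarrow> ln (real p) / (real p ^ k * real p))" if "x \<in> A" for x
    using that by (auto simp: A_def aprimedivisor_prime_power)
  have "(\<Sum>d=1..N. ?g d) = (\<Sum>d\<in>{d\<in>{1..N}. primepow d}. ?g d)"
    by (intro sum.mono_neutral_right) (auto simp: mangoldt_def)
  also have "\<dots> \<le> (\<Sum>d\<in>?h ` A. ?g d)"
  proof (rule sum_mono2)
    show "{d\<in>{1..N}. primepow d} \<subseteq> ?h ` A"
    proof
      fix d assume d: "d \<in> {d\<in>{1..N}. primepow d}"
      then obtain p k where pk: "prime p" "k > 0" "d = p ^ k" by (auto simp: primepow_def)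
      have "p \<le> p ^ k" using pk prime_gt_0_nat[OF pk(1)] by (simp add: self_le_power Suc_leI)
      moreover have "k < p ^ k" using prime_gt_1_nat[OF pk(1)] by (simp add: power_gt_expt)
      ultimately have "(p, k) \<in> A" using pk d prime_ge_2_nat[OF pk(1)] by (auto simp: A_def)
      with pk show "d \<in> ?h ` A" by force
    qed
  qed (use fA in \<open>auto intro!: divide_nonneg_nonneg mangoldt_nonneg\<close>)
  also have "\<dots> \<le> (\<Sum>x\<in>A. ?g (?h x))"
    using sum_image_le[OF fA, of ?g ?h] unfolding o_def by (meson divide_nonneg_nonneg mangoldt_nonneg mult_nonneg_nonneg of_nat_0_le_iff)
  also have "\<dots> = (\<Sum>x\<in>A. case x of (p, k) \<Rightarrow> ln (real p) / (real p ^ k * real p))"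
    by (intro sum.cong refl gA)
  also have "\<dots> = (\<Sum>p\<in>{p\<in>{2..N}. prime p}. \<Sum>k=1..N. ln (real p) / (real p ^ k * real p))"
    unfolding A_def by (subst sum.cartesian_product) simp
  also have "\<dots> \<le> (\<Sum>p\<in>{p\<in>{2..N}. prime p}. 4 * real p powr (-(3/2)))"
  proof (rule sum_mono)
    fix p assume p: "p \<in> {p\<in>{2..N}. prime p}"
    then have p2: "real p \<ge> 2" by auto
    have "(\<Sum>k=1..N. (1 / real p) ^ k) \<le> 2 / real p"
    proof -
      have "(\<Sum>k=1..N. (1 / real p) ^ k) = (1 / real p) * (\<Sum>k<N. (1 / real p) ^ k)"
        by (simp add: sum_distrib_left sum.atLeast_Suc_atMost_Suc_shift atLeast0AtMost lessThan_atLeast0 sum.shift_bounds_cl_Suc_ivl flip: power_Suc)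
           (rule sum.reindex_bij_witness[of _ Suc "\<lambda>k. k - 1"], auto)
      also have "(\<Sum>k<N. (1 / real p) ^ k) \<le> (\<Sum>k. (1 / real p) ^ k)"
        using p2 by (intro sum_le_suminf summable_geometric) auto
      also have "\<dots> = 1 / (1 - 1 / real p)" using p2 by (intro suminf_geometric) auto
      also have "\<dots> \<le> 2" using p2 by (simp add: field_simps)
      finally show ?thesis using p2 by (simp add: mult_left_mono divide_right_mono)
    qed
    then have "ln (real p) / real p * (\<Sum>k=1..N. (1 / real p) ^ k) \<le> ln (real p) / real p * (2 / real p)"
      using p2 by (intro mult_left_mono) auto
    moreover have "(\<Sum>k=1..N. ln (real p) / (real p ^ k * real p)) = ln (real p) / real p * (\<Sum>k=1..N. (1 / real p) ^ k)"
      by (simp add: sum_distrib_left power_divide mult_ac)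
    ultimately have "(\<Sum>k=1..N. ln (real p) / (real p ^ k * real p)) \<le> 2 * (ln (real p) * (1 / real p)\<^sup>2)"
      by (simp add: power2_eq_square mult_ac)
    also have "\<dots> \<le> 2 * ((real p powr (1/2) / (1/2)) * (1 / real p)\<^sup>2)"
      using p2 ln_powr_bound[of "real p" "1/2"] by (intro mult_left_mono mult_right_mono) auto
    also have "(1 / real p)\<^sup>2 = real p powr (-2)"
      using p2 by (simp add: powr_minus power_inverse divide_inverse)
    also have "2 * ((real p powr (1/2) / (1/2)) * real p powr (-2)) = 4 * (real p powr (1/2) * real p powr (-2))"
      by simp
    also have "real p powr (1/2) * real p powr (-2) = real p powr (-(3/2))" by (simp flip: powr_add)
    finally show "(\<Sum>k=1..N. ln (real p) / (real p ^ k * real p)) \<le> 4 * real p powr (-(3/2))" .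
  qed
  also have "\<dots> \<le> 4 * (\<Sum>p=1..N. real p powr (-(3/2)))"
    unfolding sum_distrib_left by (intro sum_mono2) auto
  also have "\<dots> \<le> 4 * ((3/2) / (3/2 - 1))" by (intro mult_left_mono sum_powr_le) auto
  finally show ?thesis by simp
qed

text \<open>\<open>mangoldt\<close> confines \<open>d\<close> to powers of a prime \<open>p\<close>,
  and a common factor with the cofactor then means that \<open>d * p\<close> divides
  \<open>n\<close>, which happens for at most \<open>N / (d * p)\<close> values. The additional
  \<open>1 / p\<close> makes the sum over \<open>d\<close> bounded.\<close>

lemma sum_mangoldt_noncoprime_le:
  "(\<Sum>n=1..N. \<Sum>d | d dvd n. if coprime d (n div d) then 0 else mangoldt d) \<le> 12 * real N"
proof -
  have "(\<Sum>n=1..N. \<Sum>d | d dvd n. if coprime d (n div d) then 0 else mangoldt d :: real) =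
      (\<Sum>d=1..N. \<Sum>m=1..N div d. if coprime d m then 0 else mangoldt d)"
    by (rule sum_divisors_swap)
  also have "\<dots> \<le> (\<Sum>d=1..N. real N * (mangoldt d / (real d * real (aprimedivisor d))))"
  proof (rule sum_mono)
    fix d assume d: "d \<in> {1..N}"
    show "(\<Sum>m=1..N div d. if coprime d m then 0 else mangoldt d) \<le> real N * (mangoldt d / (real d * real (aprimedivisor d)))"
    proof (cases "primepow d")
      case False
      then have "(\<Sum>m=1..N div d. if coprime d m then 0 else mangoldt d :: real) = 0"
        by (intro sum.neutral) (auto simp: mangoldt_def)
      with False show ?thesis by (simp add: mangoldt_def)
    next
      case True
      then obtain p k where pk: "prime p" "k > 0" "d = p ^ k" by (auto simp: primepow_def)
      have ap: "aprimedivisor d = p" using pk by (simp add: aprimedivisor_prime_power)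
      have p0: "p > 0" using pk prime_gt_0_nat by blast
      have nc: "coprime d m" if "\<not> p dvd m" for m
        using that pk by (auto intro: prime_imp_coprime_nat)
      have "(\<Sum>m=1..N div d. if coprime d m then 0 else mangoldt d) \<le> (\<Sum>m\<in>(\<lambda>j. p * j) ` {1..N div d div p}. mangoldt d :: real)"
      proof -
        have "(\<Sum>m=1..N div d. if coprime d m then 0 else mangoldt d :: real) \<le> (\<Sum>m\<in>{m\<in>{1..N div d}. p dvd m}. mangoldt d)"
          unfolding sum.inter_filter[OF finite_atLeastAtMost] using nc by (intro sum_mono) (auto simp: mangoldt_nonneg)
        also have "\<dots> \<le> (\<Sum>m\<in>(\<lambda>j. p * j) ` {1..N div d div p}. mangoldt d)"
        proof (rule sum_mono2)
          show "{m\<in>{1..N div d}. p dvd m} \<subseteq> (\<lambda>j. p * j) ` {1..N div d div p}"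
          proof
            fix m assume m: "m \<in> {m\<in>{1..N div d}. p dvd m}"
            then obtain j where "m = p * j" by auto
            with m p0 show "m \<in> (\<lambda>j. p * j) ` {1..N div d div p}"
              by (auto simp: less_eq_div_iff_mult_less_eq mult.commute Suc_le_eq intro!: imageI)
          qed
        qed (auto simp: mangoldt_nonneg)
        finally show ?thesis .
      qed
      also have "\<dots> = real (N div d div p) * mangoldt d"
        using p0 by (subst sum.reindex) (auto simp: inj_on_def)
      also have "N div d div p = N div (d * p)" by (simp add: div_mult2_eq)
      also have "real (N div (d * p)) * mangoldt d \<le> (real N / real (d * p)) * mangoldt d"
        by (intro mult_right_mono mangoldt_nonneg)
           (metis floor_divide_of_nat_eq of_int_floor_le of_int_of_nat_eq)
      also have "\<dots> = real N * (mangoldt d / (real d * real (aprimedivisor d)))" by (simp add: ap)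
      finally show ?thesis .
    qed
  qed
  also have "\<dots> = real N * (\<Sum>d=1..N. mangoldt d / (real d * real (aprimedivisor d)))"
    by (simp add: sum_distrib_left)
  also have "\<dots> \<le> real N * 12" by (intro mult_left_mono sum_mangoldt_aprimedivisor_le) auto
  finally show ?thesis by simp
qed

section \<open>Logarithmic weights\<close>

context unimodular
begin

definition partial_sum :: "nat \<Rightarrow> complex" where "partial_sum N = (\<Sum>n=1..N. f n)"

text \<open>The Dirichlet convolution of \<open>mangoldt * f\<close> with \<open>f\<close>; for
  completely multiplicative \<open>f\<close> it would be \<open>f n * ln n\<close>.\<close>

definition mangoldt_conv :: "nat \<Rightarrow> complex" where
  "mangoldt_conv n = (\<Sum>d | d dvd n. mangoldt d * f d * f (n div d))"

definition conv_sum :: "nat \<Rightarrow> complex" where "conv_sum N = (\<Sum>n=1..N. mangoldt_conv n)"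

lemma norm_S_le: "norm (partial_sum N) \<le> real N"
proof -
  have "norm (partial_sum N) \<le> (\<Sum>n=1..N. norm (f n))" unfolding partial_sum_def by (rule norm_sum)
  also have "\<dots> = real N" by (simp add: norm_f)
  finally show ?thesis .
qed

lemma S_Lipschitz: "M \<le> N \<Longrightarrow> norm (partial_sum M) \<le> norm (partial_sum N) + (real N - real M)"
proof (induction N rule: dec_induct)
  case (step n)
  have "norm (partial_sum n) \<le> norm (partial_sum (Suc n)) + norm (f (Suc n))"
    using norm_triangle_ineq4[of "partial_sum (Suc n)" "f (Suc n)"] by (simp add: partial_sum_def)
  with step show ?case by (simp add: norm_f)
qed simp

lemma norm_b_le:
  assumes "n \<ge> 1"
  shows "norm (mangoldt_conv n) \<le> ln (real n)"
proof -
  have "norm (mangoldt_conv n) \<le> (\<Sum>d | d dvd n. norm (mangoldt d * f d * f (n div d)))"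
    unfolding mangoldt_conv_def by (rule norm_sum)
  also have "\<dots> = (\<Sum>d | d dvd n. mangoldt d)"
  proof (intro sum.cong refl)
    fix d assume "d \<in> {d. d dvd n}"
    then have "d \<ge> 1" "n div d \<ge> 1" using assms by (auto elim!: dvdE simp: Suc_le_eq)
    then show "norm (mangoldt d * f d * f (n div d)) = mangoldt d" by (simp add: norm_mult norm_f)
  qed
  also have "\<dots> = ln (real n)" using mangoldt_sum[of n, where ?'a = real] assms by simp
  finally show ?thesis .
qed

text \<open>With \<open>ln n\<close> written as the sum of \<open>mangoldt\<close> over the
  divisors, the coprime pairs cancel by multiplicativity, and every other pair contributes at most
  \<open>2 * mangoldt d\<close>.\<close>

lemma norm_f_ln_minus_b:
  assumes "n \<ge> 1"
  shows "norm (f n * of_real (ln (real n)) - mangoldt_conv n) \<le> 2 * (\<Sum>d | d dvd n. if coprime d (n div d) then 0 else mangoldt d)"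
proof -
  have "f n * of_real (ln (real n)) - mangoldt_conv n = (\<Sum>d | d dvd n. mangoldt d * (f n - f d * f (n div d)))"
    using mangoldt_sum[of n, where ?'a = complex] assms
    by (simp add: mangoldt_conv_def sum_distrib_left algebra_simps sum_subtractf flip: mangoldt_sum)
  also have "norm \<dots> \<le> (\<Sum>d | d dvd n. norm (mangoldt d * (f n - f d * f (n div d))))" by (rule norm_sum)
  also have "\<dots> \<le> (\<Sum>d | d dvd n. 2 * (if coprime d (n div d) then 0 else mangoldt d))"
  proof (rule sum_mono)
    fix d assume "d \<in> {d. d dvd n}"
    then have d: "d dvd n" "d \<ge> 1" "n div d \<ge> 1" using assms by (auto elim!: dvdE simp: Suc_le_eq)
    show "norm (mangoldt d * (f n - f d * f (n div d))) \<le> 2 * (if coprime d (n div d) then 0 else mangoldt d)"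
    proof (cases "coprime d (n div d)")
      case True
      then have "f n = f d * f (n div d)" using f_mult[OF d(2,3)] d(1) by simp
      with True show ?thesis by simp
    next
      case False
      have "norm (f n - f d * f (n div d)) \<le> norm (f n) + norm (f d * f (n div d))" by (rule norm_triangle_ineq4)
      also have "\<dots> = 2" using d assms by (simp add: norm_mult norm_f)
      finally have "mangoldt d * norm (f n - f d * f (n div d)) \<le> mangoldt d * 2"
        by (intro mult_left_mono mangoldt_nonneg)
      with False show ?thesis by (simp add: norm_mult mult.commute)
    qed
  qed
  finally show ?thesis by (simp add: sum_distrib_left)
qed

text \<open>Of the 25, a share of \<open>2 * 12\<close> pays for the pairs with a common prime, and
  1 for replacing \<open>ln n\<close> by \<open>ln N\<close>, where the total difference is
  \<open>N * ln N - ln (fact N) \<le> N\<close>.\<close>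

lemma norm_S_ln_le:
  assumes N: "N \<ge> 1"
  shows "norm (partial_sum N) * ln (real N) \<le> norm (conv_sum N) + 25 * real N"
proof -
  have "partial_sum N * of_real (ln (real N)) = conv_sum N + (\<Sum>n=1..N. f n * of_real (ln (real n)) - mangoldt_conv n) + (\<Sum>n=1..N. f n * of_real (ln (real N) - ln (real n)))"
    by (simp add: partial_sum_def conv_sum_def sum_subtractf right_diff_distrib flip: sum_distrib_right)
  then have "norm (partial_sum N * of_real (ln (real N))) \<le> norm (conv_sum N) + norm (\<Sum>n=1..N. f n * of_real (ln (real n)) - mangoldt_conv n) + norm (\<Sum>n=1..N. f n * of_real (ln (real N) - ln (real n)))"
    by (simp only:) (rule order_trans[OF norm_triangle_ineq add_right_mono[OF norm_triangle_ineq]])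
  moreover have "norm (\<Sum>n=1..N. f n * of_real (ln (real n)) - mangoldt_conv n) \<le> 24 * real N"
  proof -
    have "norm (\<Sum>n=1..N. f n * of_real (ln (real n)) - mangoldt_conv n) \<le> (\<Sum>n=1..N. norm (f n * of_real (ln (real n)) - mangoldt_conv n))" by (rule norm_sum)
    also have "\<dots> \<le> (\<Sum>n=1..N. 2 * (\<Sum>d | d dvd n. if coprime d (n div d) then 0 else mangoldt d))"
      by (intro sum_mono norm_f_ln_minus_b) auto
    also have "\<dots> \<le> 2 * (12 * real N)"
      unfolding sum_distrib_left[symmetric] by (intro mult_left_mono sum_mangoldt_noncoprime_le) auto
    finally show ?thesis by simp
  qed
  moreover have "norm (\<Sum>n=1..N. f n * of_real (ln (real N) - ln (real n))) \<le> real N"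
  proof -
    have "norm (\<Sum>n=1..N. f n * of_real (ln (real N) - ln (real n))) \<le> (\<Sum>n=1..N. norm (f n * of_real (ln (real N) - ln (real n))))" by (rule norm_sum)
    also have "\<dots> = (\<Sum>n=1..N. ln (real N) - ln (real n))"
      by (intro sum.cong refl) (auto simp: norm_mult norm_f simp del: of_real_diff)
    also have "\<dots> = real N * ln (real N) - ln (fact N)" by (simp add: sum_subtractf ln_fact_eq_sum)
    also have "\<dots> \<le> real N" using ln_fact_ge[of N] by simp
    finally show ?thesis .
  qed
  ultimately show ?thesis using N by (simp add: norm_mult)
qed

lemma A_eq: "conv_sum N = (\<Sum>d=1..N. mangoldt d * f d * partial_sum (N div d))"
  unfolding conv_sum_def mangoldt_conv_def partial_sum_def
  using sum_divisors_swap[of "\<lambda>d m. mangoldt d * f d * f m" N] by (simp add: sum_distrib_left)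

lemma norm_A_le: "norm (conv_sum N) \<le> (\<Sum>d=1..N. mangoldt d * norm (partial_sum (N div d)))"
proof -
  have "norm (conv_sum N) \<le> (\<Sum>d=1..N. norm (mangoldt d * f d * partial_sum (N div d)))" unfolding A_eq by (rule norm_sum)
  also have "\<dots> = (\<Sum>d=1..N. mangoldt d * norm (partial_sum (N div d)))"
    by (intro sum.cong refl) (auto simp: norm_mult norm_f)
  finally show ?thesis .
qed

lemma summable_nonneg_Icc:
  fixes a :: "nat \<Rightarrow> real"
  assumes "\<And>n. a n \<ge> 0" "\<And>N. (\<Sum>n=1..N. a n) \<le> C"
  shows "summable a"
proof (rule bounded_imp_summable[where B = "a 0 + C"])
  fix n
  have "sum a {..n} = a 0 + sum a {1..n}" by (simp add: sum.atLeast_Suc_atMost atMost_atLeast0)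
  then show "sum a {..n} \<le> a 0 + C" using assms(2)[of n] by simp
qed (use assms in auto)

lemma summable_mangoldt:
  assumes s: "\<sigma> > 1"
  shows "summable (\<lambda>n. norm (mangoldt n * f n * nps \<sigma> t n))"
proof (rule summable_comparison_test')
  show "summable (\<lambda>n. mangoldt n * real n powr (-\<sigma>))"
    by (rule summable_nonneg_Icc[OF _ sum_mangoldt_powr_le[OF s]]) (simp add: mangoldt_nonneg)
  show "norm (norm (mangoldt n * f n * nps \<sigma> t n)) \<le> mangoldt n * real n powr (-\<sigma>)" for n
    by (cases "n = 0") (auto simp: norm_mult norm_f mangoldt_nonneg)
qed

text \<open>Multiplication of absolutely convergent Dirichlet series, rearranged along the bijection
  between \<open>(n, d)\<close> with \<open>d dvd n\<close> and \<open>(d, n div d)\<close>.\<close>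

lemma series_b:
  assumes s: "\<sigma> > 1"
  shows "summable (\<lambda>n. norm (mangoldt_conv n * nps \<sigma> t n))"
    and "(\<Sum>n. mangoldt_conv n * nps \<sigma> t n) = (\<Sum>n. f n * nps \<sigma> t n) * (\<Sum>n. mangoldt n * f n * nps \<sigma> t n)"
proof -
  let ?g = "\<lambda>n. f n * nps \<sigma> t n" and ?h = "\<lambda>n. mangoldt n * f n * nps \<sigma> t n"
  let ?P = "{1::nat..}"
  have to_inf: "infsum a ?P = suminf a" if "summable (\<lambda>n. norm (a n))" "a 0 = 0" for a :: "nat \<Rightarrow> complex"
  proof -
    have "infsum a ?P = infsum a UNIV" by (rule infsum_cong_neutral) (use that(2) in \<open>auto simp: not_le\<close>)
    also have "\<dots> = suminf a"
      using that(1) by (intro infsumI norm_summable_imp_has_sum summable_sums) (auto dest: summable_norm_cancel)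
    finally show ?thesis .
  qed
  have g: "(\<lambda>n. norm (?g n)) summable_on ?P" by (rule abs_summable_term[OF s])
  have h: "(\<lambda>n. norm (?h n)) summable_on ?P"
    using norm_summable_imp_summable_on[of "\<lambda>n. norm (?h n)"] summable_mangoldt[OF s, of t]
    by (auto intro: summable_on_subset_banach)
  define Sg where "Sg = Sigma ?P (\<lambda>n. {d. d dvd n})"
  have bij: "bij_betw (\<lambda>(n, d). (d, n div d)) Sg (?P \<times> ?P)"
    by (rule bij_betwI[of _ _ _ "\<lambda>(d, m). (d * m, d)"]) (auto simp: Sg_def Suc_le_eq elim!: dvdE)
  let ?k = "\<lambda>(d, m). ?h d * ?g m"
  have k: "(\<lambda>x. norm (?k x)) summable_on ?P \<times> ?P"
    using abs_summable_times[OF h g] by (simp add: case_prod_unfold)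
  have kS: "?k (case x of (n, d) \<Rightarrow> (d, n div d)) = (case x of (n, d) \<Rightarrow> mangoldt d * f d * f (n div d) * nps \<sigma> t n)" if "x \<in> Sg" for x
  proof -
    obtain n d where x: "x = (n, d)" "d dvd n" using \<open>x \<in> Sg\<close> by (cases x) (auto simp: Sg_def)
    then have "nps \<sigma> t n = nps \<sigma> t d * nps \<sigma> t (n div d)" by (simp flip: nps_mult)
    with x show ?thesis by simp
  qed
  have kS1: "(\<lambda>x. norm (case x of (n, d) \<Rightarrow> mangoldt d * f d * f (n div d) * nps \<sigma> t n)) summable_on Sg"
    using k summable_on_reindex_bij_betw[OF bij, of "\<lambda>x. norm (?k x)"] 
    by (subst summable_on_cong[of _ _ "\<lambda>x. norm (?k (case x of (n, d) \<Rightarrow> (d, n div d)))"]) (use kS in auto)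
  have "(\<Sum>\<^sub>\<infinity>x\<in>?P \<times> ?P. ?k x) = (\<Sum>\<^sub>\<infinity>x\<in>Sg. case x of (n, d) \<Rightarrow> mangoldt d * f d * f (n div d) * nps \<sigma> t n)"
    by (subst infsum_reindex_bij_betw[OF bij, symmetric]) (rule infsum_cong, rule kS)
  also have "\<dots> = (\<Sum>\<^sub>\<infinity>n\<in>?P. \<Sum>\<^sub>\<infinity>d\<in>{d. d dvd n}. mangoldt d * f d * f (n div d) * nps \<sigma> t n)"
    unfolding Sg_def using abs_summable_summable[OF kS1] by (subst infsum_Sigma_banach[symmetric]) (auto simp: Sg_def)
  also have "\<dots> = (\<Sum>\<^sub>\<infinity>n\<in>?P. mangoldt_conv n * nps \<sigma> t n)"
    by (intro infsum_cong) (auto simp: mangoldt_conv_def sum_distrib_right Suc_le_eq)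
  finally have 1: "(\<Sum>\<^sub>\<infinity>x\<in>?P \<times> ?P. ?k x) = (\<Sum>\<^sub>\<infinity>n\<in>?P. mangoldt_conv n * nps \<sigma> t n)" .
  have "(\<Sum>\<^sub>\<infinity>x\<in>?P \<times> ?P. ?k x) = (\<Sum>\<^sub>\<infinity>d\<in>?P. \<Sum>\<^sub>\<infinity>m\<in>?P. ?h d * ?g m)"
    using abs_summable_summable[OF k] by (subst infsum_Sigma_banach[symmetric]) auto
  also have "\<dots> = infsum ?h ?P * infsum ?g ?P"
    by (simp add: infsum_cmult_right' infsum_cmult_left')
  finally have 2: "(\<Sum>\<^sub>\<infinity>x\<in>?P \<times> ?P. ?k x) = infsum ?h ?P * infsum ?g ?P" .
  show sb: "summable (\<lambda>n. norm (mangoldt_conv n * nps \<sigma> t n))"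
  proof (rule summable_comparison_test')
    define \<delta> where "\<delta> = (\<sigma> - 1) / 2"
    have d: "\<delta> > 0" using s by (simp add: \<delta>_def)
    show "summable (\<lambda>n. (1 / \<delta>) * real n powr (-(1+\<delta>)))"
      using d by (intro summable_mult summable_powr_minus) auto
    show "norm (norm (mangoldt_conv n * nps \<sigma> t n)) \<le> (1 / \<delta>) * real n powr (-(1+\<delta>))" for n
    proof (cases "n = 0")
      case False
      have "norm (mangoldt_conv n) \<le> ln (real n)" using False by (intro norm_b_le) auto
      also have "\<dots> \<le> real n powr \<delta> / \<delta>" using False d by (intro ln_powr_bound) auto
      finally have "norm (mangoldt_conv n) * real n powr (-\<sigma>) \<le> real n powr \<delta> / \<delta> * real n powr (-\<sigma>)" by (intro mult_right_mono) auto
      also have "\<dots> = (1 / \<delta>) * real n powr (\<delta> + (-\<sigma>))" unfolding powr_add by simp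
      also have "\<delta> + (-\<sigma>) = -(1+\<delta>)" by (simp add: \<delta>_def field_simps)
      finally show ?thesis by (simp add: norm_mult)
    qed simp
  qed
  show "(\<Sum>n. mangoldt_conv n * nps \<sigma> t n) = (\<Sum>n. f n * nps \<sigma> t n) * (\<Sum>n. mangoldt n * f n * nps \<sigma> t n)"
    using 1 2 to_inf[OF sb] to_inf[OF summable_norm_term[OF s, of t]] to_inf[OF summable_mangoldt[OF s, of t]]
    by (simp add: mult.commute)
qed

end

section \<open>Mean squares of partial sums\<close>

text \<open>Mean value theorem at a point \<open>z < Suc k \<le> 2 * k\<close>. The exponent
  \<open>- 2 * \<sigma> - 1\<close> is at least -5, so passing from \<open>k\<close> to
  \<open>z\<close> costs at most 32, of which the derivative returns a factor
  \<open>2 * \<sigma> \<ge> 2\<close>.\<close>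

lemma powr_diff_lower:
  assumes s: "1 \<le> \<sigma>" "\<sigma> \<le> 2" and k: "k \<ge> (1::nat)"
  shows "real k powr (- 2 * \<sigma> - 1) / 16 \<le> real k powr (- 2 * \<sigma>) - real (Suc k) powr (- 2 * \<sigma>)"
proof -
  have "\<exists>z>real k. z < real (Suc k) \<and> real (Suc k) powr (- 2 * \<sigma>) - real k powr (- 2 * \<sigma>) = (real (Suc k) - real k) * ((- 2 * \<sigma>) * z powr (- 2 * \<sigma> - 1))"
  proof (rule MVT2)
    fix x assume "real k \<le> x" "x \<le> real (Suc k)"
    then show "((\<lambda>x. x powr (- 2 * \<sigma>)) has_real_derivative ((- 2 * \<sigma>) * x powr (- 2 * \<sigma> - 1))) (at x)"
      using k by (intro has_real_derivative_powr) auto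
  qed simp
  then obtain z where z: "z > real k" "z < real (Suc k)"
    and eq: "real (Suc k) powr (- 2 * \<sigma>) - real k powr (- 2 * \<sigma>) = (- 2 * \<sigma>) * z powr (- 2 * \<sigma> - 1)" by auto
  have "real k powr (- 2 * \<sigma> - 1) * (1/32) \<le> real k powr (- 2 * \<sigma> - 1) * 2 powr (- 2 * \<sigma> - 1)"
  proof (rule mult_left_mono)
    have "(1/32::real) = 2 powr (-5)" by (simp add: powr_minus)
    also have "\<dots> \<le> 2 powr (- 2 * \<sigma> - 1)" using s by (intro powr_mono) auto
    finally show "(1/32::real) \<le> 2 powr (- 2 * \<sigma> - 1)" .
  qed simp
  also have "\<dots> = (2 * real k) powr (- 2 * \<sigma> - 1)" by (simp add: powr_mult mult.commute)
  also have "\<dots> \<le> z powr (- 2 * \<sigma> - 1)" using z k s by (intro powr_mono2') auto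
  finally have "real k powr (- 2 * \<sigma> - 1) / 16 \<le> 2 * z powr (- 2 * \<sigma> - 1)" by simp
  also have "\<dots> \<le> 2 * \<sigma> * z powr (- 2 * \<sigma> - 1)" using s by (intro mult_right_mono) auto
  finally show ?thesis using eq by simp
qed

context unimodular
begin

text \<open>Chebyshev's bound, in the role \<open>E n = 6\<close>, is the only input. The pointwise
  bound \<open>O(1 / (\<sigma> - 1))\<close> for the series would give the square of this; the mean
  square saves one power.\<close>

lemma integral_L_le:
  assumes s: "\<sigma> > 1" "\<sigma> \<le> 2"
  shows "(LBINT t. (norm (\<Sum>n. mangoldt n * f n * nps \<sigma> t n))\<^sup>2 / (1\<^sup>2 + t\<^sup>2)) \<le> 144 * pi / (\<sigma> - 1)"
    and "integrable lborel (\<lambda>t. (norm (\<Sum>n. mangoldt n * f n * nps \<sigma> t n))\<^sup>2 / (1\<^sup>2 + t\<^sup>2))"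
proof -
  define a where "a = (\<lambda>n. mangoldt n * f n * of_real (real n powr (-\<sigma>)))"
  have eq: "mangoldt n * f n * nps \<sigma> t n = a n * cis (- t * ln (real n))" for n t
    by (simp add: a_def nps_def)
  have sm: "summable (\<lambda>n. norm (a n))"
    using summable_mangoldt[OF s(1), of 0] by (simp add: eq norm_mult)
  have a0: "a 0 = 0" by (simp add: a_def)
  note pl = plancherel_limit[OF zero_less_one sm a0, of "\<lambda>n. ln (real n)"]
  show "integrable lborel (\<lambda>t. (norm (\<Sum>n. mangoldt n * f n * nps \<sigma> t n))\<^sup>2 / (1\<^sup>2 + t\<^sup>2))"
    unfolding eq by (rule pl(2))
  have "(LBINT t. (norm (\<Sum>n=1..N. a n * cis (- t * ln (real n))))\<^sup>2 / (1\<^sup>2 + t\<^sup>2)) \<le> 144 * pi / (\<sigma> - 1)" for N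
  proof -
    have "(LBINT t. (norm (\<Sum>n=1..N. a n * cis (- t * ln (real n))))\<^sup>2 / (1\<^sup>2 + t\<^sup>2)) \<le> 2 * pi / 1 * (\<Sum>n=1..N. mangoldt n * 6 * real n powr (-\<sigma>))"
      unfolding a_def using s psi_le
      by (intro plancherel_upper) (auto simp: norm_mult norm_f psi_def mult.commute)
    also have "(\<Sum>n=1..N. mangoldt n * 6 * real n powr (-\<sigma>)) = 6 * (\<Sum>n=1..N. mangoldt n * real n powr (-\<sigma>))"
      by (simp add: sum_distrib_left mult_ac)
    also have "2 * pi / 1 * (6 * (\<Sum>n=1..N. mangoldt n * real n powr (-\<sigma>))) \<le> 2 * pi / 1 * (6 * (6 * (\<sigma> / (\<sigma> - 1))))"
      using sum_mangoldt_powr_le[OF s(1), of N] by (intro mult_left_mono) auto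
    also have "\<dots> \<le> 2 * pi / 1 * (6 * (6 * (2 / (\<sigma> - 1))))"
      using s by (intro mult_left_mono divide_right_mono) auto
    finally show ?thesis by simp
  qed
  then show "(LBINT t. (norm (\<Sum>n. mangoldt n * f n * nps \<sigma> t n))\<^sup>2 / (1\<^sup>2 + t\<^sup>2)) \<le> 144 * pi / (\<sigma> - 1)"
    unfolding eq by (intro LIMSEQ_le_const2[OF pl(1)]) auto
qed

text \<open>The coefficients and the averages of their partial sums are both majorised by
  \<open>ln n\<close>. The first bound is meant for large \<open>c\<close>, where its
  \<open>1 / c\<close> is the gain; the third ties the integral with kernel width
  \<open>\<sigma>\<close> to the partial sums.\<close>

lemma integral_B:
  assumes s: "\<sigma> > 1" "\<sigma> \<le> 2" and c: "c \<ge> 1"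
  shows "(LBINT t. (norm (\<Sum>n. mangoldt_conv n * nps \<sigma> t n))\<^sup>2 / (c\<^sup>2 + t\<^sup>2)) \<le> 96 * pi / (c * (\<sigma> - 1) ^ 3)"
    and "integrable lborel (\<lambda>t. (norm (\<Sum>n. mangoldt_conv n * nps \<sigma> t n))\<^sup>2 / (c\<^sup>2 + t\<^sup>2))"
    and "pi / \<sigma> * (\<Sum>k=1..X. (real k powr (- 2 * \<sigma>) - real (Suc k) powr (- 2 * \<sigma>)) * (norm (conv_sum k))\<^sup>2)
       \<le> (LBINT t. (norm (\<Sum>n. mangoldt_conv n * nps \<sigma> t n))\<^sup>2 / (\<sigma>\<^sup>2 + t\<^sup>2))"
proof -
  define a where "a = (\<lambda>n. mangoldt_conv n * of_real (real n powr (-\<sigma>)))"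
  have eq: "mangoldt_conv n * nps \<sigma> t n = a n * cis (- t * ln (real n))" for n t
    by (simp add: a_def nps_def)
  have sm: "summable (\<lambda>n. norm (a n))"
    using series_b(1)[OF s(1), of 0] by (simp add: eq norm_mult)
  have a0: "a 0 = 0" by (simp add: a_def)
  have c0: "c > 0" using c by simp
  note pl = plancherel_limit[OF c0 sm a0, of "\<lambda>n. ln (real n)"]
  show "integrable lborel (\<lambda>t. (norm (\<Sum>n. mangoldt_conv n * nps \<sigma> t n))\<^sup>2 / (c\<^sup>2 + t\<^sup>2))"
    unfolding eq by (rule pl(2))
  have "(LBINT t. (norm (\<Sum>n=1..N. a n * cis (- t * ln (real n))))\<^sup>2 / (c\<^sup>2 + t\<^sup>2)) \<le> 96 * pi / (c * (\<sigma> - 1) ^ 3)" for N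
  proof -
    have "(LBINT t. (norm (\<Sum>n=1..N. a n * cis (- t * ln (real n))))\<^sup>2 / (c\<^sup>2 + t\<^sup>2)) \<le> 2 * pi / c * (\<Sum>n=1..N. ln (real n) * ln (real n) * real n powr (-\<sigma>))"
      unfolding a_def using s c
      by (intro plancherel_upper norm_b_le) (use ln_fact_le in \<open>auto simp: ln_fact_eq_sum\<close>)
    also have "\<dots> \<le> 2 * pi / c * (48 / (\<sigma> - 1) ^ 3)"
      using s c by (intro mult_left_mono sum_ln_square_powr_le) auto
    finally show ?thesis by simp
  qed
  then show "(LBINT t. (norm (\<Sum>n. mangoldt_conv n * nps \<sigma> t n))\<^sup>2 / (c\<^sup>2 + t\<^sup>2)) \<le> 96 * pi / (c * (\<sigma> - 1) ^ 3)"
    unfolding eq by (intro LIMSEQ_le_const2[OF pl(1)]) auto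
  have s0: "\<sigma> > 0" using s by simp
  note pl' = plancherel_limit[OF s0 sm a0, of "\<lambda>n. ln (real n)"]
  have "pi / \<sigma> * (\<Sum>k=1..X. (real k powr (- 2 * \<sigma>) - real (Suc k) powr (- 2 * \<sigma>)) * (norm (conv_sum k))\<^sup>2)
     \<le> (LBINT t. (norm (\<Sum>n=1..N. a n * cis (- t * ln (real n))))\<^sup>2 / (\<sigma>\<^sup>2 + t\<^sup>2))" if "N \<ge> X" for N
    unfolding a_def conv_sum_def using plancherel_lower[OF s0 that, of mangoldt_conv] by simp
  then show "pi / \<sigma> * (\<Sum>k=1..X. (real k powr (- 2 * \<sigma>) - real (Suc k) powr (- 2 * \<sigma>)) * (norm (conv_sum k))\<^sup>2)
       \<le> (LBINT t. (norm (\<Sum>n. mangoldt_conv n * nps \<sigma> t n))\<^sup>2 / (\<sigma>\<^sup>2 + t\<^sup>2))"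
    unfolding eq by (intro LIMSEQ_le_const[OF pl'(1)]) auto
qed

text \<open>The integral bounds give 144 and \<open>2 * 96\<close>. Both are multiplied by 2 for
  \<open>\<sigma> \<le> 2\<close> and by 16 from \<open>powr_diff_lower\<close>, which produces 4608
  and 6144.\<close>

lemma sum_A_square_le:
  assumes s: "\<sigma> > 1" "\<sigma> \<le> 2" and T: "T \<ge> 1" and e: "\<epsilon> \<ge> 0"
    and sup: "\<And>t. \<bar>t\<bar> \<le> T \<Longrightarrow> norm (\<Sum>n. f n * nps \<sigma> t n) \<le> \<epsilon> / (\<sigma> - 1)"
  shows "(\<Sum>k=1..X. real k powr (- 2 * \<sigma> - 1) * (norm (conv_sum k))\<^sup>2) \<le> (4608 * \<epsilon>\<^sup>2 + 6144 / T) / (\<sigma> - 1) ^ 3"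
proof -
  define F where "F = (\<lambda>t. \<Sum>n. f n * nps \<sigma> t n)"
  define L where "L = (\<lambda>t. \<Sum>n. mangoldt n * f n * nps \<sigma> t n)"
  define B where "B = (\<lambda>t. \<Sum>n. mangoldt_conv n * nps \<sigma> t n)"
  have BFL: "B t = F t * L t" for t unfolding B_def F_def L_def by (rule series_b(2)[OF s(1)])
  have iL: "integrable lborel (\<lambda>t. (norm (L t))\<^sup>2 / (1\<^sup>2 + t\<^sup>2))" unfolding L_def by (rule integral_L_le[OF s])
  have iB: "integrable lborel (\<lambda>t. (norm (B t))\<^sup>2 / (c\<^sup>2 + t\<^sup>2))" if "c \<ge> 1" for c unfolding B_def by (rule integral_B[OF s that])
  define K where "K = (\<epsilon> / (\<sigma> - 1))\<^sup>2"
  have pw: "(norm (B t))\<^sup>2 / (\<sigma>\<^sup>2 + t\<^sup>2) \<le> K * ((norm (L t))\<^sup>2 / (1\<^sup>2 + t\<^sup>2)) + 2 * ((norm (B t))\<^sup>2 / (T\<^sup>2 + t\<^sup>2))" for t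
  proof -
    have p1: "1\<^sup>2 + t\<^sup>2 > 0" by (simp add: add_pos_nonneg)
    have p2: "T\<^sup>2 + t\<^sup>2 > 0" using T by (simp add: add_pos_nonneg)
    have "1\<^sup>2 \<le> \<sigma>\<^sup>2" using s by (intro power_mono) auto
    then have le: "(norm (B t))\<^sup>2 / (\<sigma>\<^sup>2 + t\<^sup>2) \<le> (norm (B t))\<^sup>2 / (1\<^sup>2 + t\<^sup>2)"
      using p1 by (intro divide_left_mono mult_pos_pos) auto
    show ?thesis
    proof (cases "\<bar>t\<bar> \<le> T")
      case True
      have "norm (F t) \<le> \<epsilon> / (\<sigma> - 1)" unfolding F_def by (rule sup[OF True])
      then have "(norm (F t))\<^sup>2 \<le> K" unfolding K_def by (intro power_mono) auto
      then have "(norm (F t))\<^sup>2 * (norm (L t))\<^sup>2 / (1\<^sup>2 + t\<^sup>2) \<le> K * (norm (L t))\<^sup>2 / (1\<^sup>2 + t\<^sup>2)"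
        using p1 by (intro divide_right_mono mult_right_mono) auto
      moreover have "(norm (B t))\<^sup>2 = (norm (F t))\<^sup>2 * (norm (L t))\<^sup>2" by (simp add: BFL norm_mult power_mult_distrib)
      moreover have "0 \<le> 2 * ((norm (B t))\<^sup>2 / (T\<^sup>2 + t\<^sup>2))" using p2 by simp
      ultimately have "(norm (B t))\<^sup>2 / (1\<^sup>2 + t\<^sup>2) \<le> K * ((norm (L t))\<^sup>2 / (1\<^sup>2 + t\<^sup>2))"
        and "0 \<le> 2 * ((norm (B t))\<^sup>2 / (T\<^sup>2 + t\<^sup>2))" by simp_all
      then show ?thesis using le by linarith
    next
      case False
      then have "T\<^sup>2 \<le> t\<^sup>2" using T by (metis abs_ge_zero abs_le_square_iff abs_of_nonneg less_eq_real_def not_le order_trans zero_le_one)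
      then have "(norm (B t))\<^sup>2 * (T\<^sup>2 + t\<^sup>2) \<le> (norm (B t))\<^sup>2 * (2 * (1\<^sup>2 + t\<^sup>2))" by (intro mult_left_mono) auto
      then have "(norm (B t))\<^sup>2 / (1\<^sup>2 + t\<^sup>2) \<le> 2 * ((norm (B t))\<^sup>2 / (T\<^sup>2 + t\<^sup>2))"
        using p1 p2 by (simp add: field_simps)
      moreover have "0 \<le> K * ((norm (L t))\<^sup>2 / (1\<^sup>2 + t\<^sup>2))" using p1 by (simp add: K_def)
      ultimately show ?thesis using le by linarith
    qed
  qed
  have "pi / \<sigma> * (\<Sum>k=1..X. (real k powr (- 2 * \<sigma>) - real (Suc k) powr (- 2 * \<sigma>)) * (norm (conv_sum k))\<^sup>2)
     \<le> (LBINT t. (norm (B t))\<^sup>2 / (\<sigma>\<^sup>2 + t\<^sup>2))" unfolding B_def by (rule integral_B(3)[OF s order_refl])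
  also have "\<dots> \<le> (LBINT t. K * ((norm (L t))\<^sup>2 / (1\<^sup>2 + t\<^sup>2)) + 2 * ((norm (B t))\<^sup>2 / (T\<^sup>2 + t\<^sup>2)))"
    using pw s T by (intro integral_mono iB Bochner_Integration.integrable_add integrable_mult_right iL) auto
  also have "\<dots> = K * (LBINT t. (norm (L t))\<^sup>2 / (1\<^sup>2 + t\<^sup>2)) + 2 * (LBINT t. (norm (B t))\<^sup>2 / (T\<^sup>2 + t\<^sup>2))"
    by (simp only: Bochner_Integration.integral_add integral_mult_right_zero integrable_mult_right iL iB[OF T])
  also have "\<dots> \<le> K * (144 * pi / (\<sigma> - 1)) + 2 * (96 * pi / (T * (\<sigma> - 1) ^ 3))"
    unfolding L_def B_def by (intro add_mono mult_left_mono integral_L_le integral_B s T) (auto simp: K_def)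
  also have "\<dots> = pi * ((144 * \<epsilon>\<^sup>2 + 192 / T) / (\<sigma> - 1) ^ 3)"
    by (simp add: K_def power_divide add_divide_distrib distrib_left power2_eq_square power3_eq_cube mult_ac)
  finally have I: "pi / \<sigma> * (\<Sum>k=1..X. (real k powr (- 2 * \<sigma>) - real (Suc k) powr (- 2 * \<sigma>)) * (norm (conv_sum k))\<^sup>2) \<le> pi * ((144 * \<epsilon>\<^sup>2 + 192 / T) / (\<sigma> - 1) ^ 3)" .
  define W where "W = (\<Sum>k=1..X. (real k powr (- 2 * \<sigma>) - real (Suc k) powr (- 2 * \<sigma>)) * (norm (conv_sum k))\<^sup>2)"
  define Y where "Y = (144 * \<epsilon>\<^sup>2 + 192 / T) / (\<sigma> - 1) ^ 3"
  have Y0: "Y \<ge> 0" using s T e by (simp add: Y_def)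
  have "pi * W \<le> pi * (\<sigma> * Y)" using I s unfolding W_def[symmetric] Y_def[symmetric] by (simp add: field_simps)
  then have "W \<le> \<sigma> * Y" using pi_gt_zero by (simp only: mult_le_cancel_left_pos)
  also have "\<dots> \<le> 2 * Y" using s Y0 by (intro mult_right_mono) auto
  finally have W: "W \<le> 2 * Y" .
  have "(\<Sum>k=1..X. real k powr (- 2 * \<sigma> - 1) / 16 * (norm (conv_sum k))\<^sup>2) \<le> W"
    unfolding W_def using s by (intro sum_mono mult_right_mono powr_diff_lower) auto
  also have "(\<Sum>k=1..X. real k powr (- 2 * \<sigma> - 1) / 16 * (norm (conv_sum k))\<^sup>2) = (\<Sum>k=1..X. real k powr (- 2 * \<sigma> - 1) * (norm (conv_sum k))\<^sup>2) / 16"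
    by (simp add: sum_divide_distrib)
  finally have "(\<Sum>k=1..X. real k powr (- 2 * \<sigma> - 1) * (norm (conv_sum k))\<^sup>2) \<le> 32 * Y" using W by simp
  also have "\<dots> = (4608 * \<epsilon>\<^sup>2 + 6144 / T) / (\<sigma> - 1) ^ 3" by (simp add: Y_def add_divide_distrib)
  finally show ?thesis .
qed

text \<open>Choosing \<open>\<sigma> = 1 + 1 / ln X\<close> makes \<open>k powr (2 - 2 * \<sigma>)\<close> bounded below for \<open>k \<le> X\<close>.\<close>

lemma sum_A_square_small:
  assumes div: "\<And>t M. \<exists>Q. finite Q \<and> (\<forall>q\<in>Q. prime q) \<and> (\<Sum>p\<in>Q. defect t p / real p) > M"
    and eta: "\<eta> > 0"
  shows "\<forall>\<^sub>F X in sequentially. (\<Sum>k=1..X. (norm (conv_sum k))\<^sup>2 / real k ^ 3) \<le> \<eta> * ln (real X) ^ 3"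
proof -
  \<comment> \<open>\<open>T\<close> and \<open>\<epsilon>\<close> make each of the two terms at
    most \<open>\<eta> / 2\<close>; the 9 bounds \<open>exp 2\<close>, the loss in passing from
    \<open>k powr (- 2 * \<sigma> - 1)\<close> to \<open>1 / k ^ 3\<close>. \<open>T\<close>
    precedes \<open>\<delta>\<close>, as uniform smallness is available only on a bounded range of
    \<open>t\<close>.\<close>
  define T where "T = max 1 (2 * 9 * 6144 / \<eta>)"
  define \<epsilon> where "\<epsilon> = sqrt (\<eta> / (2 * 9 * 4608))"
  have T1: "T \<ge> 1" by (simp add: T_def)
  have e0: "\<epsilon> > 0" using eta by (simp add: \<epsilon>_def)
  have bnd: "9 * (4608 * \<epsilon>\<^sup>2 + 6144 / T) \<le> \<eta>"
  proof -
    have "9 * (4608 * \<epsilon>\<^sup>2) = \<eta> / 2" using eta by (simp add: \<epsilon>_def)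
    moreover have "9 * (6144 / T) \<le> \<eta> / 2"
    proof -
      have "2 * 9 * 6144 / \<eta> \<le> T" by (simp add: T_def)
      then show ?thesis using eta T1 by (simp add: field_simps)
    qed
    ultimately show ?thesis by simp
  qed
  obtain \<delta> where d: "\<delta> > 0" and sup: "\<And>\<sigma> t. 1 < \<sigma> \<Longrightarrow> \<sigma> < 1 + \<delta> \<Longrightarrow> \<bar>t\<bar> \<le> T \<Longrightarrow> norm (\<Sum>n. f n * nps \<sigma> t n) \<le> \<epsilon> / (\<sigma> - 1)"
    using series_small_uniformly[OF div e0, of T] by metis
  have "filterlim (\<lambda>X::nat. ln (real X)) at_top sequentially" by real_asymp
  then have "\<forall>\<^sub>F X in sequentially. ln (real X) > max 1 (1 / \<delta>)" unfolding filterlim_at_top_dense by blast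
  then show ?thesis
  proof eventually_elim
    case (elim X)
    define \<sigma> where "\<sigma> = 1 + 1 / ln (real X)"
    have lX: "ln (real X) > 1" "ln (real X) > 1 / \<delta>" using elim by auto
    then have s: "\<sigma> > 1" "\<sigma> \<le> 2" "\<sigma> < 1 + \<delta>" using d by (auto simp: \<sigma>_def field_simps)
    have "(\<Sum>k=1..X. (norm (conv_sum k))\<^sup>2 / real k ^ 3) \<le> (\<Sum>k=1..X. 9 * (real k powr (- 2 * \<sigma> - 1) * (norm (conv_sum k))\<^sup>2))"
    proof (rule sum_mono)
      fix k assume k: "k \<in> {1..X}"
      have "ln (real k) / ln (real X) \<le> 1" 
      proof -
        have "ln (real k) \<le> ln (real X)" using k by (subst ln_le_cancel_iff) auto
        then show ?thesis using lX by (simp add: divide_le_eq_1_pos)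
      qed
      then have "exp (- 2) \<le> exp (- 2 * (\<sigma> - 1) * ln (real k))" by (simp add: \<sigma>_def)
      also have "\<dots> = real k powr (- 2 * (\<sigma> - 1))" using k by (simp add: powr_def)
      finally have "exp (- 2) \<le> real k powr (- 2 * (\<sigma> - 1))" .
      moreover have "(1::real) / 9 \<le> exp (- 2)"
      proof -
        have "exp (2::real) = exp 1 * exp 1" by (simp flip: exp_add)
        also have "\<dots> \<le> 3 * 3" using exp_le by (intro mult_mono) auto
        finally show ?thesis by (simp add: exp_minus field_simps)
      qed
      ultimately have "1 \<le> 9 * real k powr (- 2 * (\<sigma> - 1))" by linarith
      then have "1 * real k powr (-3) \<le> 9 * real k powr (- 2 * (\<sigma> - 1)) * real k powr (-3)" by (intro mult_right_mono) auto
      also have "\<dots> = 9 * real k powr (- 2 * (\<sigma> - 1) + (-3))" unfolding powr_add by (simp only: mult.assoc)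
      also have "- 2 * (\<sigma> - 1) + (-3) = - 2 * \<sigma> - 1" by simp
      finally have "real k powr (-3) * (norm (conv_sum k))\<^sup>2 \<le> 9 * real k powr (- 2 * \<sigma> - 1) * (norm (conv_sum k))\<^sup>2"
        by (intro mult_right_mono) auto
      moreover have "real k powr (-3) = 1 / real k ^ 3" using k by (simp add: powr_minus divide_inverse)
      ultimately show "(norm (conv_sum k))\<^sup>2 / real k ^ 3 \<le> 9 * (real k powr (- 2 * \<sigma> - 1) * (norm (conv_sum k))\<^sup>2)" by simp
    qed
    also have "\<dots> \<le> 9 * ((4608 * \<epsilon>\<^sup>2 + 6144 / T) / (\<sigma> - 1) ^ 3)"
      unfolding sum_distrib_left[symmetric] using s e0 by (intro mult_left_mono sum_A_square_le T1 sup) auto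
    also have "\<dots> = 9 * (4608 * \<epsilon>\<^sup>2 + 6144 / T) * ln (real X) ^ 3"
      using lX by (simp add: \<sigma>_def power_divide)
    also have "\<dots> \<le> \<eta> * ln (real X) ^ 3" using bnd lX by (intro mult_right_mono) auto
    finally show ?case .
  qed
qed

end

section \<open>Halasz's theorem\<close>

lemma sum_inverse_le:
  assumes "m \<ge> 1"
  shows "(\<Sum>k=1..m. 1 / real k) \<le> 1 + ln (real m)"
  using assms
proof (induction m rule: dec_induct)
  case (step n)
  have "ln (real n / real (Suc n)) \<le> real n / real (Suc n) - 1"
    using step by (intro ln_le_minus_one) auto
  also have "\<dots> = - (1 / real (Suc n))" by (simp add: field_simps)
  finally have "1 / real (Suc n) \<le> ln (real (Suc n)) - ln (real n)" using step by (simp add: ln_div)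
  with step show ?case by simp
qed simp

text \<open>The condition means \<open>k \<le> exp y\<close>, so a small proportion of the
  logarithmic scale carries little harmonic weight.\<close>

lemma sum_inverse_ln_le:
  assumes y: "y \<ge> 0"
  shows "(\<Sum>k\<in>{k\<in>{1..X}. ln (real k) \<le> y}. 1 / real k) \<le> 1 + y"
proof -
  define m where "m = nat \<lfloor>exp y\<rfloor>"
  have "exp y \<ge> 1" using y by simp
  then have m: "m \<ge> 1" "real m \<le> exp y" by (auto simp: m_def le_nat_floor)
  have "{k\<in>{1..X}. ln (real k) \<le> y} \<subseteq> {1..m}"
  proof
    fix k assume k: "k \<in> {k\<in>{1..X}. ln (real k) \<le> y}"
    then have "exp (ln (real k)) \<le> exp y" by (simp only: exp_le_cancel_iff) auto
    then have "real k \<le> exp y" using k by (subst (asm) exp_ln) auto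
    then have "k \<le> m" unfolding m_def by (rule le_nat_floor)
    with k show "k \<in> {1..m}" by auto
  qed
  then have "(\<Sum>k\<in>{k\<in>{1..X}. ln (real k) \<le> y}. 1 / real k) \<le> (\<Sum>k=1..m. 1 / real k)"
    by (intro sum_mono2) auto
  also have "\<dots> \<le> 1 + ln (real m)" by (rule sum_inverse_le[OF m(1)])
  also have "ln (real m) \<le> ln (exp y)" using m by (subst ln_le_cancel_iff) auto
  finally show ?thesis by simp
qed

context unimodular
begin

text \<open>The inequality of arithmetic and geometric means with a free weight \<open>\<mu>\<close>
  takes the place of Cauchy-Schwarz: \<open>u \<le> \<mu> / 2 * u^2 + 1 / (2 * \<mu>)\<close> for
  \<open>u = norm (conv_sum k) / k\<close>. The harmonic sum is at most
  \<open>2 * ln X\<close>.\<close>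

lemma sum_S_ln_le:
  assumes X: "ln (real X) \<ge> 1" and mu: "\<mu> > 0"
  shows "(\<Sum>k=1..X. norm (partial_sum k) * ln (real k) / (real k)\<^sup>2) \<le>
    (\<mu> * (\<Sum>k=1..X. (norm (conv_sum k))\<^sup>2 / real k ^ 3) + 2 * ln (real X) / \<mu>) / 2 + 50 * ln (real X)"
proof -
  have X1: "X \<ge> 1" using X by (cases "X = 0") auto
  have "(\<Sum>k=1..X. norm (partial_sum k) * ln (real k) / (real k)\<^sup>2) \<le> (\<Sum>k=1..X. \<mu> / 2 * ((norm (conv_sum k))\<^sup>2 / real k ^ 3) + (1 / (2 * \<mu>) + 25) * (1 / real k))"
  proof (rule sum_mono)
    fix k assume k: "k \<in> {1..X}"
    then have k0: "real k > 0" by simp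
    define u where "u = norm (conv_sum k) / real k"
    have "0 \<le> (\<mu> * u - 1)\<^sup>2" by simp
    then have "2 * \<mu> * u \<le> \<mu>\<^sup>2 * u\<^sup>2 + 1" by (simp add: power2_eq_square algebra_simps)
    then have "u \<le> \<mu> / 2 * u\<^sup>2 + 1 / (2 * \<mu>)" using mu by (simp add: field_simps power2_eq_square)
    then have "u / real k \<le> (\<mu> / 2 * u\<^sup>2 + 1 / (2 * \<mu>)) / real k" using k0 by (intro divide_right_mono) auto
    also have "\<dots> = \<mu> / 2 * ((norm (conv_sum k))\<^sup>2 / real k ^ 3) + (1 / (2 * \<mu>)) * (1 / real k)"
      using k0 mu by (simp add: u_def add_divide_distrib power2_eq_square power3_eq_cube)
    finally have u: "u / real k \<le> \<mu> / 2 * ((norm (conv_sum k))\<^sup>2 / real k ^ 3) + (1 / (2 * \<mu>)) * (1 / real k)" .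
    have "norm (partial_sum k) * ln (real k) / (real k)\<^sup>2 \<le> (norm (conv_sum k) + 25 * real k) / (real k)\<^sup>2"
      using k by (intro divide_right_mono norm_S_ln_le) auto
    also have "\<dots> = u / real k + 25 * (1 / real k)" using k0 by (simp add: u_def add_divide_distrib power2_eq_square)
    finally show "norm (partial_sum k) * ln (real k) / (real k)\<^sup>2 \<le> \<mu> / 2 * ((norm (conv_sum k))\<^sup>2 / real k ^ 3) + (1 / (2 * \<mu>) + 25) * (1 / real k)"
      using u by (simp add: algebra_simps)
  qed
  also have "\<dots> = \<mu> / 2 * (\<Sum>k=1..X. (norm (conv_sum k))\<^sup>2 / real k ^ 3) + (1 / (2 * \<mu>) + 25) * (\<Sum>k=1..X. 1 / real k)"
    by (simp only: sum.distrib sum_distrib_left)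
  also have "\<dots> \<le> \<mu> / 2 * (\<Sum>k=1..X. (norm (conv_sum k))\<^sup>2 / real k ^ 3) + (1 / (2 * \<mu>) + 25) * (2 * ln (real X))"
    using sum_inverse_le[OF X1] X mu by (intro add_left_mono mult_left_mono) auto
  also have "\<dots> = (\<mu> * (\<Sum>k=1..X. (norm (conv_sum k))\<^sup>2 / real k ^ 3) + 2 * ln (real X) / \<mu>) / 2 + 50 * ln (real X)"
    using mu by (simp add: field_simps)
  finally show ?thesis .
qed

text \<open>To divide by \<open>ln k\<close>, the indices with \<open>ln k \<le> a * l\<close> are
  estimated trivially; for all others \<open>ln k\<close> exceeds \<open>a * l\<close>.\<close>

lemma sum_S_small:
  assumes div: "\<And>t M. \<exists>Q. finite Q \<and> (\<forall>q\<in>Q. prime q) \<and> (\<Sum>p\<in>Q. defect t p / real p) > M"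
    and th: "\<theta> > 0"
  shows "\<forall>\<^sub>F X in sequentially. (\<Sum>k=1..X. norm (partial_sum k) / (real k)\<^sup>2) \<le> \<theta> * ln (real X)"
proof -
  \<comment> \<open>The indices set aside contribute at most \<open>2 * a * l\<close>, half of the
    allowance. With \<open>\<mu> = lam / l\<close> and the mean square at most
    \<open>2 / lam^2 * l ^ 3\<close>, the two balanced terms add up to
    \<open>a * \<theta> / 4 * l^2\<close>, and the threshold 200 makes \<open>50 * l\<close> fit in
    the same amount.\<close>
  define a where "a = \<theta> / 4"
  define lam where "lam = 8 / (a * \<theta>)"
  have a0: "a > 0" using th by (simp add: a_def)
  have l0: "lam > 0" using th a0 by (simp add: lam_def)
  have "filterlim (\<lambda>X::nat. ln (real X)) at_top sequentially" by real_asymp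
  then have "\<forall>\<^sub>F X in sequentially. ln (real X) > max 1 (max (1 / a) (200 / (a * \<theta>)))"
    unfolding filterlim_at_top_dense by blast
  moreover have "\<forall>\<^sub>F X in sequentially. (\<Sum>k=1..X. (norm (conv_sum k))\<^sup>2 / real k ^ 3) \<le> (2 / lam\<^sup>2) * ln (real X) ^ 3"
    using l0 by (intro sum_A_square_small div) auto
  ultimately show ?thesis
  proof eventually_elim
    case (elim X)
    define l where "l = ln (real X)"
    have l: "l > 1" "1 \<le> a * l" "200 \<le> a * \<theta> * l" using elim a0 th by (auto simp: l_def field_simps)
    let ?W = "\<Sum>k=1..X. norm (partial_sum k) * ln (real k) / (real k)\<^sup>2"
    have "?W \<le> ((lam / l) * (\<Sum>k=1..X. (norm (conv_sum k))\<^sup>2 / real k ^ 3) + 2 * l / (lam / l)) / 2 + 50 * l"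
      unfolding l_def using l l0 by (intro sum_S_ln_le) (auto simp: l_def)
    also have "\<dots> \<le> ((lam / l) * ((2 / lam\<^sup>2) * l ^ 3) + 2 * l / (lam / l)) / 2 + 50 * l"
      using elim(2) l l0 by (intro add_right_mono divide_right_mono mult_left_mono) (auto simp: l_def)
    also have "\<dots> = 2 * l\<^sup>2 / lam + 50 * l"
      using l l0 by (simp add: field_simps power2_eq_square power3_eq_cube)
    also have "2 * l\<^sup>2 / lam = (a * \<theta> / 4) * l\<^sup>2" using a0 th by (simp add: lam_def)
    also have "50 * l \<le> (a * \<theta> / 4) * l\<^sup>2"
      using mult_right_mono[OF l(3), of l] l(1) by (simp add: power2_eq_square)
    finally have W: "?W \<le> a * \<theta> / 2 * l\<^sup>2" by (simp add: mult_ac)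
    have "(\<Sum>k=1..X. norm (partial_sum k) / (real k)\<^sup>2) \<le> (\<Sum>k=1..X. (if ln (real k) \<le> a * l then 1 / real k else 0) + (1 / (a * l)) * (norm (partial_sum k) * ln (real k) / (real k)\<^sup>2))"
    proof (rule sum_mono)
      fix k assume k: "k \<in> {1..X}"
      have nn: "0 \<le> (1 / (a * l)) * (norm (partial_sum k) * ln (real k) / (real k)\<^sup>2)" using k l a0 by simp
      show "norm (partial_sum k) / (real k)\<^sup>2 \<le> (if ln (real k) \<le> a * l then 1 / real k else 0) + (1 / (a * l)) * (norm (partial_sum k) * ln (real k) / (real k)\<^sup>2)"
      proof (cases "ln (real k) \<le> a * l")
        case True
        have "norm (partial_sum k) / (real k)\<^sup>2 \<le> real k / (real k)\<^sup>2" by (intro divide_right_mono norm_S_le) auto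
        also have "\<dots> = 1 / real k" by (simp add: power2_eq_square)
        finally show ?thesis using True nn by simp
      next
        case False
        have "1 * (norm (partial_sum k) / (real k)\<^sup>2) \<le> (ln (real k) / (a * l)) * (norm (partial_sum k) / (real k)\<^sup>2)"
          using False a0 l by (intro mult_right_mono) auto
        with False show ?thesis by (simp add: mult_ac)
      qed
    qed
    also have "\<dots> = (\<Sum>k\<in>{k\<in>{1..X}. ln (real k) \<le> a * l}. 1 / real k) + (1 / (a * l)) * ?W"
      unfolding sum.distrib sum_distrib_left sum.inter_filter[OF finite_atLeastAtMost] ..
    also have "\<dots> \<le> (1 + a * l) + (1 / (a * l)) * (a * \<theta> / 2 * l\<^sup>2)"
      using W a0 l by (intro add_mono mult_left_mono sum_inverse_ln_le) auto
    also have "\<dots> \<le> 2 * (a * l) + \<theta> / 2 * l" using l a0 by (simp add: power2_eq_square)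
    also have "\<dots> = \<theta> * l" by (simp add: a_def)
    finally show ?case by (simp add: l_def)
  qed
qed

text \<open>\<open>S_Lipschitz\<close> gives a loss of at most \<open>\<delta> * M\<close> on a
  window of \<open>J + 1 \<ge> \<delta> * M\<close> integers. The window is then enlarged to
  \<open>{M..2*M}\<close>, where \<open>1 / j^2 \<ge> 1 / (4 * M^2)\<close>, so that its shape no
  longer depends on \<open>\<delta>\<close>.\<close>

lemma norm_S_le_average:
  assumes d: "0 < \<delta>" "\<delta> \<le> 1" and M: "M \<ge> 1"
  shows "norm (partial_sum M) \<le> \<delta> * real M + 4 * real M / \<delta> * (\<Sum>j=M..2*M. norm (partial_sum j) / (real j)\<^sup>2)"
proof -
  let ?R = "\<Sum>j=M..2*M. norm (partial_sum j) / (real j)\<^sup>2"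
  have R0: "?R \<ge> 0" by (intro sum_nonneg) auto
  define J where "J = nat \<lfloor>\<delta> * real M\<rfloor>"
  have dM: "\<delta> * real M \<ge> 0" using d by simp
  have J: "real J \<le> \<delta> * real M" "\<delta> * real M \<le> real J + 1" using dM by (auto simp: J_def)
  have "\<delta> * real M \<le> 1 * real M" using d by (intro mult_right_mono) auto
  with J(1) have JM: "J \<le> M" by linarith
  have "(real J + 1) * norm (partial_sum M) = (\<Sum>j=M..M+J. norm (partial_sum M))" by simp
  also have "\<dots> \<le> (\<Sum>j=M..M+J. norm (partial_sum j) + \<delta> * real M)"
  proof (rule sum_mono)
    fix j assume j: "j \<in> {M..M+J}"
    then have "norm (partial_sum M) \<le> norm (partial_sum j) + (real j - real M)" by (intro S_Lipschitz) auto
    moreover have "real j - real M \<le> real J" using j by auto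
    ultimately show "norm (partial_sum M) \<le> norm (partial_sum j) + \<delta> * real M" using J by linarith
  qed
  also have "\<dots> = (\<Sum>j=M..M+J. norm (partial_sum j)) + (real J + 1) * (\<delta> * real M)" by (simp add: sum.distrib)
  also have "(\<Sum>j=M..M+J. norm (partial_sum j)) \<le> (\<Sum>j=M..2*M. norm (partial_sum j))" using JM by (intro sum_mono2) auto
  also have "(\<Sum>j=M..2*M. norm (partial_sum j)) \<le> (\<Sum>j=M..2*M. 4 * (real M)\<^sup>2 * (norm (partial_sum j) / (real j)\<^sup>2))"
  proof (rule sum_mono)
    fix j assume j: "j \<in> {M..2*M}"
    then have "(real j)\<^sup>2 \<le> (2 * real M)\<^sup>2" by (intro power_mono) auto
    then have "norm (partial_sum j) * (real j)\<^sup>2 \<le> norm (partial_sum j) * (4 * (real M)\<^sup>2)" by (intro mult_left_mono) (auto simp: power2_eq_square)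
    then show "norm (partial_sum j) \<le> 4 * (real M)\<^sup>2 * (norm (partial_sum j) / (real j)\<^sup>2)" using j M by (simp add: field_simps)
  qed
  also have "\<dots> = 4 * (real M)\<^sup>2 * ?R" by (simp add: sum_distrib_left)
  finally have "(real J + 1) * (norm (partial_sum M) - \<delta> * real M) \<le> 4 * (real M)\<^sup>2 * ?R" by (simp add: algebra_simps)
  moreover have "norm (partial_sum M) \<le> \<delta> * real M + 4 * real M / \<delta> * ?R" if h: "norm (partial_sum M) - \<delta> * real M > 0"
  proof -
    have "(\<delta> * real M) * (norm (partial_sum M) - \<delta> * real M) \<le> (real J + 1) * (norm (partial_sum M) - \<delta> * real M)"
      using J h by (intro mult_right_mono) auto
    also have "\<dots> \<le> 4 * (real M)\<^sup>2 * ?R" by fact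
    finally have "real M * (\<delta> * (norm (partial_sum M) - \<delta> * real M)) \<le> real M * (4 * real M * ?R)" by (simp add: power2_eq_square mult_ac)
    then have "\<delta> * (norm (partial_sum M) - \<delta> * real M) \<le> 4 * real M * ?R" using M by (subst (asm) mult_le_cancel_left_pos) auto
    then have "norm (partial_sum M) - \<delta> * real M \<le> 4 * real M * ?R / \<delta>" using d by (simp add: pos_le_divide_eq mult.commute)
    then show ?thesis by (simp add: algebra_simps)
  qed
  moreover have "4 * real M / \<delta> * ?R \<ge> 0" using d R0 by simp
  ultimately show ?thesis by (cases "norm (partial_sum M) - \<delta> * real M > 0") auto
qed

text \<open>After exchanging the sums, a fixed \<open>j\<close> meets only those \<open>d\<close>
  with \<open>N \<le> 2 * d * j\<close> and \<open>d * j \<le> 2 * N\<close>. Chebyshev's bound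
  limits their total \<open>mangoldt d / d\<close> to 24, so no logarithm is lost in this part; it
  multiplies the 4 from the averaging.\<close>

lemma norm_A_le_average:
  assumes d: "0 < \<delta>" "\<delta> \<le> 1" and N: "N \<ge> 1"
  shows "norm (conv_sum N) \<le> \<delta> * real N * (ln (real N) + 6) + 96 * real N / \<delta> * (\<Sum>j=1..2*N. norm (partial_sum j) / (real j)\<^sup>2)"
proof -
  let ?s = "\<lambda>j. norm (partial_sum j) / (real j)\<^sup>2"
  have "norm (conv_sum N) \<le> (\<Sum>d=1..N. mangoldt d * norm (partial_sum (N div d)))" by (rule norm_A_le)
  also have "\<dots> \<le> (\<Sum>d=1..N. \<delta> * real N * (mangoldt d / real d) + 4 * real N / \<delta> * (mangoldt d / real d * (\<Sum>j=N div d..2*(N div d). ?s j)))"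
  proof (rule sum_mono)
    fix d assume dd: "d \<in> {1..N}"
    then have M: "N div d \<ge> 1" by (auto simp: div_greater_zero_iff Suc_le_eq)
    have le: "real (N div d) \<le> real N / real d"
      by (metis floor_divide_of_nat_eq of_int_floor_le of_int_of_nat_eq)
    have "norm (partial_sum (N div d)) \<le> \<delta> * real (N div d) + 4 * real (N div d) / \<delta> * (\<Sum>j=N div d..2*(N div d). ?s j)"
      by (rule norm_S_le_average[OF d M])
    also have "\<dots> \<le> \<delta> * (real N / real d) + 4 * (real N / real d) / \<delta> * (\<Sum>j=N div d..2*(N div d). ?s j)"
      using d le by (intro add_mono mult_left_mono mult_right_mono divide_right_mono sum_nonneg) auto
    finally have "mangoldt d * norm (partial_sum (N div d)) \<le> mangoldt d * (\<delta> * (real N / real d) + 4 * (real N / real d) / \<delta> * (\<Sum>j=N div d..2*(N div d). ?s j))"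
      by (intro mult_left_mono mangoldt_nonneg)
    then show "mangoldt d * norm (partial_sum (N div d)) \<le> \<delta> * real N * (mangoldt d / real d) + 4 * real N / \<delta> * (mangoldt d / real d * (\<Sum>j=N div d..2*(N div d). ?s j))"
      by (simp add: distrib_left mult_ac)
  qed
  also have "\<dots> = \<delta> * real N * (\<Sum>d=1..N. mangoldt d / real d) + 4 * real N / \<delta> * (\<Sum>d=1..N. mangoldt d / real d * (\<Sum>j=N div d..2*(N div d). ?s j))"
    by (simp only: sum.distrib sum_distrib_left)
  also have "(\<Sum>d=1..N. mangoldt d / real d * (\<Sum>j=N div d..2*(N div d). ?s j)) \<le> 24 * (\<Sum>j=1..2*N. ?s j)"
  proof -
    have "(\<Sum>d=1..N. mangoldt d / real d * (\<Sum>j=N div d..2*(N div d). ?s j)) =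
      (\<Sum>d=1..N. \<Sum>j=1..2*N. if N div d \<le> j \<and> j \<le> 2 * (N div d) then mangoldt d / real d * ?s j else 0)"
    proof (intro sum.cong refl)
      fix d assume dd: "d \<in> {1..N}"
      then have "N div d \<ge> 1" "N div d \<le> N" by (auto simp: div_greater_zero_iff Suc_le_eq)
      then have eq: "{N div d..2 * (N div d)} = {j\<in>{1..2*N}. N div d \<le> j \<and> j \<le> 2 * (N div d)}"
        by (auto intro: order_trans[OF _ mult_le_mono2[OF div_le_dividend]])
      have "mangoldt d / real d * (\<Sum>j=N div d..2*(N div d). ?s j) = (\<Sum>j=N div d..2*(N div d). mangoldt d / real d * ?s j)"
        by (rule sum_distrib_left)
      also have "\<dots> = (\<Sum>j=1..2*N. if N div d \<le> j \<and> j \<le> 2 * (N div d) then mangoldt d / real d * ?s j else 0)"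
        unfolding eq by (rule sum.inter_filter) simp
      finally show "mangoldt d / real d * (\<Sum>j=N div d..2*(N div d). ?s j) = (\<Sum>j=1..2*N. if N div d \<le> j \<and> j \<le> 2 * (N div d) then mangoldt d / real d * ?s j else 0)" .
    qed
    also have "\<dots> = (\<Sum>j=1..2*N. \<Sum>d=1..N. if N div d \<le> j \<and> j \<le> 2 * (N div d) then mangoldt d / real d * ?s j else 0)"
      by (rule sum.swap)
    also have "\<dots> \<le> (\<Sum>j=1..2*N. 24 * ?s j)"
    proof (rule sum_mono)
      fix j assume j: "j \<in> {1..2*N}"
      have "(\<Sum>d=1..N. if N div d \<le> j \<and> j \<le> 2 * (N div d) then mangoldt d / real d else 0) \<le> (\<Sum>d=1..2 * N div j. 2 * real j / real N * mangoldt d)"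
      proof -
        have "(\<Sum>d=1..N. if N div d \<le> j \<and> j \<le> 2 * (N div d) then mangoldt d / real d else 0 :: real) = 
          (\<Sum>d\<in>{d\<in>{1..N}. N div d \<le> j \<and> j \<le> 2 * (N div d)}. mangoldt d / real d)"
          by (simp only: sum.inter_filter[OF finite_atLeastAtMost])
        also have "\<dots> \<le> (\<Sum>d\<in>{d\<in>{1..N}. N div d \<le> j \<and> j \<le> 2 * (N div d)}. 2 * real j / real N * mangoldt d)"
        proof (rule sum_mono)
          fix d assume dd: "d \<in> {d\<in>{1..N}. N div d \<le> j \<and> j \<le> 2 * (N div d)}"
          then have d1: "d \<ge> 1" "N div d \<le> j" by auto
          have "N < d * (N div d + 1)" using d1 by (metis Suc_eq_plus1 Suc_le_lessD One_nat_def dividend_less_times_div mult.commute mult_Suc_right add.commute)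
          also have "\<dots> \<le> d * (2 * j)" using d1 j by (intro mult_left_mono) auto
          finally have "real N \<le> real d * (2 * real j)" by (metis less_imp_le of_nat_le_iff of_nat_mult of_nat_numeral)
          then have "1 / real d \<le> 2 * real j / real N" using d1 N by (simp add: field_simps)
          then have "mangoldt d * (1 / real d) \<le> mangoldt d * (2 * real j / real N)" by (intro mult_left_mono mangoldt_nonneg)
          then show "mangoldt d / real d \<le> 2 * real j / real N * mangoldt d" by (simp add: mult_ac)
        qed
        also have "\<dots> \<le> (\<Sum>d=1..2 * N div j. 2 * real j / real N * mangoldt d)"
        proof (rule sum_mono2)
          show "{d\<in>{1..N}. N div d \<le> j \<and> j \<le> 2 * (N div d)} \<subseteq> {1..2 * N div j}"
          proof
            fix d assume dd: "d \<in> {d\<in>{1..N}. N div d \<le> j \<and> j \<le> 2 * (N div d)}"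
            then have "d * j \<le> 2 * (d * (N div d))" by (auto intro: order_trans[OF mult_le_mono2])
            also have "\<dots> \<le> 2 * N" by simp
            finally show "d \<in> {1..2 * N div j}" using dd j by (auto simp: less_eq_div_iff_mult_less_eq)
          qed
        qed (auto simp: mangoldt_nonneg)
        finally show ?thesis .
      qed
      also have "\<dots> = 2 * real j / real N * psi (2 * N div j)" by (simp add: psi_def sum_distrib_left)
      also have "\<dots> \<le> 2 * real j / real N * (6 * (real (2 * N) / real j))"
      proof (rule mult_left_mono)
        have "psi (2 * N div j) \<le> 6 * real (2 * N div j)" by (rule psi_le)
        also have "real (2 * N div j) \<le> real (2 * N) / real j"
          by (metis floor_divide_of_nat_eq of_int_floor_le of_int_of_nat_eq)
        finally show "psi (2 * N div j) \<le> 6 * (real (2 * N) / real j)" by simp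
      qed auto
      also have "\<dots> = 24" using j N by simp
      finally have "(\<Sum>d=1..N. if N div d \<le> j \<and> j \<le> 2 * (N div d) then mangoldt d / real d else 0) * ?s j \<le> 24 * ?s j"
        by (intro mult_right_mono) auto
      moreover have "(\<Sum>d=1..N. if N div d \<le> j \<and> j \<le> 2 * (N div d) then mangoldt d / real d * ?s j else 0) =
        (\<Sum>d=1..N. if N div d \<le> j \<and> j \<le> 2 * (N div d) then mangoldt d / real d else 0) * ?s j"
        unfolding sum_distrib_right by (intro sum.cong refl) auto
      ultimately show "(\<Sum>d=1..N. if N div d \<le> j \<and> j \<le> 2 * (N div d) then mangoldt d / real d * ?s j else 0) \<le> 24 * ?s j" by simp
    qed
    finally show ?thesis by (simp only: sum_distrib_left)
  qed
  also have "(\<Sum>d=1..N. mangoldt d / real d) \<le> ln (real N) + 6" by (rule sum_mangoldt_over_le[OF N])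
  finally show ?thesis using d by (simp add: mult_left_mono mult_right_mono divide_right_mono)
qed

theorem mean_value_zero:
  assumes div: "\<And>t M. \<exists>Q. finite Q \<and> (\<forall>q\<in>Q. prime q) \<and> (\<Sum>p\<in>Q. defect t p / real p) > M"
  shows "(\<lambda>N. partial_sum N / of_nat N) \<longlonglongrightarrow> 0"
proof (rule tendstoI)
  fix e :: real assume "e > 0"
  define \<epsilon> where "\<epsilon> = e / 2"
  have e: "\<epsilon> > 0" using \<open>e > 0\<close> by (simp add: \<epsilon>_def)
  define \<delta> where "\<delta> = min 1 (\<epsilon> / 4)"
  have d: "0 < \<delta>" "\<delta> \<le> 1" "\<delta> \<le> \<epsilon> / 4" using e by (auto simp: \<delta>_def)
  \<comment> \<open>Makes \<open>96 / \<delta> * (\<theta> * (2 * l))\<close> equal to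
    \<open>\<epsilon> / 4 * l\<close>, the 2 coming from
    \<open>ln (2 * N) \<le> 2 * l\<close>.\<close>
  define \<theta> where "\<theta> = \<delta> * \<epsilon> / 768"
  have th: "\<theta> > 0" using e d by (simp add: \<theta>_def)
  have "\<forall>\<^sub>F X in sequentially. (\<Sum>k=1..X. norm (partial_sum k) / (real k)\<^sup>2) \<le> \<theta> * ln (real X)"
    by (rule sum_S_small[OF div th])
  moreover have "filterlim (\<lambda>N::nat. 2 * N) at_top sequentially"
    by (rule filterlim_subseq) (auto simp: strict_mono_def)
  ultimately have ev: "\<forall>\<^sub>F N in sequentially. (\<Sum>k=1..2*N. norm (partial_sum k) / (real k)\<^sup>2) \<le> \<theta> * ln (real (2 * N))"
    by (rule eventually_compose_filterlim)
  have "filterlim (\<lambda>X::nat. ln (real X)) at_top sequentially" by real_asymp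
  \<comment> \<open>\<open>124 = 4 * 31\<close>, where 31 collects the constants 25 and 6, so that
    they fit into \<open>\<epsilon> / 4 * l\<close>.\<close>
  then have "\<forall>\<^sub>F X in sequentially. ln (real X) > max 1 (124 / \<epsilon>)" unfolding filterlim_at_top_dense by blast
  with ev show "\<forall>\<^sub>F N in sequentially. dist (partial_sum N / of_nat N) 0 < e"
  proof eventually_elim
    case (elim N)
    define l where "l = ln (real N)"
    have l: "l > 1" "31 \<le> \<epsilon> / 4 * l" using elim(2) e by (auto simp: l_def field_simps)
    have N: "N \<ge> 1" using l by (cases "N = 0") (auto simp: l_def)
    have "ln (real (2 * N)) = ln 2 + l" using N by (simp add: l_def ln_mult)
    also have "\<dots> \<le> 2 * l" using ln_2_less_1 l by simp
    finally have l2: "ln (real (2 * N)) \<le> 2 * l" .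
    have "(\<Sum>k=1..2*N. norm (partial_sum k) / (real k)\<^sup>2) \<le> \<theta> * (2 * l)"
      using elim(1) mult_left_mono[OF l2, of \<theta>] th by linarith
    then have "96 * real N / \<delta> * (\<Sum>k=1..2*N. norm (partial_sum k) / (real k)\<^sup>2) \<le> 96 * real N / \<delta> * (\<theta> * (2 * l))"
      using d by (intro mult_left_mono) auto
    also have "\<dots> = real N * (\<epsilon> / 4 * l)" using d by (simp add: \<theta>_def)
    finally have b1: "96 * real N / \<delta> * (\<Sum>k=1..2*N. norm (partial_sum k) / (real k)\<^sup>2) \<le> real N * (\<epsilon> / 4 * l)" .
    have "\<delta> * l \<le> \<epsilon> / 4 * l" using d l by (intro mult_right_mono) auto
    then have "\<delta> * (l + 6) \<le> \<epsilon> / 4 * l + 6" using d by (simp add: algebra_simps)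
    then have b2: "\<delta> * real N * (l + 6) \<le> real N * (\<epsilon> / 4 * l + 6)"
      using mult_left_mono[of "\<delta> * (l + 6)" "\<epsilon> / 4 * l + 6" "real N"] by (simp add: mult_ac)
    have "norm (partial_sum N) * l \<le> norm (conv_sum N) + 25 * real N" unfolding l_def by (rule norm_S_ln_le[OF N])
    also have "norm (conv_sum N) \<le> \<delta> * real N * (l + 6) + 96 * real N / \<delta> * (\<Sum>j=1..2*N. norm (partial_sum j) / (real j)\<^sup>2)"
      unfolding l_def by (rule norm_A_le_average[OF d(1,2) N])
    also have "\<dots> \<le> real N * (\<epsilon> / 4 * l + 6) + real N * (\<epsilon> / 4 * l)" using b1 b2 by linarith
    finally have "norm (partial_sum N) * l \<le> real N * (\<epsilon> / 2 * l + 31)" by (simp add: algebra_simps)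
    also have "\<dots> \<le> real N * (\<epsilon> * l)" using l by (intro mult_left_mono) auto
    finally have "l * norm (partial_sum N) \<le> l * (\<epsilon> * real N)" by (simp add: mult_ac)
    then have "norm (partial_sum N) \<le> \<epsilon> * real N" using l by (subst (asm) mult_le_cancel_left_pos) auto
    then have "norm (partial_sum N) / real N \<le> \<epsilon>" using N by (simp add: field_simps)
    then have "norm (partial_sum N) / real N < e" using \<open>e > 0\<close> unfolding \<epsilon>_def by linarith
    then show ?case by (simp add: norm_divide)
  qed
qed

end

section \<open>Nonvanishing mean values\<close>

lemma norm_cis_diff_le: "norm (cis a - cis b) \<le> \<bar>a - b\<bar>"
proof -
  have "cis a - cis b = cis b * (iexp (a - b) - 1)"
    by (simp add: right_diff_distrib cis_conv_exp flip: exp_add)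
  then have "norm (cis a - cis b) = norm (iexp (a - b) - 1)" by (simp add: norm_mult)
  also have "\<dots> \<le> \<bar>a - b\<bar>" using iexp_approx1[of "a - b" 0] by simp
  finally show ?thesis .
qed

text \<open>A discrete derivative bound for \<open>x powr (-s)\<close> with
  \<open>s = \<sigma> + \<i> t\<close>: the change of modulus gives the 2, the change of argument
  gives \<open>\<bar>t\<bar>\<close>.\<close>

lemma norm_nps_diff_le:
  assumes s: "1 \<le> \<sigma>" "\<sigma> \<le> 2" and n: "n \<ge> 1"
  shows "norm (nps \<sigma> t n - nps \<sigma> t (Suc n)) \<le> (2 + \<bar>t\<bar>) * real n powr (- \<sigma> - 1)"
proof -
  define x y where "x = real n powr (-\<sigma>)" and "y = real (Suc n) powr (-\<sigma>)"
  define a b where "a = - t * ln (real n)" and "b = - t * ln (real (Suc n))"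
  have y: "0 \<le> y" "y \<le> x" unfolding x_def y_def using s n by (auto intro: powr_mono2')
  have xy: "x - y \<le> 2 * real n powr (- \<sigma> - 1)"
  proof -
    have "\<exists>z>real n. z < real (Suc n) \<and> real (Suc n) powr (-\<sigma>) - real n powr (-\<sigma>) = (real (Suc n) - real n) * ((-\<sigma>) * z powr (-\<sigma> - 1))"
    proof (rule MVT2)
      fix x assume "real n \<le> x" "x \<le> real (Suc n)"
      then show "((\<lambda>x. x powr (-\<sigma>)) has_real_derivative ((-\<sigma>) * x powr (-\<sigma> - 1))) (at x)"
        using n by (intro has_real_derivative_powr) auto
    qed simp
    then obtain z where z: "z > real n" and eq: "y - x = (-\<sigma>) * z powr (-\<sigma> - 1)" by (auto simp: x_def y_def)
    have "\<sigma> * z powr (-\<sigma> - 1) \<le> 2 * real n powr (-\<sigma> - 1)"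
      using s z n by (intro mult_mono powr_mono2') auto
    with eq show ?thesis by simp
  qed
  have ab: "\<bar>a - b\<bar> \<le> \<bar>t\<bar> / real n"
  proof -
    have "a - b = t * (ln (real (Suc n)) - ln (real n))" by (simp add: a_def b_def algebra_simps)
    moreover have "ln (real (Suc n)) - ln (real n) \<le> 1 / real n"
    proof -
      have "ln (real (Suc n)) - ln (real n) = ln (real (Suc n) / real n)" using n by (simp add: ln_div)
      also have "\<dots> \<le> real (Suc n) / real n - 1" using n by (intro ln_le_minus_one) auto
      also have "\<dots> = 1 / real n" using n by (simp add: field_simps)
      finally show ?thesis .
    qed
    moreover have "0 \<le> ln (real (Suc n)) - ln (real n)" using n by simp
    ultimately show ?thesis using mult_left_mono[of "ln (real (Suc n)) - ln (real n)" "1 / real n" "\<bar>t\<bar>"] by (simp add: abs_mult)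
  qed
  have "nps \<sigma> t n - nps \<sigma> t (Suc n) = of_real (x - y) * cis a + of_real y * (cis a - cis b)"
    by (simp add: nps_def x_def y_def a_def b_def algebra_simps)
  then have "norm (nps \<sigma> t n - nps \<sigma> t (Suc n)) \<le> norm (of_real (x - y) * cis a) + norm (of_real y * (cis a - cis b))"
    by (simp only:) (rule norm_triangle_ineq)
  also have "\<dots> \<le> 2 * real n powr (- \<sigma> - 1) + x * (\<bar>t\<bar> / real n)"
  proof (rule add_mono)
    show "norm (of_real (x - y) * cis a) \<le> 2 * real n powr (- \<sigma> - 1)"
      using xy y by (simp add: norm_mult del: of_real_diff)
    have "norm (of_real y * (cis a - cis b)) = y * norm (cis a - cis b)" using y by (simp add: norm_mult)
    also have "\<dots> \<le> x * (\<bar>t\<bar> / real n)" using y order_trans[OF norm_cis_diff_le ab] by (intro mult_mono) auto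
    finally show "norm (of_real y * (cis a - cis b)) \<le> x * (\<bar>t\<bar> / real n)" .
  qed
  also have "x * (\<bar>t\<bar> / real n) = \<bar>t\<bar> * real n powr (- \<sigma> - 1)" using n by (simp add: x_def powr_diff)
  finally show ?thesis by (simp add: algebra_simps)
qed

context unimodular
begin

lemma sum_by_parts: "(\<Sum>n=1..N. f n * w n) = (\<Sum>n=1..N. partial_sum n * (w n - w (Suc n))) + partial_sum N * w (Suc N)"
  by (induction N) (auto simp: partial_sum_def algebra_simps)

text \<open>An Abelian argument at one fixed \<open>t\<close>. In the summation by parts
  \<open>norm (partial_sum n) \<le> \<eta> * n + N0\<close> meets differences of size
  \<open>n powr (- \<sigma> - 1)\<close>, so only the part with \<open>\<eta>\<close> grows like
  \<open>1 / (\<sigma> - 1)\<close>.\<close>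

lemma series_small_of_mean_zero:
  assumes lim: "(\<lambda>N. partial_sum N / of_nat N) \<longlonglongrightarrow> 0" and e: "\<epsilon> > 0"
  shows "\<exists>\<delta>>0. \<forall>\<sigma>. 1 < \<sigma> \<longrightarrow> \<sigma> < 1 + \<delta> \<longrightarrow> norm (\<Sum>n. f n * nps \<sigma> t n) \<le> \<epsilon> / (\<sigma> - 1)"
proof -
  define C where "C = 2 + \<bar>t\<bar>"
  \<comment> \<open>Limits the growing part \<open>C * \<eta> * 2 / (\<sigma> - 1)\<close> to half
    of the target.\<close>
  define \<eta> where "\<eta> = \<epsilon> / (4 * C)"
  have C: "C > 0" by (simp add: C_def)
  have eta: "\<eta> > 0" using e C by (simp add: \<eta>_def)
  obtain N0 where N0: "\<And>n. n \<ge> N0 \<Longrightarrow> norm (partial_sum n / of_nat n) < \<eta>"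
    using LIMSEQ_D[OF lim eta] by auto
  have Sn: "norm (partial_sum n) \<le> \<eta> * real n + real N0" if "n \<ge> 1" for n
  proof (cases "n \<ge> N0")
    case True
    then have "norm (partial_sum n) / real n < \<eta>" using N0[OF True] by (simp add: norm_divide)
    then have "norm (partial_sum n) < \<eta> * real n" using that by (simp add: pos_divide_less_eq)
    then show ?thesis by simp
  next
    case False
    then have "norm (partial_sum n) \<le> real N0" using norm_S_le[of n] by simp
    moreover have "0 \<le> \<eta> * real n" using eta by simp
    ultimately show ?thesis by linarith
  qed
  \<comment> \<open>The part that stays bounded as \<open>\<sigma>\<close> tends to 1, including at
    most 1 from the boundary term; \<open>\<delta>\<close> places it below the other half.\<close>
  define D where "D = C * (2 * real N0) + 1"
  have D: "D > 0" using C by (simp add: D_def add_nonneg_pos)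
  define \<delta> where "\<delta> = min 1 (\<epsilon> / (2 * D))"
  have d: "\<delta> > 0" using e D by (simp add: \<delta>_def)
  have "norm (\<Sum>n. f n * nps \<sigma> t n) \<le> \<epsilon> / (\<sigma> - 1)" if s: "1 < \<sigma>" "\<sigma> < 1 + \<delta>" for \<sigma>
  proof -
    have s2: "1 \<le> \<sigma>" "\<sigma> \<le> 2" using s by (auto simp: \<delta>_def)
    have "norm (\<Sum>n=1..N. f n * nps \<sigma> t n) \<le> \<epsilon> / (\<sigma> - 1)" for N
    proof -
      have "norm (\<Sum>n=1..N. f n * nps \<sigma> t n) \<le> norm (\<Sum>n=1..N. partial_sum n * (nps \<sigma> t n - nps \<sigma> t (Suc n))) + norm (partial_sum N * nps \<sigma> t (Suc N))"
        unfolding sum_by_parts[of "nps \<sigma> t"] by (rule norm_triangle_ineq)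
      also have "norm (partial_sum N * nps \<sigma> t (Suc N)) \<le> 1"
      proof -
        have "norm (partial_sum N * nps \<sigma> t (Suc N)) \<le> real N * real (Suc N) powr (-\<sigma>)"
          by (simp add: norm_mult norm_S_le mult_right_mono)
        also have "\<dots> \<le> real (Suc N) * real (Suc N) powr (-1)"
          using s2 by (intro mult_mono powr_mono) auto
        also have "\<dots> = 1" by (simp add: powr_minus)
        finally show ?thesis .
      qed
      also have "norm (\<Sum>n=1..N. partial_sum n * (nps \<sigma> t n - nps \<sigma> t (Suc n))) \<le> (\<Sum>n=1..N. C * (\<eta> * real n powr (-\<sigma>) + real N0 * real n powr (-(\<sigma>+1))))"
      proof (rule order_trans[OF norm_sum], rule sum_mono)
        fix n assume n: "n \<in> {1..N}"
        have "norm (partial_sum n * (nps \<sigma> t n - nps \<sigma> t (Suc n))) \<le> (\<eta> * real n + real N0) * (C * real n powr (- \<sigma> - 1))"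
          unfolding norm_mult C_def using n eta by (intro mult_mono Sn norm_nps_diff_le s2) auto
        also have "\<dots> = C * (\<eta> * (real n * real n powr (- \<sigma> - 1)) + real N0 * real n powr (-(\<sigma>+1)))"
        proof -
          have p: "real n powr (-(\<sigma>+1)) = real n powr (- \<sigma> - 1)"
            by (rule arg_cong[of _ _ "\<lambda>x. real n powr x"]) simp
          show ?thesis unfolding p by (simp add: algebra_simps)
        qed
        also have "real n * real n powr (- \<sigma> - 1) = real n powr (-\<sigma>)" using n by (simp add: powr_diff)
        finally show "norm (partial_sum n * (nps \<sigma> t n - nps \<sigma> t (Suc n))) \<le> C * (\<eta> * real n powr (-\<sigma>) + real N0 * real n powr (-(\<sigma>+1)))" .
      qed
      also have "\<dots> = C * (\<eta> * (\<Sum>n=1..N. real n powr (-\<sigma>)) + real N0 * (\<Sum>n=1..N. real n powr (-(\<sigma>+1))))"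
        by (simp only: sum_distrib_left sum.distrib distrib_left)
      also have "\<dots> \<le> C * (\<eta> * (2 / (\<sigma> - 1)) + real N0 * 2)"
      proof -
        have "(\<Sum>n=1..N. real n powr (-\<sigma>)) \<le> \<sigma> / (\<sigma> - 1)" by (rule sum_powr_le[OF s(1)])
        also have "\<dots> \<le> 2 / (\<sigma> - 1)" using s s2 by (intro divide_right_mono) auto
        finally have "(\<Sum>n=1..N. real n powr (-\<sigma>)) \<le> 2 / (\<sigma> - 1)" .
        moreover have "(\<Sum>n=1..N. real n powr (-(\<sigma>+1))) \<le> (\<sigma> + 1) / (\<sigma> + 1 - 1)" using s by (intro sum_powr_le) auto
        moreover have "(\<sigma> + 1) / (\<sigma> + 1 - 1) \<le> 2" using s by (simp add: field_simps)
        ultimately show ?thesis using C eta by (intro mult_left_mono add_mono) auto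
      qed
      also have "\<dots> + 1 = (\<epsilon> / 2) / (\<sigma> - 1) + D" using C by (simp add: \<eta>_def D_def distrib_left)
      also have "D \<le> (\<epsilon> / 2) / (\<sigma> - 1)"
      proof -
        have "\<sigma> - 1 \<le> \<epsilon> / (2 * D)" using s by (simp add: \<delta>_def)
        then show ?thesis using s D e by (simp add: field_simps)
      qed
      also have "(\<epsilon> / 2) / (\<sigma> - 1) + (\<epsilon> / 2) / (\<sigma> - 1) = \<epsilon> / (\<sigma> - 1)"
        by (metis add_divide_distrib field_sum_of_halves)
      finally show ?thesis by simp
    qed
    then show ?thesis
      by (intro LIMSEQ_le_const2[OF tendsto_norm[OF LIMSEQ_sum_Icc]] summable_norm_cancel[OF summable_norm_term] s(1)) auto
  qed
  with d show ?thesis by blast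
qed

text \<open>A vanishing mean bounds the series at every height \<open>t\<close>, so it contradicts
  the lower bound at the height where \<open>f\<close> is pretentious, without twisting
  \<open>f\<close> first.\<close>

lemma mean_value_nonzero:
  assumes conv: "\<And>Q. finite Q \<Longrightarrow> (\<forall>q\<in>Q. prime q) \<Longrightarrow> (\<Sum>p\<in>Q. defect t p / real p) \<le> B"
    and two: "\<exists>k\<ge>1. coef t 2 k \<noteq> -1"
  shows "\<not> (\<lambda>N. partial_sum N / of_nat N) \<longlonglongrightarrow> 0"
proof
  assume lim: "(\<lambda>N. partial_sum N / of_nat N) \<longlonglongrightarrow> 0"
  obtain c \<delta> where c: "c > 0" "\<delta> > 0" and lo: "\<And>\<sigma>. 1 < \<sigma> \<Longrightarrow> \<sigma> < 1 + \<delta> \<Longrightarrow> norm (\<Sum>n. f n * nps \<sigma> t n) \<ge> c / (\<sigma> - 1)"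
    using series_lower[OF conv two] by metis
  have "c / 2 > 0" using c by simp
  then obtain \<delta>' where d': "\<delta>' > 0" and up: "\<And>\<sigma>. 1 < \<sigma> \<Longrightarrow> \<sigma> < 1 + \<delta>' \<Longrightarrow> norm (\<Sum>n. f n * nps \<sigma> t n) \<le> (c / 2) / (\<sigma> - 1)"
    using series_small_of_mean_zero[OF lim] by metis
  define \<sigma> where "\<sigma> = 1 + min \<delta> \<delta>' / 2"
  have s: "1 < \<sigma>" "\<sigma> < 1 + \<delta>" "\<sigma> < 1 + \<delta>'" using c d' by (auto simp: \<sigma>_def)
  have "c / (\<sigma> - 1) \<le> (c / 2) / (\<sigma> - 1)" using lo[OF s(1,2)] up[OF s(1,3)] by linarith
  then show False using c s by (simp add: field_simps)
qed

end

section \<open>Weyl's criterion\<close>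

text \<open>Formulated with real scaling so that complex characters and real indicator functions
  share one notion.\<close>

definition has_mean :: "(nat \<Rightarrow> 'a::real_normed_vector) \<Rightarrow> 'a \<Rightarrow> bool" where
  "has_mean a m \<longleftrightarrow> (\<lambda>N. (\<Sum>k=1..N. a k) /\<^sub>R real N) \<longlonglongrightarrow> m"

lemma has_mean_const: "has_mean (\<lambda>_. c) c"
  unfolding has_mean_def
proof (rule tendsto_eventually)
  show "\<forall>\<^sub>F N in sequentially. (\<Sum>k=1..N. c) /\<^sub>R real N = c"
    using eventually_gt_at_top[of 0] by eventually_elim (simp add: sum_constant_scaleR)
qed

lemma has_mean_add: "has_mean a m \<Longrightarrow> has_mean b n \<Longrightarrow> has_mean (\<lambda>k. a k + b k) (m + n)"
  unfolding has_mean_def sum.distrib scaleR_right_distrib by (rule tendsto_add)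

lemma has_mean_bounded_linear:
  assumes "bounded_linear T" "has_mean a m"
  shows "has_mean (\<lambda>k. T (a k)) (T m)"
proof -
  interpret bounded_linear T by fact
  show ?thesis using tendsto[OF assms(2)[unfolded has_mean_def]] by (simp add: has_mean_def sum scaleR)
qed

lemma has_mean_sum:
  "finite I \<Longrightarrow> (\<And>i. i \<in> I \<Longrightarrow> has_mean (a i) (m i)) \<Longrightarrow> has_mean (\<lambda>k. \<Sum>i\<in>I. a i k) (\<Sum>i\<in>I. m i)"
  by (induction I rule: finite_induct) (auto intro: has_mean_add simp: has_mean_const)

lemma has_mean_approx:
  fixes a :: "nat \<Rightarrow> 'a::real_normed_vector"
  assumes "\<And>e. e > 0 \<Longrightarrow> \<exists>b m'. has_mean b m' \<and> (\<forall>k. norm (a k - b k) \<le> e) \<and> norm (m' - m) \<le> e"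
  shows "has_mean a m"
  unfolding has_mean_def
proof (rule tendstoI)
  fix e :: real assume e: "e > 0"
  then have e4: "e / 4 > 0" by simp
  obtain b m' where b: "has_mean b m'" "\<And>k. norm (a k - b k) \<le> e / 4" "norm (m' - m) \<le> e / 4"
    using assms[OF e4] by blast
  have "\<forall>\<^sub>F N in sequentially. dist ((\<Sum>k=1..N. b k) /\<^sub>R real N) m' < e / 4"
    using b(1) e4 unfolding has_mean_def by (rule tendstoD)
  then show "\<forall>\<^sub>F N in sequentially. dist ((\<Sum>k=1..N. a k) /\<^sub>R real N) m < e"
    using eventually_gt_at_top[of 0]
  proof eventually_elim
    case (elim N)
    have "norm ((\<Sum>k=1..N. a k) /\<^sub>R real N - (\<Sum>k=1..N. b k) /\<^sub>R real N) = norm (\<Sum>k=1..N. a k - b k) / real N"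
      by (simp add: sum_subtractf divide_inverse mult.commute flip: scaleR_right_diff_distrib)
    also have "\<dots> \<le> (\<Sum>k=1..N. e / 4) / real N"
      using b(2) by (intro divide_right_mono order_trans[OF norm_sum] sum_mono) auto
    also have "\<dots> = e / 4" using elim by simp
    finally have 1: "dist ((\<Sum>k=1..N. a k) /\<^sub>R real N) ((\<Sum>k=1..N. b k) /\<^sub>R real N) \<le> e / 4"
      by (simp add: dist_norm)
    have 3: "dist m' m \<le> e / 4" using b(3) by (simp add: dist_norm)
    have "dist ((\<Sum>k=1..N. a k) /\<^sub>R real N) m \<le> dist ((\<Sum>k=1..N. a k) /\<^sub>R real N) ((\<Sum>k=1..N. b k) /\<^sub>R real N)
       + (dist ((\<Sum>k=1..N. b k) /\<^sub>R real N) m' + dist m' m)"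
      by (meson add_left_mono dist_triangle order_trans)
    with 1 3 elim(1) e show ?case by linarith
  qed
qed

lemma has_mean_squeeze:
  fixes a :: "nat \<Rightarrow> real"
  assumes "\<And>e. e > 0 \<Longrightarrow> \<exists>b c m1 m2. has_mean b m1 \<and> has_mean c m2 \<and> (\<forall>k. b k \<le> a k \<and> a k \<le> c k) \<and> m1 \<ge> m - e \<and> m2 \<le> m + e"
  shows "has_mean a m"
  unfolding has_mean_def
proof (rule tendstoI)
  fix e :: real assume e: "e > 0"
  then have e2: "e / 2 > 0" by simp
  obtain b c m1 m2 where bc: "has_mean b m1" "has_mean c m2" "\<And>k. b k \<le> a k" "\<And>k. a k \<le> c k" "m1 \<ge> m - e / 2" "m2 \<le> m + e / 2"
    using assms[OF e2] by blast
  have "\<forall>\<^sub>F N in sequentially. dist ((\<Sum>k=1..N. b k) /\<^sub>R real N) m1 < e / 2"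
    using bc(1) e2 unfolding has_mean_def by (rule tendstoD)
  moreover have "\<forall>\<^sub>F N in sequentially. dist ((\<Sum>k=1..N. c k) /\<^sub>R real N) m2 < e / 2"
    using bc(2) e2 unfolding has_mean_def by (rule tendstoD)
  ultimately show "\<forall>\<^sub>F N in sequentially. dist ((\<Sum>k=1..N. a k) /\<^sub>R real N) m < e"
  proof eventually_elim
    case (elim N)
    have "(\<Sum>k=1..N. b k) /\<^sub>R real N \<le> (\<Sum>k=1..N. a k) /\<^sub>R real N" "(\<Sum>k=1..N. a k) /\<^sub>R real N \<le> (\<Sum>k=1..N. c k) /\<^sub>R real N"
      by (rule scaleR_left_mono[OF sum_mono[OF bc(3)]], simp) (rule scaleR_left_mono[OF sum_mono[OF bc(4)]], simp)
    with elim bc(5,6) show ?case unfolding dist_real_def by linarith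
  qed
qed

lemma has_integral_cis:
  assumes c: "c \<noteq> 0" and ab: "a \<le> b"
  shows "((\<lambda>t. cis (c * t)) has_integral (cis (c * b) / (\<i> * of_real c) - cis (c * a) / (\<i> * of_real c))) {a..b}"
proof (rule fundamental_theorem_of_calculus[OF ab])
  fix x :: real assume "x \<in> {a..b}"
  have "((\<lambda>t. cis (c * t)) has_vector_derivative (\<i> * of_real c) * cis (c * x)) (at x within {a..b})"
  proof -
    have "((\<lambda>z. exp (\<i> * of_real c * z)) has_field_derivative (\<i> * of_real c) * exp (\<i> * of_real c * of_real x)) (at (of_real x))"
      by (auto intro!: derivative_eq_intros)
    from has_vector_derivative_real_field[OF this] show ?thesis by (simp add: cis_conv_exp mult_ac)
  qed
  then have "((\<lambda>t. cis (c * t) / (\<i> * of_real c)) has_vector_derivative ((\<i> * of_real c) * cis (c * x)) / (\<i> * of_real c)) (at x within {a..b})"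
    by (rule has_vector_derivative_divide)
  then show "((\<lambda>t. cis (c * t) / (\<i> * of_real c)) has_vector_derivative cis (c * x)) (at x within {a..b})"
    using c by simp
qed


lemma integral_cis_multiple:
  fixes l :: int
  shows "((\<lambda>x. cis (2 * pi * of_int l * x)) has_integral (if l = 0 then 1 else 0)) {0..1}"
proof (cases "l = 0")
  case True
  then show ?thesis using has_integral_const_real[of "1::complex" 0 1] by simp
next
  case False
  define c where "c = 2 * pi * of_int l"
  have c: "c \<noteq> 0" using False by (simp add: c_def)
  have "((\<lambda>x. cis (c * x)) has_integral (cis (c * 1) / (\<i> * of_real c) - cis (c * 0) / (\<i> * of_real c))) {0..1}"
    by (rule has_integral_cis[OF c]) simp
  moreover have "cis (c * 1) = 1" unfolding c_def using cis_multiple_2pi[of "of_int l"] by simp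
  ultimately show ?thesis using False by (simp add: c_def)
qed

section \<open>Test functions on the circle\<close>

context
  fixes x :: "nat \<Rightarrow> real"
  assumes weyl: "\<And>l::int. l \<noteq> 0 \<Longrightarrow> has_mean (\<lambda>k. cis (2 * pi * of_int l * x k)) 0"
begin

text \<open>Test functions live on the unit circle rather than being periodic on the line, so that
  Stone-Weierstrass on a compact set applies.\<close>

definition good :: "(complex \<Rightarrow> complex) \<Rightarrow> bool" where
  "good g \<longleftrightarrow> (\<exists>m. has_mean (\<lambda>k. g (cis (2 * pi * x k))) m \<and> ((\<lambda>t. g (cis (2 * pi * t))) has_integral m) {0..1})"

definition trig :: "(complex \<Rightarrow> complex) \<Rightarrow> bool" where
  "trig g \<longleftrightarrow> (\<exists>I c. finite I \<and> (\<forall>t. g (cis t) = (\<Sum>l\<in>I. c l * cis (of_int l * t))))"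

lemma trig_good:
  assumes "trig g" shows "good g"
proof -
  obtain I c where I: "finite I" and g: "\<And>t. g (cis t) = (\<Sum>l\<in>I. c l * cis (of_int l * t))"
    using assms unfolding trig_def by blast
  have cm: "cis (of_int l * (2 * pi * y)) = cis (2 * pi * of_int l * y)" for l :: int and y by (simp add: mult_ac)
  let ?m = "\<lambda>l::int. if l = 0 then 1 else 0 :: complex"
  have "has_mean (\<lambda>k. cis (2 * pi * of_int l * x k)) (?m l)" for l
    using weyl[of l] has_mean_const[of "1::complex"] by (cases "l = 0") auto
  then have "has_mean (\<lambda>k. \<Sum>l\<in>I. c l * cis (2 * pi * of_int l * x k)) (\<Sum>l\<in>I. c l * ?m l)"
    by (intro has_mean_sum I has_mean_bounded_linear[OF bounded_linear_mult_right])
  moreover have "((\<lambda>t. \<Sum>l\<in>I. c l * cis (2 * pi * of_int l * t)) has_integral (\<Sum>l\<in>I. c l * ?m l)) {0..1}"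
    by (intro has_integral_sum I has_integral_mult_right integral_cis_multiple)
  ultimately show ?thesis unfolding good_def g cm by blast
qed

lemma trig_const: "trig (\<lambda>_. c)"
  unfolding trig_def by (rule exI[of _ "{0}"], rule exI[of _ "\<lambda>_. c"]) simp

lemma trig_monom: "trig (\<lambda>z. c * z)" "trig (\<lambda>z. c * cnj z)"
  unfolding trig_def
  by (rule exI[of _ "{1}"], rule exI[of _ "\<lambda>_. c"], simp) (rule exI[of _ "{-1}"], rule exI[of _ "\<lambda>_. c"], simp add: cis_cnj)

lemma trig_add:
  assumes "trig g" "trig h" shows "trig (\<lambda>z. g z + h z)"
proof -
  obtain I c where I: "finite I" and g: "\<And>t. g (cis t) = (\<Sum>l\<in>I. c l * cis (of_int l * t))"
    using assms(1) unfolding trig_def by blast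
  obtain J d where J: "finite J" and h: "\<And>t. h (cis t) = (\<Sum>l\<in>J. d l * cis (of_int l * t))"
    using assms(2) unfolding trig_def by blast
  have "g (cis t) + h (cis t) = (\<Sum>l\<in>I \<union> J. ((if l \<in> I then c l else 0) + (if l \<in> J then d l else 0)) * cis (of_int l * t))" for t
  proof -
    have "g (cis t) = (\<Sum>l\<in>I \<union> J. (if l \<in> I then c l else 0) * cis (of_int l * t))"
      unfolding g using I J by (intro sum.mono_neutral_cong_left) auto
    moreover have "h (cis t) = (\<Sum>l\<in>I \<union> J. (if l \<in> J then d l else 0) * cis (of_int l * t))"
      unfolding h using I J by (intro sum.mono_neutral_cong_left) auto
    ultimately show ?thesis by (simp only: sum.distrib distrib_right)
  qed
  then show ?thesis unfolding trig_def using I J by (intro exI[of _ "I \<union> J"] exI) auto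
qed

lemma trig_sum: "finite I \<Longrightarrow> (\<And>i. i \<in> I \<Longrightarrow> trig (g i)) \<Longrightarrow> trig (\<lambda>z. \<Sum>i\<in>I. g i z)"
  by (induction I rule: finite_induct) (auto intro: trig_add simp: trig_const)

lemma trig_mult:
  assumes "trig g" "trig h" shows "trig (\<lambda>z. g z * h z)"
proof -
  obtain I c where I: "finite I" and g: "\<And>t. g (cis t) = (\<Sum>l\<in>I. c l * cis (of_int l * t))"
    using assms(1) unfolding trig_def by blast
  obtain J d where J: "finite J" and h: "\<And>t. h (cis t) = (\<Sum>l\<in>J. d l * cis (of_int l * t))"
    using assms(2) unfolding trig_def by blast
  have mono: "trig (\<lambda>z. e * (z powi l))" for e l
    unfolding trig_def by (rule exI[of _ "{l}"], rule exI[of _ "\<lambda>_. e"]) (simp add: cis_power_int)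
  have "trig (\<lambda>z. \<Sum>i\<in>I. \<Sum>j\<in>J. (c i * d j) * (z powi (i + j)))"
    by (intro trig_sum I J mono)
  moreover have "g (cis t) * h (cis t) = (\<Sum>i\<in>I. \<Sum>j\<in>J. (c i * d j) * ((cis t) powi (i + j)))" for t
    unfolding g h sum_product by (intro sum.cong refl) (simp add: cis_power_int distrib_right flip: cis_mult)
  ultimately show ?thesis unfolding trig_def by simp
qed

text \<open>A real-linear form on the plane is a combination of \<open>z\<close> and
  \<open>cnj z\<close>, which are the frequencies 1 and -1 on the circle; trigonometric polynomials
  are closed under sums and products.\<close>

lemma trig_real_polynomial:
  fixes p :: "complex \<Rightarrow> real"
  assumes "real_polynomial_function p"
  shows "trig (\<lambda>z. complex_of_real (p z))"
  using assms
proof (induction p rule: real_polynomial_function.induct)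
  case (linear p)
  interpret bounded_linear p by fact
  define u v where "u = p 1" and "v = p \<i>"
  have p: "complex_of_real (p z) = ((u - \<i> * v) / 2) * z + ((u + \<i> * v) / 2) * cnj z" for z
  proof -
    have "p z = p (Re z *\<^sub>R 1 + Im z *\<^sub>R \<i>)" by (rule arg_cong[of _ _ p]) (simp add: complex_eq_iff)
    also have "\<dots> = Re z * u + Im z * v" by (simp only: add scaleR u_def v_def real_scaleR_def)
    finally have "p z = Re z * u + Im z * v" .
    then show ?thesis by (simp add: complex_eq_iff field_simps)
  qed
  show ?case unfolding p by (intro trig_add trig_monom)
next
  case (const c)
  show ?case by (rule trig_const)
next
  case (add f g)
  then show ?case using trig_add by simp
next
  case (mult f g)
  then show ?case using trig_mult by simp
qed

text \<open>Uniform approximation by polynomials, by Stone-Weierstrass, moves the mean and the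
  integral by at most the same error.\<close>

lemma mean_continuous:
  fixes g :: "complex \<Rightarrow> real"
  assumes cont: "continuous_on (sphere 0 1) g"
  shows "has_mean (\<lambda>k. g (cis (2 * pi * x k))) (integral {0..1} (\<lambda>t. g (cis (2 * pi * t))))"
proof (rule has_mean_approx)
  fix e :: real assume e: "e > 0"
  obtain p where p: "real_polynomial_function p" and ap: "\<And>z. z \<in> sphere 0 1 \<Longrightarrow> \<bar>g z - p z\<bar> < e"
    using Stone_Weierstrass_real_polynomial_function[OF compact_sphere cont e] by blast
  have "good (\<lambda>z. complex_of_real (p z))" by (rule trig_good[OF trig_real_polynomial[OF p]])
  then obtain m where m: "has_mean (\<lambda>k. complex_of_real (p (cis (2 * pi * x k)))) m"
    "((\<lambda>t. complex_of_real (p (cis (2 * pi * t)))) has_integral m) {0..1}"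
    unfolding good_def by blast
  have m1: "has_mean (\<lambda>k. p (cis (2 * pi * x k))) (Re m)"
    using has_mean_bounded_linear[OF bounded_linear_Re m(1)] by simp
  have m2: "((\<lambda>t. p (cis (2 * pi * t))) has_integral (Re m)) {0..1}"
    using has_integral_linear[OF m(2) bounded_linear_Re] by (simp add: o_def)
  have ig: "(\<lambda>t. g (cis (2 * pi * t))) integrable_on {0..1}"
    by (intro integrable_continuous_interval continuous_on_compose2[OF cont] continuous_intros) auto
  have "norm (integral {0..1} (\<lambda>t. p (cis (2 * pi * t)) - g (cis (2 * pi * t)))) \<le> e * (1 - 0)"
  proof (rule integral_bound)
    show "continuous_on {0..1} (\<lambda>t. p (cis (2 * pi * t)) - g (cis (2 * pi * t)))"
    proof -
      have cp: "continuous_on UNIV p"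
        using continuous_real_polymonial_function[OF p] by (simp add: continuous_at_imp_continuous_on)
      show ?thesis
        by (intro continuous_intros continuous_on_compose2[OF cont] continuous_on_compose2[OF cp]) auto
    qed
    show "norm (p (cis (2 * pi * t)) - g (cis (2 * pi * t))) \<le> e" if "t \<in> {0..1}" for t
      using ap[of "cis (2 * pi * t)"] by (simp add: abs_minus_commute)
  qed auto
  then have "norm (Re m - integral {0..1} (\<lambda>t. g (cis (2 * pi * t)))) \<le> e"
    using m2 ig by (subst (asm) integral_diff) (auto simp: has_integral_iff)
  moreover have "norm (g (cis (2 * pi * x k)) - p (cis (2 * pi * x k))) \<le> e" for k
    using ap[of "cis (2 * pi * x k)"] by simp
  ultimately show "\<exists>b m'. has_mean b m' \<and> (\<forall>k. norm (g (cis (2 * pi * x k)) - b k) \<le> e) \<and>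
      norm (m' - integral {0..1} (\<lambda>t. g (cis (2 * pi * t)))) \<le> e"
    using m1 by blast
qed

text \<open>The continuous functions \<open>g n\<close> lie above the indicator of \<open>C\<close>
  and converge to it because \<open>C\<close> is closed; dominated convergence makes their integrals
  approach \<open>V\<close>. Lower bounds are obtained later by passing to the complementary
  arc.\<close>

lemma closed_arc_upper:
  assumes C: "closed C" "C \<noteq> {}" and e: "e > 0"
    and V: "((\<lambda>t. indicator C (cis (2 * pi * t))) has_integral V) {0..1}"
  shows "\<exists>c m. has_mean c m \<and> (\<forall>k. indicator C (cis (2 * pi * x k)) \<le> c k) \<and> m \<le> V + (e::real)"
proof -
  define g where "g = (\<lambda>(n::nat) z. max 0 (1 - real n * infdist z C))"
  have cg: "continuous_on A (g n)" for n A
    unfolding g_def by (intro continuous_intros continuous_on_infdist)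
  have lim: "(\<lambda>n. g n z) \<longlonglongrightarrow> indicator C z" for z
  proof (cases "z \<in> C")
    case True
    then show ?thesis by (simp add: g_def)
  next
    case False
    then have pos: "infdist z C > 0" using C in_closed_iff_infdist_zero[of C z] infdist_nonneg[of z C] by auto
    obtain N where N: "real N > 1 / infdist z C" using reals_Archimedean2 by blast
    have "\<forall>\<^sub>F n in sequentially. g n z = 0"
      using eventually_ge_at_top[of N]
    proof eventually_elim
      case (elim n)
      then have "1 / infdist z C < real n" using N by linarith
      then have "1 < real n * infdist z C" using pos by (simp add: pos_divide_less_eq)
      then show ?case by (simp add: g_def)
    qed
    then show ?thesis using False by (simp add: tendsto_eventually)
  qed
  have "(\<lambda>n. integral {0..1} (\<lambda>t. g n (cis (2 * pi * t)))) \<longlonglongrightarrow> integral {0..1} (\<lambda>t. indicator C (cis (2 * pi * t)))"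
  proof (rule dominated_convergence(2)[where h = "\<lambda>_. 1"])
    show "(\<lambda>t. g n (cis (2 * pi * t))) integrable_on {0..1}" for n
      by (intro integrable_continuous_interval continuous_on_compose2[OF cg[of UNIV]] continuous_intros) auto
  qed (use lim in \<open>auto simp: g_def infdist_nonneg\<close>)
  then have "(\<lambda>n. integral {0..1} (\<lambda>t. g n (cis (2 * pi * t)))) \<longlonglongrightarrow> V" using V by (simp add: has_integral_iff)
  then obtain n where n: "\<bar>integral {0..1} (\<lambda>t. g n (cis (2 * pi * t))) - V\<bar> < e"
    using LIMSEQ_D[OF _ e] by fastforce
  have "has_mean (\<lambda>k. g n (cis (2 * pi * x k))) (integral {0..1} (\<lambda>t. g n (cis (2 * pi * t))))"
    by (rule mean_continuous[OF cg])
  moreover have "indicator C (cis (2 * pi * x k)) \<le> g n (cis (2 * pi * x k))" for k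
    by (auto simp: g_def indicator_def)
  ultimately show ?thesis using n by (intro exI conjI) auto
qed

end

section \<open>Equidistribution in intervals and back\<close>

text \<open>\<open>s\<close> is kept away from 0 and 1, which are the same point of the
  circle.\<close>

lemma cis_2pi_inj:
  assumes "cis (2 * pi * s) = cis (2 * pi * t)" "0 < s" "s < 1" "0 \<le> t" "t \<le> 1"
  shows "s = t"
proof -
  have "sin (2 * pi * s) = sin (2 * pi * t) \<and> cos (2 * pi * s) = cos (2 * pi * t)"
    using assms(1) by (metis cis.sel)
  then obtain n :: int where "2 * pi * s = 2 * pi * t + 2 * pi * of_int n"
    unfolding sin_cos_eq_iff by auto
  then have "2 * pi * s = 2 * pi * (t + of_int n)" by (simp add: algebra_simps)
  then have n: "s = t + of_int n" by simp
  then have "of_int n < (1::real)" "of_int n > (-1::real)" using assms by auto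
  then have "n = 0" by linarith
  with n show ?thesis by simp
qed

lemma cis_2pi_mem_image:
  assumes "T \<subseteq> {0..1}" "0 < s" "s < 1"
  shows "cis (2 * pi * s) \<in> (\<lambda>t. cis (2 * pi * t)) ` T \<longleftrightarrow> s \<in> T"
proof
  assume "cis (2 * pi * s) \<in> (\<lambda>t. cis (2 * pi * t)) ` T"
  then obtain t where t: "cis (2 * pi * s) = cis (2 * pi * t)" "t \<in> T" by auto
  then have "s = t" using assms by (intro cis_2pi_inj) auto
  with t show "s \<in> T" by simp
qed auto

lemma cis_frac: "cis (2 * pi * frac y) = cis (2 * pi * y)"
proof -
  have "2 * pi * y = 2 * pi * frac y + 2 * pi * of_int \<lfloor>y\<rfloor>" by (simp add: frac_def algebra_simps)
  then have "cis (2 * pi * y) = cis (2 * pi * frac y) * cis (2 * pi * of_int \<lfloor>y\<rfloor>)" by (simp only: cis_mult)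
  then show ?thesis using cis_multiple_2pi[of "of_int \<lfloor>y\<rfloor>"] by simp
qed

text \<open>The closed arc \<open>C1\<close> bounds the indicator from above, and 1 minus the bound
  for the complementary closed arc \<open>C2\<close> bounds it from below. The arcs share their
  endpoints, and 0 and 1 coincide on the circle, which affects the integrals at finitely many points
  only.\<close>

lemma equidistributed_if_weyl:
  assumes weyl: "\<And>l::int. l \<noteq> 0 \<Longrightarrow> has_mean (\<lambda>k. cis (2 * pi * of_int l * x k)) 0"
    and ab: "0 \<le> a" "a < b" "b \<le> 1"
  shows "has_mean (\<lambda>k. of_bool (a \<le> frac (x k) \<and> frac (x k) < b)) (b - a)"
proof (rule has_mean_squeeze)
  fix e :: real assume e: "e > 0"
  let ?c = "\<lambda>t. cis (2 * pi * t)"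
  define C1 where "C1 = ?c ` {a..b}"
  define C2 where "C2 = ?c ` ({0..a} \<union> {b..1})"
  have cl: "closed C1" "closed C2" unfolding C1_def C2_def
    by (intro compact_imp_closed compact_continuous_image continuous_intros compact_Un compact_Icc)+
  have ne: "C1 \<noteq> {}" "C2 \<noteq> {}" using ab by (auto simp: C1_def C2_def)
  have i0: "((\<lambda>t. if t \<in> {a..b} then 1 else 0 :: real) has_integral (b - a)) {0..1}"
    using has_integral_restrict_closed_subinterval[of "\<lambda>_. 1::real" "b - a" a b 0 1] has_integral_const_real[of "1::real" a b] ab by simp
  have i1: "((\<lambda>t. indicator C1 (?c t)) has_integral (b - a)) {0..1}"
  proof (rule has_integral_spike_finite[OF _ _ i0])
    show "indicator C1 (?c t) = (if t \<in> {a..b} then 1 else 0 :: real)" if "t \<in> {0..1} - {0, 1}" for t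
      using that ab cis_2pi_mem_image[of "{a..b}" t] by (auto simp: C1_def indicator_def)
  qed simp
  have "((\<lambda>t. 1 - (if t \<in> {a..b} then 1 else 0 :: real)) has_integral (1 - (b - a))) {0..1}"
    using has_integral_diff[OF has_integral_const_real[of "1::real" 0 1] i0] by simp
  then have i2: "((\<lambda>t. indicator C2 (?c t)) has_integral (1 - (b - a))) {0..1}"
  proof (rule has_integral_spike_finite[rotated 2])
    show "indicator C2 (?c t) = 1 - (if t \<in> {a..b} then 1 else 0 :: real)" if "t \<in> {0..1} - {0, 1, a, b}" for t
      using that ab cis_2pi_mem_image[of "{0..a} \<union> {b..1}" t] by (auto simp: C2_def indicator_def)
  qed simp
  obtain c1 m1 where c1: "has_mean c1 m1" "\<And>k. indicator C1 (?c (x k)) \<le> c1 k" "m1 \<le> (b - a) + e"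
    using closed_arc_upper[OF weyl cl(1) ne(1) e i1] by auto
  obtain c2 m2 where c2: "has_mean c2 m2" "\<And>k. indicator C2 (?c (x k)) \<le> c2 k" "m2 \<le> (1 - (b - a)) + e"
    using closed_arc_upper[OF weyl cl(2) ne(2) e i2] by auto
  have fr: "0 \<le> frac y" "frac y < 1" for y :: real by (auto simp: frac_lt_1)
  have u: "of_bool (a \<le> frac (x k) \<and> frac (x k) < b) \<le> c1 k" for k
  proof -
    have "of_bool (a \<le> frac (x k) \<and> frac (x k) < b) \<le> (indicator C1 (?c (frac (x k))) :: real)"
      by (auto simp: C1_def indicator_def)
    then show ?thesis using c1(2)[of k] by (simp add: cis_frac)
  qed
  have l: "1 - c2 k \<le> of_bool (a \<le> frac (x k) \<and> frac (x k) < b)" for k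
  proof -
    have "1 - indicator C2 (?c (frac (x k))) \<le> (of_bool (a \<le> frac (x k) \<and> frac (x k) < b) :: real)"
      using fr[of "x k"] by (auto simp: C2_def indicator_def)
    then show ?thesis using c2(2)[of k] by (simp add: cis_frac)
  qed
  have "has_mean (\<lambda>k. 1 + (- 1) * c2 k) (1 + (- 1) * m2)"
    by (intro has_mean_add has_mean_const has_mean_bounded_linear[OF bounded_linear_mult_right] c2)
  then have "has_mean (\<lambda>k. 1 - c2 k) (1 - m2)" by simp
  with c1 c2 u l show "\<exists>b' c m1 m2. has_mean b' m1 \<and> has_mean c m2 \<and> (\<forall>k. b' k \<le> of_bool (a \<le> frac (x k) \<and> frac (x k) < b) \<and> of_bool (a \<le> frac (x k) \<and> frac (x k) < b) \<le> c k) \<and> m1 \<ge> (b - a) - e \<and> m2 \<le> (b - a) + e"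
    by (intro exI[of _ "\<lambda>k. 1 - c2 k"] exI[of _ c1] exI[of _ "1 - m2"] exI[of _ m1]) auto
qed

text \<open>Equidistribution is assumed only for the cells of one fine partition at a time, because
  digit strings supply no other intervals. A character is within \<open>e\<close> of a step function
  on the cells, and the mean of that step function is a Riemann sum for the integral over whole
  periods, which is 0.\<close>

lemma weyl_if_equidistributed_steps:
  fixes x :: "nat \<Rightarrow> real" and l :: int
  assumes steps: "\<And>e. e > 0 \<Longrightarrow> \<exists>n a. a 0 = 0 \<and> a n = 1 \<and> (\<forall>j<n. a j \<le> a (Suc j) \<and> a (Suc j) - a j \<le> e \<and>
      has_mean (\<lambda>k. of_bool (a j \<le> frac (x k) \<and> frac (x k) < a (Suc j))) (a (Suc j) - a j :: real))"
    and l: "l \<noteq> 0"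
  shows "has_mean (\<lambda>k. cis (2 * pi * of_int l * x k)) 0"
proof (rule has_mean_approx)
  fix e :: real assume e: "e > 0"
  define c where "c = 2 * pi * of_int l"
  have c: "c \<noteq> 0" "\<bar>c\<bar> > 0" using l by (auto simp: c_def)
  have "e / \<bar>c\<bar> > 0" using c e by simp
  from steps[OF this] obtain n a where a: "a 0 = 0" "a n = 1" and st: "\<And>j. j < n \<Longrightarrow> a j \<le> a (Suc j)" "\<And>j. j < n \<Longrightarrow> a (Suc j) - a j \<le> e / \<bar>c\<bar>"
     and hm: "\<And>j. j < n \<Longrightarrow> has_mean (\<lambda>k. of_bool (a j \<le> frac (x k) \<and> frac (x k) < a (Suc j))) (a (Suc j) - a j :: real)"
    by blast
  let ?I = "\<lambda>j y. of_bool (a j \<le> frac y \<and> frac y < a (Suc j)) :: real"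
  define b where "b = (\<lambda>k. \<Sum>j<n. ?I j (x k) *\<^sub>R cis (c * a j))"
  define m' where "m' = (\<Sum>j<n. (a (Suc j) - a j) *\<^sub>R cis (c * a j))"
  have mb: "has_mean b m'"
    unfolding b_def m'_def by (intro has_mean_sum has_mean_bounded_linear[OF bounded_linear_scaleR_left] hm) auto
  have mono: "i \<le> j \<Longrightarrow> j \<le> n \<Longrightarrow> a i \<le> a j" for i j
  proof (induction j rule: dec_induct)
    case (step j)
    then show ?case using st(1)[of j] by simp
  qed simp
  have "norm (cis (c * x k) - b k) \<le> e" for k
  proof -
    define y where "y = frac (x k)"
    have y: "0 \<le> y" "y < 1" by (auto simp: y_def frac_lt_1)
    \<comment> \<open>The first mesh point beyond \<open>y\<close>; the cell of \<open>y\<close>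
      ends there.\<close>
    define i where "i = (LEAST j. y < a j)"
    have ex: "y < a n" using y a by simp
    have yi: "y < a i" unfolding i_def by (rule LeastI[of _ n]) (rule ex)
    have "i \<le> n" unfolding i_def by (rule Least_le) (rule ex)
    have "i \<noteq> 0" using yi a y by (metis not_less)
    then obtain j where j: "i = Suc j" by (cases i) auto
    have jn: "j < n" using \<open>i \<le> n\<close> j by simp
    have aj: "a j \<le> y" using not_less_Least[of j "\<lambda>j. y < a j"] j by (auto simp: i_def[symmetric] not_less)
    have I: "?I j' (x k) = of_bool (j' = j)" if "j' < n" for j'
    proof -
      consider "j' < j" | "j' = j" | "j' > j" by linarith
      then show ?thesis
      proof cases
        case 1
        then have "a (Suc j') \<le> a j" using jn by (intro mono) auto
        then show ?thesis using aj 1 by (auto simp: y_def)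
      next
        case 2
        then show ?thesis using aj yi j by (auto simp: y_def)
      next
        case 3
        then have "a (Suc j) \<le> a j'" using that by (intro mono) auto
        then show ?thesis using yi j 3 by (auto simp: y_def)
      qed
    qed
    have "b k = (\<Sum>j'<n. if j' = j then cis (c * a j) else 0)"
      unfolding b_def by (intro sum.cong refl) (use I in auto)
    then have bk: "b k = cis (c * a j)" using jn by simp
    have "cis (c * x k) = cis (c * y)"
    proof -
      have "c * x k = c * y + 2 * pi * of_int (l * \<lfloor>x k\<rfloor>)" by (simp add: y_def c_def frac_def algebra_simps)
      then have "cis (c * x k) = cis (c * y) * cis (2 * pi * of_int (l * \<lfloor>x k\<rfloor>))" by (simp only: cis_mult)
      then show ?thesis using cis_multiple_2pi[of "of_int (l * \<lfloor>x k\<rfloor>)"] by (simp del: of_int_mult)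
    qed
    then have "norm (cis (c * x k) - b k) \<le> \<bar>c * y - c * a j\<bar>" using norm_cis_diff_le bk by simp
    also have "\<dots> = \<bar>c\<bar> * (y - a j)" using aj by (simp add: abs_mult flip: right_diff_distrib)
    also have "\<dots> \<le> \<bar>c\<bar> * (e / \<bar>c\<bar>)" using st(2)[OF jn] yi j by (intro mult_left_mono) auto
    also have "\<dots> = e" using c by simp
    finally show ?thesis .
  qed
  moreover have "norm (m' - 0) \<le> e"
  proof -
    \<comment> \<open>An antiderivative of \<open>cis (c * t)\<close>: its telescoping sum is the
      integral over \<open>[0, 1]\<close>, which vanishes as \<open>c\<close> is a multiple of
      \<open>2 * pi\<close>.\<close>
    let ?E = "\<lambda>t. cis (c * t) / (\<i> * of_real c)"
    have tel: "(\<Sum>j<n. ?E (a (Suc j)) - ?E (a j)) = 0"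
    proof -
      have "(\<Sum>j<n. ?E (a (Suc j)) - ?E (a j)) = ?E (a n) - ?E (a 0)" by (rule sum_lessThan_telescope)
      also have "cis (c * a n) = 1" unfolding a c_def using cis_multiple_2pi[of "of_int l"] by simp
      finally show ?thesis by (simp add: a)
    qed
    have "m' = (\<Sum>j<n. (a (Suc j) - a j) *\<^sub>R cis (c * a j) - (?E (a (Suc j)) - ?E (a j)))"
      unfolding m'_def sum_subtractf[of "\<lambda>j. (a (Suc j) - a j) *\<^sub>R cis (c * a j)"] tel by simp
    also have "norm \<dots> \<le> (\<Sum>j<n. e * (a (Suc j) - a j))"
    proof (rule order_trans[OF norm_sum], rule sum_mono)
      fix j assume "j \<in> {..<n}"
      then have j: "j < n" by simp
      have "((\<lambda>t. cis (c * a j) - cis (c * t)) has_integral ((a (Suc j) - a j) *\<^sub>R cis (c * a j) - (?E (a (Suc j)) - ?E (a j)))) {a j..a (Suc j)}"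
        using has_integral_diff[OF has_integral_const_real[of "cis (c * a j)" "a j" "a (Suc j)"] has_integral_cis[OF c(1) st(1)[OF j]]] st(1)[OF j] by simp
      then have "norm ((a (Suc j) - a j) *\<^sub>R cis (c * a j) - (?E (a (Suc j)) - ?E (a j))) \<le> e * Henstock_Kurzweil_Integration.content {a j..a (Suc j)}"
      proof (rule has_integral_bound_real[where S = "{}", rotated 2])
        fix t assume t: "t \<in> {a j..a (Suc j)} - {}"
        have "norm (cis (c * a j) - cis (c * t)) \<le> \<bar>c * a j - c * t\<bar>" by (rule norm_cis_diff_le)
        also have "\<dots> = \<bar>c\<bar> * (t - a j)" using t by (simp add: abs_mult abs_minus_commute flip: right_diff_distrib)
        also have "\<dots> \<le> \<bar>c\<bar> * (e / \<bar>c\<bar>)" using st(2)[OF j] t by (intro mult_left_mono) auto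
        also have "\<dots> = e" using c by simp
        finally show "norm (cis (c * a j) - cis (c * t)) \<le> e" .
      qed (use e in auto)
      then show "norm ((a (Suc j) - a j) *\<^sub>R cis (c * a j) - (?E (a (Suc j)) - ?E (a j))) \<le> e * (a (Suc j) - a j)"
        using st(1)[OF j] by simp
    qed
    also have "\<dots> = e * (a n - a 0)" by (simp add: sum_distrib_left[symmetric] sum_lessThan_telescope)
    finally show ?thesis by (simp add: a)
  qed
  ultimately show "\<exists>b m'. has_mean b m' \<and> (\<forall>k. norm (cis (2 * pi * of_int l * x k) - b k) \<le> e) \<and> norm (m' - 0) \<le> e"
    using mb unfolding c_def by blast
qed

section \<open>Decimal digits\<close>

text \<open>The integer with decimal digits \<open>S 0, ..., S (n - 1)\<close>, leading digit first;
  it keeps digit comparisons in integer arithmetic.\<close>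

fun prefix_value :: "(nat \<Rightarrow> nat) \<Rightarrow> nat \<Rightarrow> nat" where
  "prefix_value S 0 = 0"
| "prefix_value S (Suc n) = 10 * prefix_value S n + S n"

lemma ten_powi_minus: "10 powi (- int j) = (1::real) / 10 ^ j"
  by (simp add: power_int_minus divide_inverse)

lemma string_value_eq:
  assumes "K \<ge> 1"
  shows "string_value K S = real (prefix_value S K) / 10 ^ (K - 1)"
  using assms
proof (induction K rule: dec_induct)
  case base
  then show ?case by (simp add: string_value_def)
next
  case (step K)
  have "string_value (Suc K) S = string_value K S + real (S K) / 10 ^ K"
    by (simp add: string_value_def ten_powi_minus)
  also have "string_value K S = real (10 * prefix_value S K) / 10 ^ K"
    using step by (cases K) (auto simp: field_simps)
  finally show ?case by (simp add: add_divide_distrib)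
qed

lemma ten_powi_one_minus: "K \<ge> 1 \<Longrightarrow> 10 powi (1 - int K) = (1::real) / 10 ^ (K - 1)"
  using ten_powi_minus[of "K - 1"] by (simp add: of_nat_diff)

lemma prefix_value_bounds:
  assumes "digit_string K S" "n \<ge> 1" "n \<le> K"
  shows "10 ^ (n - 1) \<le> prefix_value S n" "prefix_value S n < 10 ^ n"
  using assms(2,3)
proof (induction n rule: dec_induct)
  case base
  { case 1 then show ?case using assms(1) by (auto simp: digit_string_def) }
  { case 2 then show ?case using assms(1) by (auto simp: digit_string_def less_Suc_eq_le dest: spec[of _ 0]) }
next
  case (step n)
  { case 1
    have "10 * 10 ^ (n - 1) \<le> 10 * prefix_value S n" using step 1 by simp
    then show ?case using step(1) by (cases n) auto }
  { case 2
    have "prefix_value S n + 1 \<le> 10 ^ n" using step 2 by simp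
    then have "10 * prefix_value S n + 10 \<le> 10 * 10 ^ n" by simp
    moreover have "S n \<le> 9" using assms(1) 2 by (auto simp: digit_string_def)
    ultimately show ?case by simp }
qed

lemma string_value_bounds:
  assumes "digit_string K S" "K \<ge> 1"
  shows "1 \<le> string_value K S" "string_value K S + 10 powi (1 - int K) \<le> 10"
proof -
  have b: "10 ^ (K - 1) \<le> prefix_value S K" "prefix_value S K + 1 \<le> 10 ^ K"
    using prefix_value_bounds[OF assms(1), of K] assms(2) by auto
  have "(10::real) ^ (K - 1) \<le> real (prefix_value S K)" using b(1) by (metis of_nat_le_iff of_nat_numeral of_nat_power)
  then show "1 \<le> string_value K S" using assms(2) by (simp add: string_value_eq)
  have "real (prefix_value S K + 1) \<le> 10 ^ K" using b(2) by (metis of_nat_le_iff of_nat_numeral of_nat_power)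
  also have "(10::real) ^ K = 10 * 10 ^ (K - 1)" using assms(2) by (cases K) auto
  finally show "string_value K S + 10 powi (1 - int K) \<le> 10"
    using assms(2) by (simp add: string_value_eq ten_powi_one_minus field_simps)
qed

text \<open>The digits from position \<open>K\<close> on are compared with all nines, whose value is
  \<open>10 powi (1 - int K)\<close>. The strict inequality is due to a later digit other than 9,
  which \<open>decimal_expansion\<close> guarantees.\<close>

lemma expansion_interval:
  assumes ex: "decimal_expansion a M d" and K: "K \<ge> 1"
  shows "string_value K d \<le> a / 10 powi M" "a / 10 powi M < string_value K d + 10 powi (1 - int K)"
proof -
  let ?t = "\<lambda>j. real (d j) * 10 powi (- int j)"
  let ?g = "\<lambda>j. (9 / 10 ^ K) * (1 / 10 :: real) ^ j"
  have sm: "summable ?t" and d9: "\<And>j. d j \<le> 9" and a: "a / 10 powi M = (\<Sum>j. ?t j)"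
    and nev: "\<not> (\<forall>\<^sub>F j in sequentially. d j = 9)"
    using ex unfolding decimal_expansion_def by auto
  have split: "(\<Sum>j. ?t j) = (\<Sum>j. ?t (j + K)) + string_value K d"
    unfolding string_value_def by (rule suminf_split_initial_segment[OF sm])
  have smK: "summable (\<lambda>j. ?t (j + K))" using sm by (subst summable_iff_shift)
  have "0 \<le> (\<Sum>j. ?t (j + K))" by (intro suminf_nonneg smK) auto
  then show "string_value K d \<le> a / 10 powi M" unfolding a split by simp
  have te: "?t (j + K) = (real (d (j + K)) / 10 ^ K) * (1 / 10) ^ j" for j
    by (simp only: ten_powi_minus power_add power_one_over) (simp add: mult_ac)
  have smg: "summable ?g" by (intro summable_mult summable_geometric) auto
  have le: "?t (j + K) \<le> ?g j" for j
    unfolding te using d9[of "j + K"] by (intro mult_right_mono divide_right_mono) auto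
  obtain j0 where j0: "j0 \<ge> K" "d j0 \<noteq> 9" using nev unfolding eventually_sequentially by auto
  then have "d (j0 - K + K) < 9" using d9[of j0] by simp
  then have lt: "?t ((j0 - K) + K) < ?g (j0 - K)"
    unfolding te by (intro mult_strict_right_mono divide_strict_right_mono) auto
  have "0 < (\<Sum>j. ?g j - ?t (j + K))"
    using le lt by (intro suminf_pos2[of _ "j0 - K"] summable_diff smg smK) auto
  then have "(\<Sum>j. ?t (j + K)) < (\<Sum>j. ?g j)"
    using suminf_diff[OF smg smK] by simp
  also have "(\<Sum>j. ?g j) = 9 / 10 ^ K * (1 / (1 - 1 / 10))"
    by (subst suminf_mult) (auto intro: summable_geometric simp: suminf_geometric)
  also have "\<dots> = 10 powi (1 - int K)" using K unfolding ten_powi_one_minus[OF K] by (cases K) auto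
  finally show "a / 10 powi M < string_value K d + 10 powi (1 - int K)" unfolding a split by simp
qed

lemma floor_ten: "\<lfloor>10 * z\<rfloor> div 10 = \<lfloor>z::real\<rfloor>"
  using floor_divide_real_eq_div[of 10 "10 * z"] by simp

text \<open>With these digits the partial sums telescope to
  \<open>\<lfloor>10 ^ n * y\<rfloor> / 10 ^ n\<close>, which is within \<open>1 / 10 ^ n\<close> of
  \<open>y\<close>.\<close>

lemma exists_expansion:
  assumes y: "1 \<le> y" "y < 10"
  defines "d \<equiv> \<lambda>j. nat (\<lfloor>10 ^ j * y\<rfloor> mod 10)"
  shows "decimal_expansion (10 powi M * y) M d"
proof -
  have dd: "real (d j) = real_of_int (\<lfloor>10 ^ j * y\<rfloor> mod 10)" for j by (simp add: d_def)
  have rec: "real (d (Suc j)) = real_of_int \<lfloor>10 ^ Suc j * y\<rfloor> - 10 * real_of_int \<lfloor>10 ^ j * y\<rfloor>" for j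
  proof -
    have "\<lfloor>10 ^ Suc j * y\<rfloor> = 10 * (\<lfloor>10 ^ Suc j * y\<rfloor> div 10) + \<lfloor>10 ^ Suc j * y\<rfloor> mod 10" by simp
    moreover have "\<lfloor>10 ^ Suc j * y\<rfloor> div 10 = \<lfloor>10 ^ j * y\<rfloor>" using floor_ten[of "10 ^ j * y"] by (simp add: mult_ac)
    ultimately have "\<lfloor>10 ^ Suc j * y\<rfloor> mod 10 = \<lfloor>10 ^ Suc j * y\<rfloor> - 10 * \<lfloor>10 ^ j * y\<rfloor>" by linarith
    then show ?thesis unfolding dd by simp
  qed
  have fy: "1 \<le> \<lfloor>y\<rfloor>" "\<lfloor>y\<rfloor> < 10" using y by (auto simp: le_floor_iff floor_less_iff)
  have d0: "int (d 0) = \<lfloor>y\<rfloor>" using fy by (simp add: d_def)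
  have part: "(\<Sum>j<Suc n. real (d j) * 10 powi (- int j)) = real_of_int \<lfloor>10 ^ n * y\<rfloor> / 10 ^ n" for n
  proof (induction n)
    case 0
    have "real (d 0) = real_of_int \<lfloor>y\<rfloor>" using d0 by (metis of_int_of_nat_eq)
    then show ?case by simp
  next
    case (Suc n)
    have "(\<Sum>j<Suc (Suc n). real (d j) * 10 powi (- int j)) = real_of_int \<lfloor>10 ^ n * y\<rfloor> / 10 ^ n + real (d (Suc n)) / 10 ^ Suc n"
      using Suc by (simp only: sum.lessThan_Suc[of _ "Suc n"] ten_powi_minus) simp
    also have "\<dots> = real_of_int \<lfloor>10 ^ Suc n * y\<rfloor> / 10 ^ Suc n"
      unfolding rec by (simp add: field_simps)
    finally show ?case .
  qed
  have "(\<lambda>n. real_of_int \<lfloor>10 ^ n * y\<rfloor> / 10 ^ n) \<longlonglongrightarrow> y"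
  proof (rule LIM_zero_cancel, rule Lim_null_comparison)
    show "\<forall>\<^sub>F n in sequentially. norm (real_of_int \<lfloor>10 ^ n * y\<rfloor> / 10 ^ n - y) \<le> (1 / 10) ^ n"
    proof (rule always_eventually, rule allI)
      fix n
      have "real_of_int \<lfloor>10 ^ n * y\<rfloor> / 10 ^ n - y = (real_of_int \<lfloor>10 ^ n * y\<rfloor> - 10 ^ n * y) / 10 ^ n" by (simp add: field_simps)
      also have "norm \<dots> = \<bar>real_of_int \<lfloor>10 ^ n * y\<rfloor> - 10 ^ n * y\<bar> / 10 ^ n" by simp
      also have "\<dots> \<le> 1 / 10 ^ n" by (intro divide_right_mono) (linarith, simp)
      finally show "norm (real_of_int \<lfloor>10 ^ n * y\<rfloor> / 10 ^ n - y) \<le> (1 / 10) ^ n" by (simp add: power_divide)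
    qed
    show "(\<lambda>n. (1 / 10 :: real) ^ n) \<longlonglongrightarrow> 0" by (rule LIMSEQ_power_zero) simp
  qed
  then have sums: "(\<lambda>j. real (d j) * 10 powi (- int j)) sums y"
    unfolding sums_def by (rule LIMSEQ_imp_Suc[where f = "\<lambda>n. \<Sum>j<n. real (d j) * 10 powi (- int j)", unfolded part])
  have "\<not> (\<forall>\<^sub>F j in sequentially. d j = 9)"
  proof
    assume "\<forall>\<^sub>F j in sequentially. d j = 9"
    then obtain J where J: "\<And>j. j \<ge> J \<Longrightarrow> d j = 9" by (auto simp: eventually_sequentially)
    \<comment> \<open>The distance of \<open>10 ^ n * y\<close> to the next integer above. A run of
      nines multiplies it by 10 at each step, yet it stays in \<open>(0, 1]\<close>.\<close>
    define u where "u = (\<lambda>n. 1 - frac (10 ^ n * y))"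
    have pos: "u n > 0" "u n \<le> 1" for n by (auto simp: u_def frac_lt_1)
    have "u (Suc n) = 10 * u n" if "Suc n \<ge> J" for n
      using rec[of n] J[OF that] by (simp add: u_def frac_def algebra_simps)
    then have "u (J + n) = 10 ^ n * u J" for n by (induction n) auto
    moreover obtain n where "1 / u J < 10 ^ n" using real_arch_pow[of 10 "1 / u J"] by auto
    then have "10 ^ n * u J > 1" using pos(1)[of J] by (simp add: divide_less_eq)
    ultimately show False using pos(2)[of "J + n"] by simp
  qed
  moreover have "1 \<le> d 0" using d0 fy by linarith
  moreover have "d j \<le> 9" for j using pos_mod_bound[of 10 "\<lfloor>10 ^ j * y\<rfloor>"] by (simp add: d_def nat_le_iff)
  ultimately show ?thesis using sums unfolding decimal_expansion_def by (auto simp: sums_iff)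
qed

text \<open>The significand of \<open>a\<close> is \<open>10 powr frac (log 10 a)\<close>, and
  fixing its first \<open>K\<close> digits confines it to a half-open interval starting at
  \<open>string_value K S\<close>. Conversely, that interval determines the integer part of
  \<open>10 ^ (K - 1)\<close> times the significand; earlier digits follow by repeated division by
  10, hence the downward induction.\<close>

lemma first_digits_iff:
  assumes S: "digit_string K S" and K: "K \<ge> 1" and a: "a > 0"
  shows "first_digits K S a \<longleftrightarrow> log 10 (string_value K S) \<le> frac (log 10 a) \<and>
     frac (log 10 a) < log 10 (string_value K S + 10 powi (1 - int K))"
proof
  let ?r = "string_value K S"
  have r: "1 \<le> ?r" "?r + 10 powi (1 - int K) \<le> 10" using string_value_bounds[OF S K] by auto
  {
    assume "first_digits K S a"
    then obtain M d where ex: "decimal_expansion a M d" and dS: "\<And>j. j < K \<Longrightarrow> d j = S j" by (auto simp: first_digits_def)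
    have sv: "string_value K d = ?r" unfolding string_value_def using dS by simp
    define y where "y = a / 10 powi M"
    have y: "?r \<le> y" "y < ?r + 10 powi (1 - int K)" using expansion_interval[OF ex K] by (auto simp: sv y_def)
    have y1: "1 \<le> y" "y < 10" using y r by linarith+
    have "a = 10 powi M * y" by (simp add: y_def)
    then have "log 10 a = log 10 (10 powr of_int M * y)" by (simp add: powr_real_of_int')
    then have "log 10 a = of_int M + log 10 y" using y1 by (simp add: log_mult)
    moreover have "0 \<le> log 10 y" "log 10 y < 1" using y1 by auto
    ultimately have fr: "frac (log 10 a) = log 10 y" by (simp add: frac_eq add.commute)
    show "log 10 ?r \<le> frac (log 10 a) \<and> frac (log 10 a) < log 10 (?r + 10 powi (1 - int K))"
      unfolding fr using y y1 r by auto
  }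
  {
    assume h: "log 10 ?r \<le> frac (log 10 a) \<and> frac (log 10 a) < log 10 (?r + 10 powi (1 - int K))"
    define y where "y = 10 powr frac (log 10 a)"
    define M where "M = \<lfloor>log 10 a\<rfloor>"
    have y1: "1 \<le> y" "y < 10" using frac_lt_1[of "log 10 a"] powr_less_mono[of "frac (log 10 a)" 1 10] ge_one_powr_ge_zero[of 10 "frac (log 10 a)"] by (auto simp: y_def)
    have "10 powr log 10 a = 10 powr (of_int M + frac (log 10 a))" by (simp add: M_def frac_def)
    then have aM: "a = 10 powi M * y" using a by (simp add: powr_add y_def powr_real_of_int')
    have "?r = 10 powr (log 10 ?r)" using r by simp
    also have "\<dots> \<le> y" using h unfolding y_def by (intro powr_mono) auto
    finally have ry: "?r \<le> y" .
    have "y < 10 powr (log 10 (?r + 10 powi (1 - int K)))" using h unfolding y_def by (intro powr_less_mono) auto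
    also have "\<dots> = ?r + 10 powi (1 - int K)" using r by (simp add: add_pos_pos)
    finally have yr: "y < ?r + 10 powi (1 - int K)" .
    define d where "d = (\<lambda>j. nat (\<lfloor>10 ^ j * y\<rfloor> mod 10))"
    have ex: "decimal_expansion a M d" unfolding aM d_def by (rule exists_expansion[OF y1])
    have "\<lfloor>10 ^ (K - 1) * y\<rfloor> = int (prefix_value S K)"
    proof (rule floor_unique)
      show "of_int (int (prefix_value S K)) \<le> 10 ^ (K - 1) * y"
        using ry K by (simp add: string_value_eq field_simps)
      show "10 ^ (K - 1) * y < of_int (int (prefix_value S K)) + 1"
        using yr K by (simp add: string_value_eq ten_powi_one_minus field_simps)
    qed
    then have top: "\<lfloor>10 ^ (K - 1) * y\<rfloor> = int (prefix_value S (Suc (K - 1)))" using K by simp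
    have S9: "j < K \<Longrightarrow> S j \<le> 9" for j using S by (simp add: digit_string_def)
    have fl: "j \<le> K - 1 \<Longrightarrow> \<lfloor>10 ^ j * y\<rfloor> = int (prefix_value S (Suc j))" for j
    proof (induction j rule: inc_induct)
      case (step j)
      have "\<lfloor>10 ^ j * y\<rfloor> = \<lfloor>10 ^ Suc j * y\<rfloor> div 10" using floor_ten[of "10 ^ j * y"] by (simp add: mult_ac)
      also have "\<dots> = int (prefix_value S (Suc (Suc j))) div 10" using step by simp
      also have "\<dots> = int (prefix_value S (Suc (Suc j)) div 10)" by (simp only: zdiv_int of_nat_numeral)
      also have "prefix_value S (Suc (Suc j)) div 10 = prefix_value S (Suc j)"
      proof -
        have "S (Suc j) \<le> 9" using step(2) by (intro S9) linarith
        then show ?thesis unfolding prefix_value.simps(2)[of S "Suc j"] by (simp del: prefix_value.simps)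
      qed
      finally show ?case .
    qed (rule top)
    have "d j = S j" if "j < K" for j
    proof -
      have "d j = prefix_value S (Suc j) mod 10" using fl[of j] that by (simp add: d_def nat_mod_distrib del: prefix_value.simps)
      then show ?thesis using S9[OF that] by simp
    qed
    with ex show "first_digits K S a" by (auto simp: first_digits_def)
  }
qed

section \<open>Benford sequences and the pretentious distance\<close>

lemma has_mean_cong:
  assumes "\<And>k. k \<ge> 1 \<Longrightarrow> a k = b k"
  shows "has_mean a m \<longleftrightarrow> has_mean b m"
proof -
  have "(\<Sum>k=1..N. a k) = (\<Sum>k=1..N. b k)" for N using assms by (intro sum.cong) auto
  then show ?thesis by (simp add: has_mean_def)
qed

lemma strong_benford_iff_has_mean:
  "strong_benford h \<longleftrightarrow> (\<forall>K\<ge>1. \<forall>S. digit_string K S \<longrightarrow>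
     has_mean (\<lambda>k. of_bool (first_digits K S \<bar>h k\<bar>)) (log 10 (string_value K S + 10 powi (1 - int K)) - log 10 (string_value K S)))"
proof -
  have "real (card {k \<in> {1..N}. first_digits K S \<bar>h k\<bar>}) / real N = (\<Sum>k=1..N. of_bool (first_digits K S \<bar>h k\<bar>)) /\<^sub>R real N" for K S N
    by (simp add: of_bool_def sum.inter_filter[symmetric] divide_inverse mult.commute)
  then show ?thesis by (simp add: strong_benford_def strong_benford_pos_def has_mean_def)
qed

lemma prefix_value_cong: "(\<And>j. j < n \<Longrightarrow> S j = T j) \<Longrightarrow> prefix_value S n = prefix_value T n"
  by (induction n) auto

lemma exists_digit_string:
  "10 ^ m \<le> D \<Longrightarrow> D < 10 ^ Suc m \<Longrightarrow> \<exists>S. digit_string (Suc m) S \<and> prefix_value S (Suc m) = D"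
proof (induction m arbitrary: D)
  case 0
  then show ?case by (intro exI[of _ "\<lambda>_. D"]) (auto simp: digit_string_def)
next
  case (Suc m)
  have "10 ^ m \<le> D div 10" "D div 10 < 10 ^ Suc m"
    using Suc.prems by (auto simp: less_eq_div_iff_mult_less_eq div_less_iff_less_mult mult_ac)
  from Suc.IH[OF this] obtain S where S: "digit_string (Suc m) S" "prefix_value S (Suc m) = D div 10" by blast
  define T where "T = S(Suc m := D mod 10)"
  have "prefix_value T (Suc m) = D div 10"
    unfolding S(2)[symmetric] by (rule prefix_value_cong) (auto simp: T_def)
  then have "prefix_value T (Suc (Suc m)) = D" by (subst prefix_value.simps(2)) (simp add: T_def)
  moreover have "digit_string (Suc (Suc m)) T" using S(1) by (auto simp: digit_string_def T_def less_Suc_eq)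
  ultimately show ?case by blast
qed

lemma benford_char_eq_cis: "benford_char h l n = cis (2 * pi * of_int l * log 10 \<bar>h n\<bar>)"
  by (simp add: benford_char_def cis_conv_exp mult_ac)

text \<open>\<open>ln z \<le> z - 1\<close> bounds each step in natural logarithms, and
  \<open>ln 10 \<ge> 1\<close> makes base 10 no worse.\<close>

lemma log_mesh:
  fixes q :: real
  assumes "q > 0"
  shows "log 10 (1 + real j / q) \<le> log 10 (1 + real (Suc j) / q)"
    and "log 10 (1 + real (Suc j) / q) - log 10 (1 + real j / q) \<le> 1 / q"
proof -
  have p: "1 + real j / q > 0" "1 + real (Suc j) / q > 0" using assms by (auto intro!: add_pos_nonneg)
  have "real j / q \<le> real (Suc j) / q" using assms by (intro divide_right_mono) auto
  then show "log 10 (1 + real j / q) \<le> log 10 (1 + real (Suc j) / q)" using p by simp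
  have "exp 1 \<le> (10::real)" using exp_le by simp
  then have l10: "ln 10 \<ge> (1::real)" by (subst ln_ge_iff) auto
  define z where "z = (1 + real (Suc j) / q) / (1 + real j / q)"
  have z: "z > 0" using p by (simp add: z_def)
  have "1 + real (Suc j) / q = (1 + real j / q) + 1 / q" by (simp add: add_divide_distrib)
  then have "z - 1 = ((1 + real j / q) + 1 / q) / (1 + real j / q) - 1" by (simp only: z_def)
  also have "\<dots> = (1 / q) / (1 + real j / q)"
    using p(1) by (simp only: add_divide_distrib[of "1 + real j / q" "1 / q"]) simp
  also have "\<dots> \<le> (1 / q) / 1" using assms p by (intro divide_left_mono) auto
  finally have "ln z \<le> 1 / q" using ln_le_minus_one[OF z] by simp
  then have "ln z / ln 10 \<le> (1 / q) / ln 10" using l10 by (intro divide_right_mono) auto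
  also have "\<dots> \<le> (1 / q) / 1" using assms l10 by (intro divide_left_mono) auto
  finally show "log 10 (1 + real (Suc j) / q) - log 10 (1 + real j / q) \<le> 1 / q"
    using p by (simp add: z_def log_def ln_div diff_divide_distrib)
qed

text \<open>The strings of length \<open>m + 1\<close> cut \<open>[0, 1)\<close> at the points
  \<open>log 10 (1 + j / 10 ^ m)\<close>, and the Benford frequency of each cell is its length;
  refining \<open>m\<close> gives the partitions for Weyl sums. In the other direction each string
  is a single interval.\<close>

lemma strong_benford_iff_weyl:
  assumes h: "\<forall>n\<ge>1. h n \<noteq> 0"
  shows "strong_benford h \<longleftrightarrow> (\<forall>l::int. l \<noteq> 0 \<longrightarrow> has_mean (benford_char h l) 0)"
proof
  define x where "x = (\<lambda>k. log 10 \<bar>h k\<bar>)"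
  have fd: "has_mean (\<lambda>k. of_bool (first_digits K S \<bar>h k\<bar>) :: real) m \<longleftrightarrow>
    has_mean (\<lambda>k. of_bool (log 10 (string_value K S) \<le> frac (x k) \<and> frac (x k) < log 10 (string_value K S + 10 powi (1 - int K)))) m"
    if "K \<ge> 1" "digit_string K S" for K S m
    using that h by (intro has_mean_cong) (simp add: first_digits_iff x_def)
  have bc: "benford_char h l = (\<lambda>k. cis (2 * pi * of_int l * x k))" for l
    by (simp add: fun_eq_iff benford_char_eq_cis x_def)
  {
    assume B: "strong_benford h"
    show "\<forall>l::int. l \<noteq> 0 \<longrightarrow> has_mean (benford_char h l) 0"
      unfolding bc
    proof (intro allI impI, rule weyl_if_equidistributed_steps)
      fix e :: real assume "e > 0"
      then obtain m where m: "(1 / 10 :: real) ^ m < e" using real_arch_pow_inv[of e "1 / 10"] by auto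
      define q where "q = (10::real) ^ m"
      have q: "q > 0" "1 / q \<le> e" using m by (auto simp: q_def power_one_over)
      define a where "a = (\<lambda>j. log 10 (1 + real j / q))"
      have "a j \<le> a (Suc j) \<and> a (Suc j) - a j \<le> e \<and>
        has_mean (\<lambda>k. of_bool (a j \<le> frac (x k) \<and> frac (x k) < a (Suc j))) (a (Suc j) - a j :: real)" if j: "j < 9 * 10 ^ m" for j
      proof (intro conjI)
        show "a j \<le> a (Suc j)" unfolding a_def by (rule log_mesh(1)[OF q(1)])
        show "a (Suc j) - a j \<le> e" using log_mesh(2)[OF q(1), of j] q(2) unfolding a_def by linarith
        \<comment> \<open>The \<open>j\<close>-th cell belongs to the digits of the integer
          \<open>10 ^ m + j\<close>, which has \<open>m + 1\<close> of them.\<close>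
        have "10 ^ m \<le> 10 ^ m + j" "10 ^ m + j < 10 ^ Suc m" using j by auto
        from exists_digit_string[OF this] obtain S where S: "digit_string (Suc m) S" "prefix_value S (Suc m) = 10 ^ m + j" by blast
        have sv: "string_value (Suc m) S = 1 + real j / q"
          using string_value_eq[of "Suc m" S] unfolding S(2) by (simp add: q_def add_divide_distrib)
        have "10 powi (1 - int (Suc m)) = 1 / q" using ten_powi_one_minus[of "Suc m"] by (simp add: q_def)
        then have sv': "string_value (Suc m) S + 10 powi (1 - int (Suc m)) = 1 + real (Suc j) / q"
          unfolding sv by (simp add: add_divide_distrib)
        have "has_mean (\<lambda>k. of_bool (first_digits (Suc m) S \<bar>h k\<bar>)) (log 10 (string_value (Suc m) S + 10 powi (1 - int (Suc m))) - log 10 (string_value (Suc m) S))"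
          by (rule B[unfolded strong_benford_iff_has_mean, rule_format]) (use S(1) in auto)
        then have "has_mean (\<lambda>k. of_bool (log 10 (string_value (Suc m) S) \<le> frac (x k) \<and> frac (x k) < log 10 (string_value (Suc m) S + 10 powi (1 - int (Suc m))))) (log 10 (string_value (Suc m) S + 10 powi (1 - int (Suc m))) - log 10 (string_value (Suc m) S))"
          using S(1) by (subst (asm) fd) auto
        then show "has_mean (\<lambda>k. of_bool (a j \<le> frac (x k) \<and> frac (x k) < a (Suc j))) (a (Suc j) - a j)"
          unfolding sv' unfolding sv a_def .
      qed
      moreover have "a 0 = 0" by (simp add: a_def)
      moreover have "a (9 * 10 ^ m) = 1"
      proof -
        have "1 + real (9 * 10 ^ m) / q = 10" by (simp add: q_def)
        then show ?thesis unfolding a_def by simp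
      qed
      ultimately show "\<exists>n a. a 0 = 0 \<and> a n = 1 \<and> (\<forall>j<n. a j \<le> a (Suc j) \<and> a (Suc j) - a j \<le> e \<and>
        has_mean (\<lambda>k. of_bool (a j \<le> frac (x k) \<and> frac (x k) < a (Suc j))) (a (Suc j) - a j :: real))"
        by blast
    qed
  }
  {
    assume W: "\<forall>l::int. l \<noteq> 0 \<longrightarrow> has_mean (benford_char h l) 0"
    show "strong_benford h"
      unfolding strong_benford_iff_has_mean
    proof (intro allI impI)
      fix K :: nat and S assume K: "K \<ge> 1" and S: "digit_string K S"
      note b = string_value_bounds[OF S K]
      have p: "(0::real) < 10 powi (1 - int K)" by simp
      show "has_mean (\<lambda>k. of_bool (first_digits K S \<bar>h k\<bar>)) (log 10 (string_value K S + 10 powi (1 - int K)) - log 10 (string_value K S))"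
        unfolding fd[OF K S]
      proof (rule equidistributed_if_weyl)
        show "has_mean (\<lambda>k. cis (2 * pi * of_int l * x k)) 0" if "l \<noteq> 0" for l :: int
          using W that unfolding bc by blast
        show "0 \<le> log 10 (string_value K S)" using b by simp
        show "log 10 (string_value K S) < log 10 (string_value K S + 10 powi (1 - int K))"
        proof -
          have "log 10 s < log 10 (s + t)" if "0 < s" "0 < t" for s t :: real using that by simp
          then show ?thesis using b(1) p by (meson less_le_trans zero_less_one)
        qed
        show "log 10 (string_value K S + 10 powi (1 - int K)) \<le> 1"
        proof -
          have "log 10 s \<le> 1" if "1 \<le> s" "s \<le> 10" for s :: real using that by simp
          moreover have "1 \<le> string_value K S + 10 powi (1 - int K)" using b(1) p by linarith
          ultimately show ?thesis using b(2) by blast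
        qed
      qed
    qed
  }
qed

lemma unimodular_benford_char:
  assumes "multiplicative_fun h" "\<forall>n\<ge>1. h n \<noteq> 0"
  shows "unimodular (benford_char h l)"
proof
  fix m n :: nat assume mn: "m \<ge> 1" "n \<ge> 1" "coprime m n"
  then have "h (m * n) = h m * h n" using assms(1) by (auto simp: multiplicative_fun_def)
  then have "log 10 \<bar>h (m * n)\<bar> = log 10 \<bar>h m\<bar> + log 10 \<bar>h n\<bar>"
    using assms(2) mn by (simp add: abs_mult log_mult)
  then show "benford_char h l (m * n) = benford_char h l m * benford_char h l n"
    by (simp add: benford_char_eq_cis cis_mult distrib_left)
qed (simp add: benford_char_eq_cis)

section \<open>The distance as a sum over primes\<close>

context unimodular
begin

lemma has_mean_iff: "has_mean f 0 \<longleftrightarrow> (\<lambda>N. partial_sum N / of_nat N) \<longlonglongrightarrow> 0"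
  by (simp add: has_mean_def partial_sum_def scaleR_conv_of_real divide_inverse mult.commute)

lemma pretentious_dist_eq:
  "pretentious_dist f (\<lambda>n. of_nat n powr (\<i> * of_real \<alpha>)) x = sqrt (\<Sum>p | prime p \<and> real p \<le> x. defect \<alpha> p / real p)"
proof -
  have "1 - Re (f p * cnj (of_nat p powr (\<i> * of_real \<alpha>))) = defect \<alpha> p" if "prime p" for p
  proof -
    have "p > 0" using that prime_gt_0_nat by blast
    then have "of_nat p powr (\<i> * of_real \<alpha>) = cis (\<alpha> * ln (real p))"
      by (simp add: powr_def cis_conv_exp mult_ac flip: Ln_of_nat)
    then show ?thesis by (simp add: defect_def cis_cnj)
  qed
  then show ?thesis unfolding pretentious_dist_def by (intro arg_cong[of _ _ sqrt] sum.cong) auto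
qed

text \<open>Since defects are nonnegative, initial segments of the primes and arbitrary finite sets
  have the same suprema. The latter form fits the finite Euler products.\<close>

lemma pretentious_dist_inf_iff:
  "pretentious_dist_inf f (\<lambda>n. of_nat n powr (\<i> * of_real \<alpha>)) = \<infinity> \<longleftrightarrow>
    (\<forall>M. \<exists>Q. finite Q \<and> (\<forall>q\<in>Q. prime q) \<and> (\<Sum>p\<in>Q. defect \<alpha> p / real p) > M)"
proof -
  define G where "G = (\<lambda>x::real. \<Sum>p | prime p \<and> real p \<le> x. defect \<alpha> p / real p)"
  have fin: "finite {p::nat. prime p \<and> real p \<le> x}" for x :: real
    by (rule finite_subset[of _ "{..nat \<lfloor>x\<rfloor>}"]) (auto simp: le_nat_floor)
  have nn: "0 \<le> defect \<alpha> p / real p" if "prime p" for p using defect_nonneg[OF that] by simp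
  have G_ge: "(\<Sum>p\<in>Q. defect \<alpha> p / real p) \<le> G x" if "\<forall>q\<in>Q. prime q \<and> real q \<le> x" for Q x
    unfolding G_def using that nn by (intro sum_mono2 fin) auto
  have mono: "G x \<le> G y" if "x \<le> y" for x y
  proof -
    have "G x = (\<Sum>p | prime p \<and> real p \<le> x. defect \<alpha> p / real p)" by (simp only: G_def)
    also have "\<dots> \<le> G y" using that by (intro G_ge) auto
    finally show ?thesis .
  qed
  have D: "pretentious_dist_inf f (\<lambda>n. of_nat n powr (\<i> * of_real \<alpha>)) = Lim at_top (\<lambda>x::real. ereal (sqrt (G x)))"
    unfolding pretentious_dist_inf_def pretentious_dist_eq G_def ..
  show ?thesis
  proof (cases "\<forall>M. \<exists>Q. finite Q \<and> (\<forall>q\<in>Q. prime q) \<and> (\<Sum>p\<in>Q. defect \<alpha> p / real p) > M")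
    case True
    have "filterlim (\<lambda>x. sqrt (G x)) at_top at_top"
      unfolding filterlim_at_top
    proof
      fix Z :: real
      obtain Q where Q: "finite Q" "\<forall>q\<in>Q. prime q" "(\<Sum>p\<in>Q. defect \<alpha> p / real p) > Z\<^sup>2" using True by blast
      show "\<forall>\<^sub>F x in at_top. Z \<le> sqrt (G x)"
        using eventually_ge_at_top[of "\<Sum>q\<in>Q. real q"]
      proof eventually_elim
        case (elim x)
        have "real q \<le> x" if "q \<in> Q" for q
          using member_le_sum[OF that, of real] Q(1) elim by auto
        then have "(\<Sum>p\<in>Q. defect \<alpha> p / real p) \<le> G x" using Q(2) by (intro G_ge) auto
        then have "Z\<^sup>2 \<le> G x" using Q(3) by linarith
        then show ?case by (rule real_le_rsqrt)
      qed
    qed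
    then have "((\<lambda>x. ereal (sqrt (G x))) \<longlongrightarrow> \<infinity>) at_top" by (simp add: tendsto_PInfty_eq_at_top)
    then have "Lim at_top (\<lambda>x::real. ereal (sqrt (G x))) = \<infinity>" by (intro tendsto_Lim) auto
    with True show ?thesis unfolding D by simp
  next
    case False
    then obtain M where "\<not> (\<exists>Q. finite Q \<and> (\<forall>q\<in>Q. prime q) \<and> (\<Sum>p\<in>Q. defect \<alpha> p / real p) > M)" by blast
    then have M: "(\<Sum>p\<in>Q. defect \<alpha> p / real p) \<le> M" if "finite Q" "\<forall>q\<in>Q. prime q" for Q
      using that by (meson not_less)
    \<comment> \<open>\<open>Lim\<close> is informative only if the limit exists, so convergence has
      to be shown in the bounded case too: a monotone function tends to its supremum.\<close>
    let ?s = "SUP x. ereal (sqrt (G x))"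
    have "((\<lambda>x. ereal (sqrt (G x))) \<longlongrightarrow> ?s) at_top"
    proof (rule order_tendstoI)
      fix y assume "y < ?s"
      then obtain x0 where x0: "y < ereal (sqrt (G x0))" by (auto simp: less_SUP_iff)
      show "\<forall>\<^sub>F x in at_top. y < ereal (sqrt (G x))"
        using eventually_ge_at_top[of x0]
      proof eventually_elim
        case (elim x)
        have "ereal (sqrt (G x0)) \<le> ereal (sqrt (G x))" using mono[OF elim] by simp
        with x0 show ?case by (rule less_le_trans)
      qed
    next
      fix y assume y: "?s < y"
      have "ereal (sqrt (G x)) < y" for x using y SUP_upper[of x UNIV "\<lambda>x. ereal (sqrt (G x))"] by (simp add: le_less_trans)
      then show "\<forall>\<^sub>F x in at_top. ereal (sqrt (G x)) < y" by simp
    qed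
    then have "Lim at_top (\<lambda>x::real. ereal (sqrt (G x))) = ?s" by (intro tendsto_Lim) auto
    moreover have "?s \<le> ereal (sqrt M)"
      by (rule SUP_least) (use M[OF fin] in \<open>auto simp: G_def\<close>)
    ultimately have le: "Lim at_top (\<lambda>x::real. ereal (sqrt (G x))) \<le> ereal (sqrt M)" by (simp only:)
    have "Lim at_top (\<lambda>x::real. ereal (sqrt (G x))) \<noteq> \<infinity>"
    proof
      assume "Lim at_top (\<lambda>x::real. ereal (sqrt (G x))) = \<infinity>"
      with le show False by simp
    qed
    with False show ?thesis unfolding D by blast
  qed
qed

end

theorem theorem2p2:
  fixes h :: "nat \<Rightarrow> real"
  assumes "multiplicative_fun h"
    and "\<forall>n\<ge>1. h n \<noteq> 0"
  shows "strong_benford h \<longleftrightarrow>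
    (\<forall>(\<alpha>::real) (l::int). l \<noteq> 0 \<longrightarrow>
       pretentious_dist_inf (benford_char h l) (\<lambda>n. of_nat n powr (\<i> * of_real \<alpha>)) = \<infinity>)"
proof
  have U: "unimodular (benford_char h l)" for l by (rule unimodular_benford_char[OF assms])
  note W = strong_benford_iff_weyl[OF assms(2)]
  {
    assume D: "\<forall>(\<alpha>::real) (l::int). l \<noteq> 0 \<longrightarrow>
       pretentious_dist_inf (benford_char h l) (\<lambda>n. of_nat n powr (\<i> * of_real \<alpha>)) = \<infinity>"
    have "has_mean (benford_char h l) 0" if l: "l \<noteq> 0" for l :: int
    proof -
      interpret unimodular "benford_char h l" by (rule U)
      show ?thesis unfolding has_mean_iff
        by (rule mean_value_zero) (use D l pretentious_dist_inf_iff in blast)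
    qed
    then show "strong_benford h" unfolding W by blast
  }
  {
    assume B: "strong_benford h"
    show "\<forall>(\<alpha>::real) (l::int). l \<noteq> 0 \<longrightarrow>
       pretentious_dist_inf (benford_char h l) (\<lambda>n. of_nat n powr (\<i> * of_real \<alpha>)) = \<infinity>"
    proof (intro allI impI, rule ccontr)
      fix \<alpha> :: real and l :: int
      assume l: "l \<noteq> 0" and ne: "pretentious_dist_inf (benford_char h l) (\<lambda>n. of_nat n powr (\<i> * of_real \<alpha>)) \<noteq> \<infinity>"
      interpret f: unimodular "benford_char h l" by (rule U)
      \<comment> \<open>The frequency \<open>2 * l\<close> is the square of the character of
        frequency \<open>l\<close>; being nonzero, it is subject to strong Benford as well.\<close>
      interpret g: unimodular "benford_char h (2 * l)" by (rule U)
      obtain C where "\<not> (\<exists>Q. finite Q \<and> (\<forall>q\<in>Q. prime q) \<and> (\<Sum>p\<in>Q. f.defect \<alpha> p / real p) > C)"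
        using ne unfolding f.pretentious_dist_inf_iff by blast
      then have C: "(\<Sum>p\<in>Q. f.defect \<alpha> p / real p) \<le> C" if "finite Q" "\<forall>q\<in>Q. prime q" for Q
        using that by (meson not_less)
      have mf: "(\<lambda>N. f.partial_sum N / of_nat N) \<longlonglongrightarrow> 0" using B l unfolding W f.has_mean_iff[symmetric] by blast
      have mg: "(\<lambda>N. g.partial_sum N / of_nat N) \<longlonglongrightarrow> 0" using B l unfolding W g.has_mean_iff[symmetric] by simp
      have sq: "benford_char h (2 * l) n = (benford_char h l n)\<^sup>2" for n
        by (simp add: benford_char_eq_cis power2_eq_square cis_mult mult_ac)
      have dg: "g.defect (2 * \<alpha>) p = 1 - Re ((benford_char h l p * cis (- \<alpha> * ln (real p)))\<^sup>2)" for p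
      proof -
        have "cis (- (2 * \<alpha>) * ln (real p)) = (cis (- \<alpha> * ln (real p)))\<^sup>2"
          by (simp add: power2_eq_square cis_mult mult_ac)
        then show ?thesis by (simp only: g.defect_def sq power_mult_distrib)
      qed
      \<comment> \<open>For \<open>z = cis u\<close> this is
        \<open>1 - cos (2 * u) \<le> 4 * (1 - cos u)\<close>, so pretentiousness passes to the
        square with twice the exponent.\<close>
      have le: "g.defect (2 * \<alpha>) p \<le> 4 * f.defect \<alpha> p" if "prime p" for p
      proof -
        define z where "z = benford_char h l p * cis (- \<alpha> * ln (real p))"
        have nz: "norm z = 1" by (simp add: z_def norm_mult benford_char_eq_cis)
        then have "(Re z)\<^sup>2 + (Im z)\<^sup>2 = 1" by (metis cmod_power2 one_power2)
        then have "1 - Re (z\<^sup>2) = 2 * ((1 - Re z) * (1 + Re z))" by (simp add: power2_eq_square algebra_simps)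
        also have "\<dots> \<le> 2 * ((1 - Re z) * 2)"
          using abs_Re_le_cmod[of z] nz by (intro mult_left_mono) auto
        finally show ?thesis unfolding dg f.defect_def z_def[symmetric] by simp
      qed
      have Cg: "(\<Sum>p\<in>Q. g.defect (2 * \<alpha>) p / real p) \<le> 4 * C" if Q: "finite Q" "\<forall>q\<in>Q. prime q" for Q
      proof -
        have "(\<Sum>p\<in>Q. g.defect (2 * \<alpha>) p / real p) \<le> (\<Sum>p\<in>Q. 4 * (f.defect \<alpha> p / real p))"
          using le Q by (intro sum_mono) (auto simp: divide_right_mono)
        also have "\<dots> \<le> 4 * C" unfolding sum_distrib_left[symmetric] using C[OF Q] by simp
        finally show ?thesis .
      qed
      have "\<not> (\<exists>k\<ge>1. f.coef \<alpha> 2 k \<noteq> -1)" using f.mean_value_nonzero[OF C] mf by blast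
      \<comment> \<open>One exceptional value is enough: squaring turns the -1 at
        \<open>k = 1\<close> into 1, so the square meets the condition of
        \<open>mean_value_nonzero\<close>.\<close>
      then have "f.coef \<alpha> 2 1 = -1" by auto
      moreover have "g.coef (2 * \<alpha>) 2 1 = (f.coef \<alpha> 2 1)\<^sup>2"
      proof -
        have "cis (- (2 * \<alpha>) * ln 2) = (cis (- \<alpha> * ln 2))\<^sup>2"
          by (simp add: power2_eq_square cis_mult mult_ac)
        then show ?thesis
          by (simp only: f.coef_def g.coef_def sq power_one_right of_nat_numeral power_mult_distrib)
      qed
      ultimately have "g.coef (2 * \<alpha>) 2 1 \<noteq> -1" by simp
      then show False using g.mean_value_nonzero[OF Cg] mg by blast
    qed
  }
qed

end
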